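(* For any real $C>1$, let $$\widehat M(C):=\{x\in\mathbb I: M_n(x)\ge C^n\ \text{for all sufficiently large } n\in\mathbb N\}.$$ Then $$\dim_{\rm H}\widehat M(C)=\widehat\theta(\log C),$$ where $\widehat\theta(\log C)$ is the unique solution $\theta\in(1/2,\infty)$ of $$\mathrm P(\theta)=\left(\sqrt\theta+\sqrt{2\theta-1}\right)^2\log C.$$
   Context: $\mathbb N=\{1,2,3,\dots\}$ and $\mathbb I:=[0,1)\setminus\mathbb Q$. For $x\in\mathbb I$, $a_1(x),a_2(x),\dots\in\mathbb N$ are the coefficients (partial quotients) of its continued fraction expansion $x=[a_1(x),a_2(x),\dots]=1/(a_1(x)+1/(a_2(x)+\cdots))$, and $M_n(x):=\max\{a_1(x),\dots,a_n(x)\}$. For positive integers $a_1,\dots,a_n$, $q_n(a_1,\dots,a_n)$ is the denominator (in lowest terms) of the rational number $[a_1,\dots,a_n]=1/(a_1+1/(a_2+\cdots+1/a_n))$. The Diophantine pressure function is $$\mathrm P(\theta):=\lim_{n\to\infty}\frac1n\log\sum_{a_1,\dots,a_n\in\mathbb N}q_n(a_1,\dots,a_n)^{-2\theta},\qquad \theta>\tfrac12.$$ $\dim_{\rm H}$ denotes Hausdorff dimension. *)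

theory Defs
  imports "HOL-Analysis.Analysis"
begin

subsection \<open>Hausdorff dimension\<close>

(* Gauge |U|^s, with |{}|^s = 0 and |U|^0 = 1 for nonempty U.  The cases are split because
   0 powr 0 = 0 in the library. *)
definition diam_pow :: "real \<Rightarrow> 'a::metric_space set \<Rightarrow> ennreal" where
  "diam_pow s U = (if U = {} then 0 else if s = 0 then 1 else ennreal (diameter U powr s))"

(* The boundedness requirement is needed because the library's diameter is a real-valued
   supremum, hence meaningless on unbounded sets. *)
definition delta_covers :: "real \<Rightarrow> 'a::metric_space set \<Rightarrow> (nat \<Rightarrow> 'a set) set" where
  "delta_covers \<delta> A = {U. A \<subseteq> (\<Union>i. U i) \<and> (\<forall>i. bounded (U i) \<and> diameter (U i) \<le> \<delta>)}"

definition hausdorff_premeasure :: "real \<Rightarrow> real \<Rightarrow> 'a::metric_space set \<Rightarrow> ennreal" where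
  "hausdorff_premeasure s \<delta> A = (INF U \<in> delta_covers \<delta> A. \<Sum>i. diam_pow s (U i))"

definition hausdorff_measure :: "real \<Rightarrow> 'a::metric_space set \<Rightarrow> ennreal" where
  "hausdorff_measure s A = (SUP \<delta> \<in> {0<..}. hausdorff_premeasure s \<delta> A)"

definition hausdorff_dim :: "'a::metric_space set \<Rightarrow> ereal" where
  "hausdorff_dim A = (INF s \<in> {s. 0 \<le> s \<and> hausdorff_measure s A = 0}. ereal s)"

subsection \<open>Continued fractions\<close>

definition unit_irrationals :: "real set" where
  "unit_irrationals = {0..<1} - \<rat>"

definition gauss_map :: "real \<Rightarrow> real" where
  "gauss_map x = frac (1 / x)"

(* Indexed from 1: the n-th partial quotient a_n(x) is the integer part of 1 / T^(n-1) x,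
   where T is the Gauss map.  The index n = 0 is not used.  Lemma cfrac_expansion below
   confirms x = [a_1(x), a_2(x), ...]. *)
definition pquot :: "nat \<Rightarrow> real \<Rightarrow> nat" where
  "pquot n x = nat \<lfloor>1 / (gauss_map ^^ (n - 1)) x\<rfloor>"

definition max_pquot :: "nat \<Rightarrow> real \<Rightarrow> nat" where
  "max_pquot n x = Max ((\<lambda>i. pquot i x) ` {1..n})"

fun cfrac :: "nat list \<Rightarrow> rat" where
  "cfrac [] = 0"
| "cfrac (a # as) = 1 / (of_nat a + cfrac as)"

(* quotient_of yields the numerator and positive denominator in lowest terms. *)
definition cfrac_denom :: "nat list \<Rightarrow> int" where
  "cfrac_denom as = snd (quotient_of (cfrac as))"

subsection \<open>Diophantine pressure\<close>

definition pressure :: "real \<Rightarrow> real" where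
  "pressure \<theta> = lim (\<lambda>n. 1 / real n *
     ln (\<Sum>\<^sub>\<infinity> as \<in> {as. length as = n \<and> set as \<subseteq> {1..}}. real_of_int (cfrac_denom as) powr (-2 * \<theta>)))"

definition theta_hat :: "real \<Rightarrow> real" where
  "theta_hat B = (THE \<theta>. \<theta> > 1/2 \<and> pressure \<theta> = (sqrt \<theta> + sqrt (2 * \<theta> - 1))\<^sup>2 * B)"

definition M_hat :: "real \<Rightarrow> real set" where
  "M_hat C = {x \<in> unit_irrationals. \<forall>\<^sub>F n in sequentially. real (max_pquot n x) \<ge> C ^ n}"

subsection \<open>The partial quotients expand the given number\<close>

lemma unit_irrationals_pos: "x \<in> unit_irrationals \<Longrightarrow> 0 < x \<and> x < 1"
  unfolding unit_irrationals_def by (cases "x = 0") auto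

lemma gauss_map_irr:
  assumes "x \<in> unit_irrationals"
  shows "gauss_map x \<in> unit_irrationals"
proof -
  have x: "x \<notin> \<rat>" using assms by (simp add: unit_irrationals_def)
  have "gauss_map x \<notin> \<rat>"
  proof
    assume "gauss_map x \<in> \<rat>"
    then have "gauss_map x + of_int \<lfloor>1 / x\<rfloor> \<in> \<rat>" by simp
    then have "1 / x \<in> \<rat>" by (simp add: gauss_map_def frac_def)
    then have "inverse (1 / x) \<in> \<rat>" by (rule Rats_inverse)
    with x show False by simp
  qed
  then show ?thesis
    by (simp add: unit_irrationals_def gauss_map_def frac_lt_1)
qed

lemma pquot_Suc: "n \<ge> 1 \<Longrightarrow> pquot (Suc n) x = pquot n (gauss_map x)"
  by (cases n) (simp_all add: pquot_def funpow_Suc_right del: funpow.simps)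

lemma pquot_1:
  assumes "x \<in> unit_irrationals"
  shows "pquot 1 x \<ge> 1" "x = 1 / (real (pquot 1 x) + gauss_map x)"
proof -
  have "1 / x > 1" using unit_irrationals_pos[OF assms] by simp
  then have fl: "\<lfloor>1 / x\<rfloor> \<ge> 1" by linarith
  then show "pquot 1 x \<ge> 1" by (simp add: pquot_def le_nat_iff del: le_floor_iff one_le_floor)
  have "real (pquot 1 x) = of_int \<lfloor>1 / x\<rfloor>"
    using fl by (simp add: pquot_def del: le_floor_iff one_le_floor)
  then have "real (pquot 1 x) + gauss_map x = 1 / x" by (simp add: gauss_map_def frac_def)
  then show "x = 1 / (real (pquot 1 x) + gauss_map x)" by simp
qed

lemma pquot_ge_1: "x \<in> unit_irrationals \<Longrightarrow> n \<ge> 1 \<Longrightarrow> pquot n x \<ge> 1"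
proof (induction n arbitrary: x)
  case (Suc n)
  then show ?case
    by (cases "n = 0") (use pquot_1(1) pquot_Suc gauss_map_irr in auto)
qed simp

definition convergent_of :: "nat \<Rightarrow> real \<Rightarrow> real" where
  "convergent_of n x = of_rat (cfrac (map (\<lambda>i. pquot i x) [1..<Suc n]))"

lemma convergent_of_Suc:
  "convergent_of (Suc n) x = 1 / (real (pquot 1 x) + convergent_of n (gauss_map x))"
proof -
  have "[1..<Suc (Suc n)] = 1 # map Suc [1..<Suc n]"
    by (simp add: upt_conv_Cons map_Suc_upt del: upt_Suc)
  moreover have "map (\<lambda>i. pquot (Suc i) x) [1..<Suc n] = map (\<lambda>i. pquot i (gauss_map x)) [1..<Suc n]"
    using pquot_Suc by (auto simp del: upt_Suc)
  ultimately have "map (\<lambda>i. pquot i x) [1..<Suc (Suc n)]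
      = pquot 1 x # map (\<lambda>i. pquot i (gauss_map x)) [1..<Suc n]"
    by (simp only: list.map map_map comp_def)
  then show ?thesis
    by (simp only: convergent_of_def cfrac.simps of_rat_divide of_rat_add of_rat_1 of_rat_of_nat_eq)
qed

lemma convergent_of_bounds:
  "x \<in> unit_irrationals \<Longrightarrow> 0 \<le> convergent_of n x \<and> convergent_of n x \<le> 1"
proof (induction n arbitrary: x)
  case 0
  then show ?case by (simp add: convergent_of_def)
next
  case (Suc n)
  from Suc.IH[OF gauss_map_irr[OF Suc.prems]] pquot_1(1)[OF Suc.prems]
  have "real (pquot 1 x) + convergent_of n (gauss_map x) \<ge> 1" by linarith
  then show ?case unfolding convergent_of_Suc by simp
qed

lemma convergent_of_error:
  assumes "x \<in> unit_irrationals"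
  shows "\<bar>x - convergent_of (Suc n) x\<bar> \<le> x * \<bar>gauss_map x - convergent_of n (gauss_map x)\<bar>"
proof -
  define a where "a = real (pquot 1 x)"
  define t where "t = gauss_map x"
  define c where "c = convergent_of n t"
  have a: "a \<ge> 1" using pquot_1(1)[OF assms] by (simp add: a_def)
  have t: "t > 0" using gauss_map_irr[OF assms] unit_irrationals_pos by (simp add: t_def)
  have c: "c \<ge> 0" using convergent_of_bounds gauss_map_irr[OF assms] by (simp add: t_def c_def)
  have x: "x = 1 / (a + t)" using pquot_1(2)[OF assms] by (simp add: a_def t_def)
  have "x - convergent_of (Suc n) x = 1 / (a + t) - 1 / (a + c)"
    unfolding convergent_of_Suc using x by (simp add: a_def t_def c_def)
  also have "\<dots> = x * ((c - t) / (a + c))"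
    using a t c by (simp add: x divide_simps)
  finally have "\<bar>x - convergent_of (Suc n) x\<bar> = x * (\<bar>t - c\<bar> / (a + c))"
    using a t c x by (simp add: abs_mult abs_minus_commute)
  also have "\<dots> \<le> x * \<bar>t - c\<bar>"
  proof (rule mult_left_mono)
    show "\<bar>t - c\<bar> / (a + c) \<le> \<bar>t - c\<bar>"
      using a c by (simp add: divide_le_eq mult_le_cancel_left1)
    show "0 \<le> x" using unit_irrationals_pos[OF assms] by simp
  qed
  finally show ?thesis by (simp add: t_def c_def)
qed

lemma gauss_map_mult:
  assumes "x \<in> unit_irrationals"
  shows "x * gauss_map x \<le> 1 / 2"
proof -
  have "pquot 1 x \<ge> 1" "0 < gauss_map x" "gauss_map x < 1"
    using pquot_1(1)[OF assms] gauss_map_irr[OF assms] unit_irrationals_pos by auto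
  then have "gauss_map x / (real (pquot 1 x) + gauss_map x) \<le> 1 / 2"
    by (simp add: divide_simps)
  then show ?thesis by (subst pquot_1(2)[OF assms]) simp
qed

lemma convergent_of_error2:
  "x \<in> unit_irrationals \<Longrightarrow> \<bar>x - convergent_of n x\<bar> \<le> (1 / 2) ^ (n div 2)"
proof (induction n arbitrary: x rule: induct_nat_012)
  case 0
  then show ?case using unit_irrationals_pos[of x] by (simp add: convergent_of_def)
next
  case 1
  have "0 < x" "x < 1" using unit_irrationals_pos[OF 1] by auto
  with convergent_of_bounds[OF 1, of 1] have "\<bar>x - convergent_of 1 x\<bar> \<le> 1" by linarith
  then show ?case by simp
next
  case (ge2 n)
  define t where "t = gauss_map x"
  have t: "t \<in> unit_irrationals" using gauss_map_irr[OF ge2.prems] by (simp add: t_def)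
  have x0: "x > 0" using unit_irrationals_pos[OF ge2.prems] by simp
  define e where "e = \<bar>gauss_map t - convergent_of n (gauss_map t)\<bar>"
  have e: "e \<le> (1 / 2) ^ (n div 2)" unfolding e_def by (rule ge2.IH(1)[OF gauss_map_irr[OF t]])
  have "\<bar>x - convergent_of (Suc (Suc n)) x\<bar> \<le> x * \<bar>t - convergent_of (Suc n) t\<bar>"
    unfolding t_def by (rule convergent_of_error[OF ge2.prems])
  also have "\<dots> \<le> x * (t * e)"
    using convergent_of_error[OF t, of n] x0 by (simp add: e_def)
  also have "\<dots> = (x * t) * e" by simp
  also have "\<dots> \<le> 1 / 2 * e"
    using gauss_map_mult[OF ge2.prems] by (intro mult_right_mono) (auto simp: t_def e_def)
  also have "\<dots> \<le> 1 / 2 * (1 / 2) ^ (n div 2)" using e by simp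
  finally show ?case by simp
qed

lemma cfrac_expansion:
  assumes "x \<in> unit_irrationals"
  shows "(\<lambda>n. of_rat (cfrac (map (\<lambda>i. pquot i x) [1..<Suc n])) :: real) \<longlonglongrightarrow> x"
proof -
  have "filterlim (\<lambda>n::nat. n div 2) sequentially sequentially"
    unfolding filterlim_at_top
  proof
    fix Z :: nat
    show "\<forall>\<^sub>F n in sequentially. Z \<le> n div 2"
      using eventually_ge_at_top[of "2 * Z"] by eventually_elim simp
  qed
  from filterlim_compose[OF LIMSEQ_realpow_zero[of "1/2"] this]
  have "(\<lambda>n. (1 / 2 :: real) ^ (n div 2)) \<longlonglongrightarrow> 0" by simp
  then have "(\<lambda>n. x - convergent_of n x) \<longlonglongrightarrow> 0"
    by (rule Lim_null_comparison[rotated])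
       (use convergent_of_error2[OF assms] in auto)
  then have "(\<lambda>n. x - (x - convergent_of n x)) \<longlonglongrightarrow> x - 0" by (intro tendsto_intros)
  then show ?thesis by (simp add: convergent_of_def[abs_def] del: upt_Suc)
qed

end

theory Submission
  imports Defs "HOL-Probability.Probability" "HOL-Real_Asymp.Real_Asymp"
begin

text \<open>
  Write \<open>B = ln C\<close>. If \<open>n\<^sub>1 < n\<^sub>2 < \<dots>\<close> are the record times of the partial quotients of a point
  of the set, the record at \<open>n\<^sub>k\<close> has to last until \<open>n\<^sub>k\<^sub>+\<^sub>1\<close>, so it is at least about \<open>exp (B n\<^sub>k\<^sub>+\<^sub>1)\<close>.
  Fixing the digits before \<open>n\<^sub>k\<close> and only bounding the next one from below gives an interval; summing
  the \<open>\<theta>\<close>-th powers of the lengths of these intervals, each free block of length \<open>l\<close> contributes about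
  \<open>exp (P(\<theta>) l)\<close>, each earlier record \<open>exp (- (2\<theta> - 1) B n\<^sub>j\<^sub>+\<^sub>1)\<close>, and the last one \<open>exp (- \<theta> B n\<^sub>k\<^sub>+\<^sub>1)\<close>. The sum is
  small when \<open>P(\<theta>) n\<^sub>k < B ((2\<theta> - 1) (n\<^sub>2 + \<dots> + n\<^sub>k) + \<theta> n\<^sub>k\<^sub>+\<^sub>1)\<close>. The right-hand side is at least
  \<open>(\<surd>\<theta> + \<surd>(2\<theta> - 1))\<^sup>2 B n\<^sub>k\<close>, up to a factor arbitrarily close to 1, for infinitely many \<open>k\<close>, and geometric
  growth with ratio \<open>1 + \<surd>((2\<theta> - 1) / \<theta>)\<close> attains this bound. The first fact gives the upper bound. Only
  records at geometrically growing scales are used, so that the number of record patterns is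
  subexponential. For the lower bound, a mass distribution lives on points with records at those
  geometric times and independent blocks, weighted by \<open>q\<close> to the power \<open>- 2\<theta>\<close>, in between.
\<close>

subsection \<open>Bounding Hausdorff dimension\<close>

text \<open>The exponents come from two ways of treating a large digit. Keeping its values
  \<open>b \<ge> X\<close> apart costs the sum of \<open>b^(-2\<theta>)\<close>, about
  \<open>X^(1-2\<theta>)\<close>. Covering them by one interval of length about
  \<open>1/(X q^2)\<close> costs \<open>X^(-\<theta>)\<close>, which is cheaper for \<theta> < 1 but
  possible only for the last digit used. If record times grow with ratio r, the cost per unit of
  \<open>B n_k\<close> tends to \<open>(2\<theta>-1) r/(r-1) + \<theta> r\<close>, and the minimum
  of this over r > 1 is the square in the equation. In the lower bound, gluing two words is
  multiplicative only up to a constant, so every block loses a factor. Blocks therefore have a fixed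
  length, so large that slack in the pressure pays for the loss. Admitting only finitely many words
  per block bounds the ordinary digits and so separates the cylinders. A set that meets some but not
  all values of a record digit is handled by counting these values; the inequality
  \<open>min 1 x \<le> x^\<theta>\<close> for \<theta> \<le> 1 turns the count into the required
  power of the diameter.\<close>

lemma diam_pow_le:
  assumes "bounded U" "diameter U \<le> r" "s > 0"
  shows "diam_pow s U \<le> ennreal (r powr s)"
proof -
  have "diameter U powr s \<le> r powr s"
    using assms diameter_ge_0[OF assms(1)] by (intro powr_mono2) auto
  then show ?thesis using assms by (auto simp: diam_pow_def ennreal_leI)
qed

lemma hausdorff_measure_eq_0_limsup:
  fixes J :: "'i::countable \<Rightarrow> 'a::metric_space set"
  assumes s: "s > 0"
    and J: "\<And>i. i \<in> I \<Longrightarrow> bounded (J i) \<and> diameter (J i) \<le> r i \<and> 0 \<le> r i"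
    and bnd: "\<And>F. finite F \<Longrightarrow> F \<subseteq> I \<Longrightarrow> (\<Sum>i\<in>F. r i powr s) \<le> b"
    and inf: "\<And>x. x \<in> A \<Longrightarrow> infinite {i \<in> I. x \<in> J i}"
  shows "hausdorff_measure s A = 0"
proof -
  have summ: "(\<lambda>i. r i powr s) summable_on I"
    by (rule nonneg_bdd_above_summable_on) (auto intro!: bdd_aboveI[of _ b] bnd)
  have pre: "hausdorff_premeasure s \<delta> A \<le> ennreal e" if d: "\<delta> > 0" and e: "e > 0" for \<delta> e
  proof -
    \<comment> \<open>The second bound keeps each single term of the tail below
      \<open>\<delta> powr s\<close>, so every remaining set is fine enough.\<close>
    define \<eta> where "\<eta> = min e (\<delta> powr s)"
    have \<eta>: "\<eta> > 0" using d e by (simp add: \<eta>_def)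
    have "((\<lambda>i. r i powr s) has_sum (\<Sum>\<^sub>\<infinity>i\<in>I. r i powr s)) I" using summ by simp
    then have "\<forall>\<^sub>F F in finite_subsets_at_top I.
        (\<Sum>i\<in>F. r i powr s) > (\<Sum>\<^sub>\<infinity>i\<in>I. r i powr s) - \<eta>"
      unfolding has_sum_def by (rule order_tendstoD) (use \<eta> in simp)
    then obtain F where F: "finite F" "F \<subseteq> I"
        and FS: "(\<Sum>i\<in>F. r i powr s) > (\<Sum>\<^sub>\<infinity>i\<in>I. r i powr s) - \<eta>"
      unfolding eventually_finite_subsets_at_top by blast
    have tail: "(\<Sum>i\<in>G. r i powr s) \<le> \<eta>" if G: "finite G" "G \<subseteq> I - F" for G
    proof -
      have "(\<Sum>i\<in>F. r i powr s) + (\<Sum>i\<in>G. r i powr s) = (\<Sum>i\<in>F \<union> G. r i powr s)"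
        using F G by (subst sum.union_disjoint) auto
      also have "\<dots> \<le> (\<Sum>\<^sub>\<infinity>i\<in>I. r i powr s)"
        by (rule finite_sum_le_infsum[OF summ]) (use F G in auto)
      finally show ?thesis using FS by linarith
    qed
    \<comment> \<open>Covers are sequences: codes that belong to no remaining index receive the
      empty set, whose gauge is 0.\<close>
    define U where "U n = (if n \<in> to_nat ` (I - F) then J (from_nat n) else {})" for n
    have "A \<subseteq> (\<Union>n. U n)"
    proof
      fix x assume "x \<in> A"
      from inf[OF this] F obtain i where "i \<in> I - F" "x \<in> J i"
        by (metis (no_types, lifting) DiffI finite_subset mem_Collect_eq subsetI)
      then have "x \<in> U (to_nat i)" by (auto simp: U_def)
      then show "x \<in> (\<Union>n. U n)" by blast
    qed
    moreover have "bounded (U n) \<and> diameter (U n) \<le> \<delta>" for n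
    proof (cases "n \<in> to_nat ` (I - F)")
      case True
      then obtain i where i: "i \<in> I - F" "n = to_nat i" by auto
      have "r i powr s \<le> \<delta> powr s" using tail[of "{i}"] i by (simp add: \<eta>_def)
      then have "r i \<le> \<delta>" using s d by (metis less_le_not_le linorder_not_le powr_less_mono2 less_imp_le)
      then show ?thesis using J[of i] i by (auto simp: U_def)
    qed (use d in \<open>simp add: U_def\<close>)
    ultimately have "U \<in> delta_covers \<delta> A" by (simp add: delta_covers_def)
    then have "hausdorff_premeasure s \<delta> A \<le> (\<Sum>n. diam_pow s (U n))"
      unfolding hausdorff_premeasure_def by (rule INF_lower)
    also have "\<dots> \<le> ennreal e"
      unfolding suminf_eq_SUP
    proof (rule SUP_least)
      fix N
      define G where "G = {i \<in> I - F. to_nat i < N}"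
      have finG: "finite G"
        by (rule finite_imageD[of to_nat]) (auto simp: G_def inj_on_def intro: finite_subset[of _ "{..<N}"])
      have "(\<Sum>n<N. diam_pow s (U n)) = (\<Sum>n\<in>to_nat ` G. diam_pow s (U n))"
        by (rule sum.mono_neutral_right) (auto simp: G_def U_def diam_pow_def)
      also have "\<dots> = (\<Sum>i\<in>G. diam_pow s (U (to_nat i)))"
        by (subst sum.reindex) (auto simp: inj_on_def)
      also have "\<dots> \<le> (\<Sum>i\<in>G. ennreal (r i powr s))"
        by (rule sum_mono, rule diam_pow_le) (use J s in \<open>auto simp: G_def U_def\<close>)
      also have "\<dots> = ennreal (\<Sum>i\<in>G. r i powr s)" by (simp add: sum_ennreal)
      also have "\<dots> \<le> ennreal e" using tail[OF finG] by (intro ennreal_leI) (auto simp: G_def \<eta>_def)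
      finally show "(\<Sum>n<N. diam_pow s (U n)) \<le> ennreal e" .
    qed
    finally show ?thesis .
  qed
  have "hausdorff_premeasure s \<delta> A = 0" if "\<delta> > 0" for \<delta>
  proof -
    have "hausdorff_premeasure s \<delta> A \<le> 0"
      by (rule ennreal_le_epsilon) (use pre[OF that] in auto)
    then show ?thesis by simp
  qed
  then show ?thesis by (simp add: hausdorff_measure_def)
qed

text \<open>Mass distribution principle, with a parametrization \<open>X\<close> by a probability
  space in place of a measure on \<open>A\<close>. Enclosing the preimage of \<open>U\<close> in a
  measurable \<open>E\<close> allows the bound to be checked on cylinders. Since covers by sets of
  diameter at most 1 are used, a bound with exponent \<open>t\<close> serves every
  \<open>s \<le> t\<close>.\<close>

lemma hausdorff_measure_neq_0_mass_distribution:
  fixes X :: "'w \<Rightarrow> 'a::metric_space"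
  assumes "prob_space M"
    and X: "\<And>w. w \<in> space M \<Longrightarrow> X w \<in> A"
    and c: "c > 0" and s: "0 \<le> s" "s \<le> t"
    and mass: "\<And>U. bounded U \<Longrightarrow> U \<noteq> {} \<Longrightarrow> diameter U \<le> 1 \<Longrightarrow>
      \<exists>E\<in>sets M. {w \<in> space M. X w \<in> U} \<subseteq> E \<and> emeasure M E \<le> ennreal (c * diameter U powr t)"
  shows "hausdorff_measure s A \<noteq> 0"
proof -
  interpret prob_space M by fact
  have "ennreal (1 / c) \<le> (\<Sum>i. diam_pow s (U i))" if U: "U \<in> delta_covers 1 A" for U
  proof -
    have "\<exists>E\<in>sets M. {w \<in> space M. X w \<in> U i} \<subseteq> E \<and> emeasure M E \<le> ennreal c * diam_pow s (U i)" for i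
    proof (cases "U i = {}")
      case False
      have b: "bounded (U i)" "diameter (U i) \<le> 1" using U by (auto simp: delta_covers_def)
      then obtain E where E: "E \<in> sets M" "{w \<in> space M. X w \<in> U i} \<subseteq> E"
          "emeasure M E \<le> ennreal (c * diameter (U i) powr t)"
        using mass[of "U i"] False by blast
      have "ennreal (diameter (U i) powr t) \<le> diam_pow s (U i)"
      proof (cases "s = 0")
        case True
        then show ?thesis using False b diameter_ge_0[OF b(1)] s
          by (auto simp: diam_pow_def intro!: powr_le1)
      next
        case False
        then show ?thesis using \<open>U i \<noteq> {}\<close> b diameter_ge_0[OF b(1)] s
          by (auto simp: diam_pow_def intro!: ennreal_leI powr_mono')
      qed
      then have "ennreal (c * diameter (U i) powr t) \<le> ennreal c * diam_pow s (U i)"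
        using c by (simp add: ennreal_mult mult_left_mono)
      with E show ?thesis using order_trans by blast
    qed (auto intro!: bexI[of _ "{}"])
    then obtain E where E: "\<And>i. E i \<in> sets M" "\<And>i. {w \<in> space M. X w \<in> U i} \<subseteq> E i"
        "\<And>i. emeasure M (E i) \<le> ennreal c * diam_pow s (U i)" by metis
    have "space M \<subseteq> (\<Union>i. E i)"
    proof
      fix w assume w: "w \<in> space M"
      then obtain i where "X w \<in> U i" using X[OF w] U by (auto simp: delta_covers_def)
      then show "w \<in> (\<Union>i. E i)" using E(2)[of i] w by blast
    qed
    then have "1 \<le> emeasure M (\<Union>i. E i)"
      using emeasure_mono[of "space M" "\<Union>i. E i" M] E(1) emeasure_space_1 by auto
    also have "\<dots> \<le> (\<Sum>i. emeasure M (E i))"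
      by (rule emeasure_subadditive_countably) (use E(1) in auto)
    also have "\<dots> \<le> (\<Sum>i. ennreal c * diam_pow s (U i))"
      by (rule suminf_le) (use E(3) in auto)
    also have "\<dots> = ennreal c * (\<Sum>i. diam_pow s (U i))" by simp
    finally have "ennreal (1 / c) * 1 \<le> ennreal (1 / c) * (ennreal c * (\<Sum>i. diam_pow s (U i)))"
      by (rule mult_left_mono) simp
    also have "\<dots> = (\<Sum>i. diam_pow s (U i))"
      using c by (simp add: mult.assoc[symmetric] ennreal_mult[symmetric])
    finally show ?thesis by simp
  qed
  then have "ennreal (1 / c) \<le> hausdorff_premeasure s 1 A"
    unfolding hausdorff_premeasure_def by (rule INF_greatest)
  also have "\<dots> \<le> hausdorff_measure s A"
    unfolding hausdorff_measure_def by (rule SUP_upper) simp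
  finally show ?thesis using c by (auto simp: ennreal_eq_0_iff)
qed

text \<open>The infimum runs over all exponents of measure zero, so \<open>lower\<close> has to
  exclude every exponent below \<open>t\<close>. It does so through an intermediate \<open>u\<close>
  above \<open>t0\<close>, because the mass distributions are built from the pressure at some
  \<open>u > 1/2\<close>.\<close>

lemma hausdorff_dim_eqI:
  assumes "t0 < t" "t < t1" "t0 \<ge> 0"
    and upper: "\<And>s. t < s \<Longrightarrow> s < t1 \<Longrightarrow> hausdorff_measure s A = 0"
    and lower: "\<And>u s. t0 < u \<Longrightarrow> u < t \<Longrightarrow> 0 \<le> s \<Longrightarrow> s \<le> u \<Longrightarrow> hausdorff_measure s A \<noteq> 0"
  shows "hausdorff_dim A = ereal t"
proof (rule antisym)
  show "ereal t \<le> hausdorff_dim A"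
    unfolding hausdorff_dim_def
  proof (rule INF_greatest)
    fix s assume s: "s \<in> {s. 0 \<le> s \<and> hausdorff_measure s A = 0}"
    have "\<not> s < t"
    proof
      assume st: "s < t"
      define u where "u = (max s t0 + t) / 2"
      have "t0 < u" "u < t" "s \<le> u" using st assms(1) by (auto simp: u_def)
      from lower[OF this(1,2) _ this(3)] s show False by auto
    qed
    then show "ereal t \<le> ereal s" by simp
  qed
  show "hausdorff_dim A \<le> ereal t"
  proof (rule ereal_le_epsilon2)
    fix e :: real assume e: "e > 0"
    define s where "s = min (t + e) ((t + t1) / 2)"
    have s: "t < s" "s < t1" "s \<le> t + e" using e assms by (auto simp: s_def min_def)
    have "hausdorff_dim A \<le> ereal s"
      unfolding hausdorff_dim_def using s assms(1,3) upper[of s] by (intro INF_lower) auto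
    also have "\<dots> \<le> ereal t + ereal e" using s by simp
    finally show "hausdorff_dim A \<le> ereal t + ereal e" .
  qed
qed

subsection \<open>Continuants\<close>

(* cnum w / cden w is the value of the finite continued fraction w; cnum0 and cden0 are the numerator
   and denominator of its predecessor, the truncation of w by its last entry. *)
fun cnum :: "nat list \<Rightarrow> nat" and cden :: "nat list \<Rightarrow> nat" where
  "cnum [] = 0"
| "cnum (a # w) = cden w"
| "cden [] = 1"
| "cden (a # w) = a * cden w + cnum w"

fun cnum0 :: "nat list \<Rightarrow> nat" and cden0 :: "nat list \<Rightarrow> nat" where
  "cnum0 [] = 1"
| "cnum0 (a # w) = cden0 w"
| "cden0 [] = 0"
| "cden0 (a # w) = a * cden0 w + cnum0 w"

text \<open>The matrix with rows \<open>cnum0 w, cnum w\<close> and \<open>cden0 w, cden w\<close>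
  is the product over the letters \<open>a\<close> of the matrices with rows \<open>0, 1\<close> and
  \<open>1, a\<close>. These are two entries of the product for \<open>u\<close> and
  \<open>v\<close>.\<close>

lemma cnum_cden_append:
  "cnum (u @ v) = cnum u * cden v + cnum0 u * cnum v"
  "cden (u @ v) = cden u * cden v + cden0 u * cnum v"
proof (induction u)
  case (Cons a u)
  { case 1 show ?case by (simp add: Cons) }
  { case 2 show ?case by (simp add: Cons algebra_simps) }
qed auto

lemma cden_pos: "0 \<notin> set w \<Longrightarrow> cden w > 0"
  by (induction w) auto

lemma cnum_le_cden: "0 \<notin> set w \<Longrightarrow> cnum w \<le> cden w"
proof (cases w)
  case (Cons a v)
  then show "0 \<notin> set w \<Longrightarrow> cnum w \<le> cden w" by (cases a) auto
qed simp

text \<open>The induction is on length because \<open>cnum0\<close> of the tail is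
  \<open>cden0\<close> of a word two letters shorter. One-letter words are separate, as
  \<open>cnum0 [] = 1\<close> exceeds \<open>cnum [] = 0\<close>.\<close>

lemma cden0_le_cden: "0 \<notin> set w \<Longrightarrow> cden0 w \<le> cden w"
proof (induction w rule: length_induct)
  case (1 w)
  then show ?case
  proof (cases w)
    case (Cons a v)
    have "cnum0 v \<le> cnum v" if "v \<noteq> []"
      using that 1 Cons by (cases v) auto
    moreover have "cden0 v \<le> cden v" using 1 Cons by simp
    ultimately show ?thesis using Cons 1(2)
      by (cases "v = []") (auto intro!: add_mono mult_left_mono)
  qed simp
qed

lemma cden_append_ge: "cden u * cden v \<le> cden (u @ v)"
  by (simp add: cnum_cden_append)

lemma cden_append_le:
  assumes "0 \<notin> set u" "0 \<notin> set v"
  shows "cden (u @ v) \<le> 2 * cden u * cden v"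
  using mult_mono[OF cden0_le_cden[OF assms(1)] cnum_le_cden[OF assms(2)]]
  by (simp add: cnum_cden_append)

lemma coprime_cnum_cden: "coprime (cnum w) (cden w)"
proof (induction w)
  case (Cons a w)
  then show ?case
    by (simp add: coprime_iff_gcd_eq_1 gcd.commute gcd_add_mult)
qed simp

lemma cfrac_eq: "0 \<notin> set w \<Longrightarrow> cfrac w = of_nat (cnum w) / of_nat (cden w)"
proof (induction w)
  case (Cons a w)
  have "(of_nat (cden w) :: rat) > 0" using cden_pos[of w] Cons by simp
  moreover from this have "rat_of_nat a + of_nat (cnum w) / of_nat (cden w) = of_nat (cden (a # w)) / of_nat (cden w)"
    by (simp add: field_simps)
  ultimately show ?case using Cons by (simp only: cfrac.simps) (simp add: Cons.IH)
qed simp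

lemma cfrac_denom_eq:
  assumes "0 \<notin> set w"
  shows "cfrac_denom w = int (cden w)"
proof -
  have "cfrac w = Fract (int (cnum w)) (int (cden w))"
    by (simp add: cfrac_eq[OF assms] Fract_of_int_quotient)
  moreover have "coprime (int (cnum w)) (int (cden w))"
    using coprime_cnum_cden by simp
  ultimately show ?thesis using cden_pos[OF assms]
    by (simp add: cfrac_denom_def quotient_of_Fract Rat.normalize_def Let_def)
qed

text \<open>Each letter contributes a matrix of determinant -1.\<close>

lemma cont_det: "int (cnum0 w) * int (cden w) - int (cnum w) * int (cden0 w) = (-1) ^ length w"
proof (induction w)
  case (Cons a w)
  have "int (cnum0 (a # w)) * int (cden (a # w)) - int (cnum (a # w)) * int (cden0 (a # w))
      = - (int (cnum0 w) * int (cden w) - int (cnum w) * int (cden0 w))"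
    by (simp add: algebra_simps)
  then show ?case by (simp add: Cons.IH)
qed simp

subsection \<open>Cylinders\<close>

text \<open>An inverse branch of the iterated Gauss map: it sends \<open>{0..1}\<close> onto the
  closed cylinder of \<open>w\<close>, and \<open>t\<close> is the remainder after the digits
  \<open>w\<close>.\<close>

fun cmap :: "nat list \<Rightarrow> real \<Rightarrow> real" where
  "cmap [] t = t"
| "cmap (a # w) t = 1 / (real a + cmap w t)"

lemma cmap_append: "cmap (u @ v) t = cmap u (cmap v t)"
  by (induction u) auto

lemma cmap_nonneg: "t \<ge> 0 \<Longrightarrow> cmap w t \<ge> 0"
  by (induction w) auto

lemma cmap_eq:
  fixes t :: real
  assumes "0 \<notin> set w" "t \<ge> 0"
  shows "cmap w t = (cnum w + cnum0 w * t) / (cden w + cden0 w * t)"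
  using assms
proof (induction w)
  case (Cons a w)
  have "real (cden w) + cden0 w * t > 0" using cden_pos[of w] Cons by (simp add: add_pos_nonneg)
  moreover have "real (cden (a # w)) + cden0 (a # w) * t > 0"
    using cden_pos[of "a # w"] Cons by (simp add: add_pos_nonneg del: cden.simps cden0.simps)
  moreover from calculation(1) have "real a + (cnum w + cnum0 w * t) / (cden w + cden0 w * t)
      = (cden (a # w) + cden0 (a # w) * t) / (cden w + cden0 w * t)"
    by (simp add: field_simps)
  ultimately show ?case using Cons by (simp only: cmap.simps) (simp add: Cons.IH)
qed simp

lemma cmap_diff:
  fixes s t :: real
  assumes w: "0 \<notin> set w" and "s \<ge> 0" "t \<ge> 0"
  shows "\<bar>cmap w s - cmap w t\<bar> = \<bar>s - t\<bar> / ((cden w + cden0 w * s) * (cden w + cden0 w * t))"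
proof -
  have p: "real (cden w) + cden0 w * s > 0" "real (cden w) + cden0 w * t > 0"
    using cden_pos[OF w] assms by (simp_all add: add_pos_nonneg)
  have "of_int (int (cnum0 w) * int (cden w) - int (cnum w) * int (cden0 w)) = ((-1) ^ length w :: real)"
    unfolding cont_det by simp
  then have d: "real (cnum0 w) * cden w - cnum w * cden0 w = (-1) ^ length w" by simp
  have "cmap w s - cmap w t
      = (real (cnum0 w) * cden w - cnum w * cden0 w) * (s - t)
        / ((cden w + cden0 w * s) * (cden w + cden0 w * t))"
    using p by (simp add: cmap_eq[OF w] assms diff_frac_eq) (simp add: algebra_simps)
  then show ?thesis using p unfolding d by (simp add: abs_mult abs_divide)
qed

lemma cmap_diff_le:
  fixes s t :: real
  assumes w: "0 \<notin> set w" and "s \<ge> 0" "t \<ge> 0"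
  shows "\<bar>cmap w s - cmap w t\<bar> \<le> \<bar>s - t\<bar> / (real (cden w))\<^sup>2"
  unfolding cmap_diff[OF assms] power2_eq_square
  using cden_pos[OF w] assms
  by (intro divide_left_mono mult_mono mult_pos_pos add_pos_nonneg) auto

lemma cmap_diff_ge:
  fixes s t :: real
  assumes w: "0 \<notin> set w" and "s \<in> {0..1}" "t \<in> {0..1}"
  shows "\<bar>s - t\<bar> / (4 * (real (cden w))\<^sup>2) \<le> \<bar>cmap w s - cmap w t\<bar>"
proof -
  have "cden w + cden0 w * u \<le> 2 * real (cden w)" if "u \<in> {0..1}" for u :: real
    using mult_mono[of "real (cden0 w)" "cden w" u 1] cden0_le_cden[OF w] that by simp
  from mult_mono[OF this[OF assms(2)] this[OF assms(3)]]
  have "(cden w + cden0 w * s) * (cden w + cden0 w * t) \<le> 4 * (real (cden w))\<^sup>2"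
    using assms by (simp add: power2_eq_square)
  moreover have "0 < (cden w + cden0 w * s) * (cden w + cden0 w * t)"
    using cden_pos[OF w] assms by (intro mult_pos_pos add_pos_nonneg) auto
  ultimately show ?thesis
    using assms cden_pos[OF w] by (subst cmap_diff[OF w]) (auto intro!: divide_left_mono mult_pos_pos)
qed

(* The hypothesis on t and t' keeps the two points away from the common endpoint of adjacent
   cylinders. *)
lemma cmap_separation:
  fixes t t' \<eta> :: real
  assumes w: "0 \<notin> set w" and b: "b \<ge> 1" "b' \<ge> 1" "b \<noteq> b'"
    and t: "t \<in> {0..1}" "t' \<in> {0..1}" and \<eta>: "0 \<le> \<eta>" "\<eta> \<le> 1"
    and gap: "(t \<ge> \<eta> \<and> t' \<ge> \<eta>) \<or> (t \<le> 1 - \<eta> \<and> t' \<le> 1 - \<eta>)"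
  shows "\<eta> * \<bar>real b - real b'\<bar> / (16 * (real (cden w))\<^sup>2 * b * b')
    \<le> \<bar>cmap (w @ [b]) t - cmap (w @ [b']) t'\<bar>"
proof -
  define D where "D = \<bar>real b - real b'\<bar>"
  have D: "D \<ge> 1" using b by (auto simp: D_def)
  \<comment> \<open>The gap hypothesis bounds the difference of \<open>t\<close> and
    \<open>t'\<close> by \<open>1 - \<eta>\<close>. As \<open>D \<ge> 1\<close>, subtracting this
    from \<open>D\<close> leaves at least \<open>\<eta> * D\<close>.\<close>
  have "\<eta> * D = D - (1 - \<eta>) * D" by (simp add: algebra_simps)
  also have "\<dots> \<le> D - (1 - \<eta>)" using mult_left_mono[OF D, of "1 - \<eta>"] \<eta> by simp
  also have "\<dots> \<le> \<bar>(real b' + t') - (real b + t)\<bar>" using gap t D unfolding D_def by auto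
  finally have num: "\<eta> * D \<le> \<bar>(real b' + t') - (real b + t)\<bar>" .
  have den: "(real b + t) * (real b' + t') \<le> 4 * real b * b'"
    using mult_mono[of "real b + t" "2 * b" "real b' + t'" "2 * b'"] b t by simp
  have pos: "real b + t > 0" "real b' + t' > 0" using b t by auto
  have "1 / (real b + t) - 1 / (real b' + t') = ((real b' + t') - (real b + t)) / ((real b + t) * (real b' + t'))"
    using pos by (simp add: divide_simps)
  then have "\<bar>1 / (real b + t) - 1 / (real b' + t')\<bar> = \<bar>(real b' + t') - (real b + t)\<bar> / ((real b + t) * (real b' + t'))"
    using pos by (simp add: abs_divide abs_mult)
  also have "\<dots> \<ge> \<eta> * D / (4 * real b * b')"
    using num den pos by (intro frac_le) auto
  finally have "\<eta> * D / (4 * real b * b') / (4 * (real (cden w))\<^sup>2)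
      \<le> \<bar>1 / (real b + t) - 1 / (real b' + t')\<bar> / (4 * (real (cden w))\<^sup>2)"
    by (rule divide_right_mono) simp
  also have "\<dots> \<le> \<bar>cmap w (1 / (real b + t)) - cmap w (1 / (real b' + t'))\<bar>"
    using b t by (intro cmap_diff_ge[OF w]) auto
  finally show ?thesis by (simp add: cmap_append D_def field_simps)
qed

lemma continuous_on_cmap: "0 \<notin> set w \<Longrightarrow> continuous_on {0..} (cmap w)"
proof (induction w)
  case (Cons a w)
  have "real a + cmap w t \<noteq> 0" if "t \<ge> 0" for t
    using cmap_nonneg[OF that, of w] Cons(2) by (auto simp: add_nonneg_eq_0_iff)
  with Cons show ?case by (auto intro!: continuous_intros)
qed simp

lemma cmap_unit_interval: "0 \<notin> set w \<Longrightarrow> t \<in> {0..1} \<Longrightarrow> cmap w t \<in> {0..1}"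
proof (induction w)
  case (Cons a w)
  then have "cmap w t \<ge> 0" "real a \<ge> 1" by (auto simp: cmap_nonneg)
  then show ?case by (auto simp: divide_simps)
qed simp

lemma unit_irrationals_funpow: "x \<in> unit_irrationals \<Longrightarrow> (gauss_map ^^ n) x \<in> unit_irrationals"
  by (induction n) (auto intro: gauss_map_irr)

lemma pquot_Suc_funpow: "pquot (Suc n) x = pquot 1 ((gauss_map ^^ n) x)"
  by (simp add: pquot_def)

definition pquots :: "nat \<Rightarrow> real \<Rightarrow> nat list" where
  "pquots n x = map (\<lambda>i. pquot (Suc i) x) [0..<n]"

lemma cmap_pquots:
  assumes "x \<in> unit_irrationals"
  shows "cmap (pquots n x) ((gauss_map ^^ n) x) = x"
proof (induction n)
  case (Suc n)
  have "1 / (real (pquot 1 ((gauss_map ^^ n) x)) + gauss_map ((gauss_map ^^ n) x)) = (gauss_map ^^ n) x"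
    using pquot_1(2)[OF unit_irrationals_funpow[OF assms]] by simp
  then have "1 / (real (pquot (Suc n) x) + gauss_map ((gauss_map ^^ n) x)) = (gauss_map ^^ n) x"
    by (simp only: pquot_Suc_funpow)
  then show ?case using Suc by (simp add: pquots_def cmap_append)
qed (simp add: pquots_def)

subsection \<open>Irrational numbers with prescribed partial quotients\<close>

text \<open>Closed cylinders make existence a matter of compactness. That the point is irrational,
  hence no endpoint, is shown afterwards, and only then are the digits its partial
  quotients.\<close>

definition has_digits :: "(nat \<Rightarrow> nat) \<Rightarrow> real \<Rightarrow> bool" where
  "has_digits d x \<longleftrightarrow> (\<forall>n. x \<in> cmap (map d [0..<n]) ` {0..1})"

lemma has_digits_exists:
  assumes "\<And>n. d n \<ge> 1"
  shows "\<exists>x. has_digits d x"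
proof -
  have w: "0 \<notin> set (map d [0..<n])" for n using assms by (auto simp: Suc_le_eq) (metis less_irrefl)
  define I where "I n = cmap (map d [0..<n]) ` {0..1::real}" for n
  have "compact (I n)" for n unfolding I_def
    by (rule compact_continuous_image[OF continuous_on_subset[OF continuous_on_cmap[OF w]]]) auto
  moreover have "I n \<noteq> {}" for n by (simp add: I_def)
  moreover have "I n \<subseteq> I m" if "m \<le> n" for m n
    using that
  proof (induction n rule: dec_induct)
    case (step n)
    have "I (Suc n) \<subseteq> I n"
    proof
      fix y assume "y \<in> I (Suc n)"
      then obtain t where t: "t \<in> {0..1}" "y = cmap (map d [0..<n]) (cmap [d n] t)"
        by (auto simp: I_def cmap_append)
      moreover have "cmap [d n] t \<in> {0..1}"
        by (rule cmap_unit_interval) (use t assms[of n] in auto)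
      ultimately show "y \<in> I n" unfolding I_def by blast
    qed
    with step show ?case by blast
  qed simp
  ultimately have "(\<Inter>n. I n) \<noteq> {}" by (intro compact_nest) auto
  then show ?thesis by (auto simp: has_digits_def I_def)
qed

lemma has_digits_step:
  assumes d: "\<And>n. d n \<ge> 1" and x: "has_digits d x"
  shows "x = 1 / (real (d 0) + (1 / x - d 0))" "has_digits (d \<circ> Suc) (1 / x - d 0)"
    "0 < x" "x < 1"
proof -
  have *: "x > 0 \<and> has_digits (d \<circ> Suc) (1 / x - d 0) \<and> 1 / x - d 0 \<in> {0..1}"
    if d: "\<And>n. d n \<ge> 1" and x: "has_digits d x" for d x
  proof -
    have ex: "\<exists>t\<in>{0..1}. x = 1 / (real (d 0) + cmap (map (d \<circ> Suc) [0..<n]) t)" for n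
    proof -
      have "x \<in> cmap (map d [0..<Suc n]) ` {0..1}" using x by (simp add: has_digits_def del: upt_Suc)
      moreover have "map d [0..<Suc n] = d 0 # map (d \<circ> Suc) [0..<n]"
        by (simp add: upt_conv_Cons map_Suc_upt[symmetric] del: upt_Suc)
      ultimately show ?thesis by auto
    qed
    from ex[of 0] d[of 0] have "x > 0" by (auto intro!: divide_pos_pos add_pos_nonneg)
    moreover have "1 / x - d 0 \<in> cmap (map (d \<circ> Suc) [0..<n]) ` {0..1}" for n
      using ex[of n] by auto
    then have "has_digits (d \<circ> Suc) (1 / x - d 0)" by (simp add: has_digits_def)
    moreover from this have "1 / x - d 0 \<in> {0..1}" unfolding has_digits_def by (auto dest: spec[of _ 0])
    ultimately show ?thesis by blast
  qed
  note 1 = *[OF d x]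
  \<comment> \<open>The remainder has a digit sequence of its own and is therefore positive too;
    this rules out the endpoint \<open>x = 1\<close>.\<close>
  then have 2: "1 / x - d 0 > 0" using *[of "d \<circ> Suc" "1 / x - d 0"] d by simp
  show "x = 1 / (real (d 0) + (1 / x - d 0))" using 1 by simp
  show "has_digits (d \<circ> Suc) (1 / x - d 0)" "0 < x" using 1 by auto
  have "1 / x > 1" using 2 d[of 0] by linarith
  then show "x < 1" using 1 by simp
qed

text \<open>Infinite descent as in the Euclidean algorithm: a fraction \<open>a / b\<close> strictly
  between 0 and 1 leaves a remainder with denominator \<open>a < b\<close>, and this remainder again
  has digits.\<close>

lemma has_digits_irrational:
  assumes "\<And>n. d n \<ge> 1" and "has_digits d x"
  shows "x \<notin> \<rat>"
proof -
  have "x \<noteq> of_int a / real b"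
    if "b > 0" "\<And>n. d n \<ge> 1" "has_digits d x" for a :: int and b d x
    using that
  proof (induction b arbitrary: a d x rule: less_induct)
    case (less b)
    show ?case
    proof
      assume eq: "x = of_int a / real b"
      note st = has_digits_step[OF less.prems(2,3)]
      have a: "0 < a" "a < int b" using st(3,4) eq less.prems(1) by (auto simp: zero_less_divide_iff divide_less_eq)
      have "1 / x - d 0 = of_int (int b - int (d 0) * a) / real (nat a)"
        using a unfolding eq by (simp add: diff_divide_distrib)
      moreover have "nat a < b" "0 < nat a" "\<And>n. (d \<circ> Suc) n \<ge> 1" using a less.prems(2) by auto
      ultimately show False using less.IH st(2) by blast
    qed
  qed
  note * = this[OF _ assms]
  show ?thesis
  proof
    assume "x \<in> \<rat>"
    then obtain a b where "b > 0" "x = of_int a / of_int b" by (rule Rats_cases') 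
    with *[of "nat b" a] show False by simp
  qed
qed

lemma has_digits_gauss:
  assumes "\<And>n. d n \<ge> 1" and "has_digits d x"
  shows "x \<in> unit_irrationals" "pquot 1 x = d 0" "has_digits (d \<circ> Suc) (gauss_map x)"
proof -
  note st = has_digits_step[OF assms]
  show "x \<in> unit_irrationals"
    using st has_digits_irrational[OF assms] by (simp add: unit_irrationals_def)
  have "0 < 1 / x - d 0" "1 / x - d 0 < 1" using has_digits_step(3,4)[of "d \<circ> Suc", OF _ st(2)] assms(1) by auto
  then have fl: "\<lfloor>1 / x\<rfloor> = int (d 0)" by linarith
  then show "pquot 1 x = d 0" by (simp add: pquot_def)
  show "has_digits (d \<circ> Suc) (gauss_map x)" using st(2) fl by (simp add: gauss_map_def frac_def)
qed

lemma has_digits_pquot: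
  assumes "\<And>n. d n \<ge> 1" and "has_digits d x"
  shows "pquot (Suc n) x = d n"
  using assms
proof (induction n arbitrary: d x)
  case 0
  then show ?case using has_digits_gauss(2) by simp
next
  case (Suc n)
  from Suc.IH[of "d \<circ> Suc" "gauss_map x"] has_digits_gauss(3)[OF Suc.prems] Suc.prems(1)
  show ?case by (simp add: pquot_Suc comp_def)
qed

subsection \<open>Sums over words\<close>

lemma summable_on_finite_sums_le:
  fixes f :: "'a \<Rightarrow> real"
  assumes "\<And>x. x \<in> A \<Longrightarrow> f x \<ge> 0" and "\<And>F. finite F \<Longrightarrow> F \<subseteq> A \<Longrightarrow> sum f F \<le> b"
  shows "f summable_on A" "infsum f A \<le> b"
proof -
  show "f summable_on A"
    by (rule nonneg_bdd_above_summable_on) (use assms in \<open>auto intro!: bdd_aboveI[of _ b]\<close>)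
  then show "infsum f A \<le> b" using assms(2) by (rule infsum_le_finite_sums)
qed

lemma finite_subset_append:
  assumes "finite F" "F \<subseteq> {u @ v |u v. u \<in> A \<and> v \<in> B}"
  obtains A0 B0 where "finite A0" "finite B0" "A0 \<subseteq> A" "B0 \<subseteq> B"
    "F \<subseteq> (\<lambda>(u, v). u @ v) ` (A0 \<times> B0)"
proof -
  have "F \<subseteq> (\<lambda>(u, v). u @ v) ` (A \<times> B)" using assms(2) by fast
  then obtain G where G: "finite G" "G \<subseteq> A \<times> B" "F = (\<lambda>(u, v). u @ v) ` G"
    using assms(1) by (metis finite_subset_image)
  have "G \<subseteq> fst ` G \<times> snd ` G" by force
  then show ?thesis using G by (intro that[of "fst ` G" "snd ` G"]) auto
qed

text \<open>Elements of \<open>C\<close> need only have some decomposition: further decompositions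
  merely enlarge the product.\<close>

lemma infsum_append_le:
  fixes f :: "'a list \<Rightarrow> real"
  assumes nn: "\<And>w. f w \<ge> 0"
    and A: "f summable_on A" and B: "f summable_on B"
    and sub: "\<And>u v. u \<in> A \<Longrightarrow> v \<in> B \<Longrightarrow> f (u @ v) \<le> f u * f v"
    and C: "C \<subseteq> {u @ v |u v. u \<in> A \<and> v \<in> B}"
  shows "f summable_on C" "infsum f C \<le> infsum f A * infsum f B"
proof -
  have *: "sum f F \<le> infsum f A * infsum f B" if F: "finite F" "F \<subseteq> C" for F
  proof -
    obtain A0 B0 where AB: "finite A0" "finite B0" "A0 \<subseteq> A" "B0 \<subseteq> B"
        "F \<subseteq> (\<lambda>(u, v). u @ v) ` (A0 \<times> B0)"
      by (rule finite_subset_append[OF F(1) order_trans[OF F(2) C]])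
    have "sum f F \<le> sum f ((\<lambda>(u, v). u @ v) ` (A0 \<times> B0))"
      using AB nn by (intro sum_mono2) auto
    also have "\<dots> \<le> sum (f \<circ> (\<lambda>(u, v). u @ v)) (A0 \<times> B0)"
      using AB nn by (intro sum_image_le) auto
    also have "\<dots> = (\<Sum>(u, v)\<in>A0 \<times> B0. f (u @ v))"
      by (intro sum.cong) auto
    also have "\<dots> \<le> (\<Sum>(u, v)\<in>A0 \<times> B0. f u * f v)"
      using AB by (intro sum_mono) (auto intro!: sub)
    also have "\<dots> = sum f A0 * sum f B0"
      by (simp add: sum.cartesian_product[symmetric] sum_product)
    also have "\<dots> \<le> infsum f A * infsum f B"
      using AB A B nn by (intro mult_mono finite_sum_le_infsum sum_nonneg infsum_nonneg) auto
    finally show ?thesis .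
  qed
  show "f summable_on C" "infsum f C \<le> infsum f A * infsum f B"
    using summable_on_finite_sums_le[of C f, OF _ *] nn by auto
qed

text \<open>The common length of the words in \<open>A\<close> makes the cut unique, so no word of
  \<open>C\<close> is counted twice. Finite sums are passed to the limit in one factor at a
  time.\<close>

lemma infsum_append_ge:
  fixes f :: "'a list \<Rightarrow> real"
  assumes nn: "\<And>w. f w \<ge> 0"
    and A: "f summable_on A" and B: "f summable_on B" and C: "f summable_on C"
    and sup: "\<And>u v. u \<in> A \<Longrightarrow> v \<in> B \<Longrightarrow> u @ v \<in> C \<and> f u * f v \<le> K * f (u @ v)"
    and len: "\<And>u. u \<in> A \<Longrightarrow> length u = n" and K: "K \<ge> 0"
  shows "infsum f A * infsum f B \<le> K * infsum f C"
proof -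
  have fin: "sum f A0 * sum f B0 \<le> K * infsum f C"
    if AB: "finite A0" "finite B0" "A0 \<subseteq> A" "B0 \<subseteq> B" for A0 B0
  proof -
    have inj: "inj_on (\<lambda>(u, v). u @ v) (A0 \<times> B0)"
    proof (rule inj_onI, clarify)
      fix u v u' v' assume *: "u \<in> A0" "u' \<in> A0" "u @ v = u' @ v'"
      then have "length u = length u'" using len AB(3) by (metis subsetD)
      with * show "u = u' \<and> v = v'" by simp
    qed
    have "sum f A0 * sum f B0 = (\<Sum>(u, v)\<in>A0 \<times> B0. f u * f v)"
      by (simp add: sum.cartesian_product[symmetric] sum_product)
    also have "\<dots> \<le> (\<Sum>(u, v)\<in>A0 \<times> B0. K * f (u @ v))"
      using AB by (intro sum_mono) (auto intro!: sup[THEN conjunct2])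
    also have "\<dots> = K * (\<Sum>(u, v)\<in>A0 \<times> B0. f (u @ v))"
      by (simp add: sum_distrib_left case_prod_unfold)
    also have "(\<Sum>(u, v)\<in>A0 \<times> B0. f (u @ v)) = sum f ((\<lambda>(u, v). u @ v) ` (A0 \<times> B0))"
      using inj by (simp add: sum.reindex case_prod_unfold comp_def)
    also have "\<dots> \<le> infsum f C"
      using AB C nn by (intro finite_sum_le_infsum) (auto intro!: sup[THEN conjunct1])
    finally show ?thesis using K by (simp add: mult_left_mono)
  qed
  have half: "infsum f A * sum f B0 \<le> K * infsum f C" if "finite B0" "B0 \<subseteq> B" for B0
  proof -
    have "infsum (\<lambda>u. f u * sum f B0) A \<le> K * infsum f C"
      using that fin by (intro infsum_le_finite_sums summable_on_cmult_left A)
        (simp add: sum_distrib_right[symmetric])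
    then show ?thesis using A by (simp add: infsum_cmult_left)
  qed
  have "infsum (\<lambda>v. infsum f A * f v) B \<le> K * infsum f C"
    using half by (intro infsum_le_finite_sums summable_on_cmult_right B)
      (simp add: sum_distrib_left[symmetric])
  then show ?thesis using B by (simp add: infsum_cmult_right)
qed

subsection \<open>The pressure function\<close>

definition words :: "nat \<Rightarrow> nat list set" where
  "words n = {w. length w = n \<and> set w \<subseteq> {1..}}"

definition weight :: "real \<Rightarrow> nat list \<Rightarrow> real" where
  "weight t w = real (cden w) powr (-2 * t)"

definition weight_sum :: "real \<Rightarrow> nat \<Rightarrow> real" where
  "weight_sum t n = infsum (weight t) (words n)"

lemma words_pos: "w \<in> words n \<Longrightarrow> 0 \<notin> set w"
  by (auto simp: words_def)

lemma words_length: "w \<in> words n \<Longrightarrow> length w = n"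
  by (simp add: words_def)

lemma words_0: "words 0 = {[]}"
  by (auto simp: words_def)

lemma words_append: "u \<in> words m \<Longrightarrow> v \<in> words n \<Longrightarrow> u @ v \<in> words (m + n)"
  by (auto simp: words_def)

lemma words_add: "words (m + n) \<subseteq> {u @ v |u v. u \<in> words m \<and> v \<in> words n}"
proof
  fix w assume "w \<in> words (m + n)"
  then have "take m w \<in> words m" "drop m w \<in> words n"
    by (auto simp: words_def dest: in_set_takeD in_set_dropD)
  then show "w \<in> {u @ v |u v. u \<in> words m \<and> v \<in> words n}"
    by (metis (mono_tags, lifting) CollectI append_take_drop_id)
qed

lemma weight_nonneg: "weight t w \<ge> 0"
  by (simp add: weight_def)

lemma weight_append_le:
  assumes "t \<ge> 0" "0 \<notin> set u" "0 \<notin> set v"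
  shows "weight t (u @ v) \<le> weight t u * weight t v"
proof -
  have "real (cden u) * real (cden v) \<le> real (cden (u @ v))"
    using cden_append_ge[of u v] by (metis of_nat_le_iff of_nat_mult)
  moreover have "real (cden u) * real (cden v) > 0" using cden_pos assms by simp
  ultimately show ?thesis
    unfolding weight_def powr_mult[symmetric] using assms by (intro powr_mono2') auto
qed

text \<open>The factor 2 of \<open>cden_append_le\<close>, raised to the power \<open>2 * t\<close>,
  becomes \<open>4 powr t\<close>.\<close>

lemma weight_append_ge:
  assumes "t \<ge> 0" "0 \<notin> set u" "0 \<notin> set v"
  shows "weight t u * weight t v \<le> 4 powr t * weight t (u @ v)"
proof -
  have "real (cden (u @ v)) \<le> 2 * (real (cden u) * real (cden v))"
    using cden_append_le[OF assms(2,3)] by (metis of_nat_le_iff of_nat_mult of_nat_numeral mult.assoc)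
  moreover have "real (cden (u @ v)) > 0" using cden_pos[of "u @ v"] assms by simp
  ultimately have "(2 * (real (cden u) * real (cden v))) powr (-2 * t) \<le> weight t (u @ v)"
    unfolding weight_def using assms by (intro powr_mono2') auto
  then have "4 powr t * (2 powr (-2 * t) * (weight t u * weight t v)) \<le> 4 powr t * weight t (u @ v)"
    by (intro mult_left_mono) (simp_all add: powr_mult weight_def)
  moreover have "4 powr t * 2 powr (-2 * t) = (1 :: real)"
  proof -
    have "(4 :: real) powr t = (2 powr 2) powr t" by simp
    also have "\<dots> = 2 powr (2 * t)" by (rule powr_powr)
    finally show ?thesis by (simp add: powr_minus powr_add[symmetric])
  qed
  ultimately show ?thesis by (metis mult.assoc mult_1)
qed

lemma weight_singleton: "weight t [a] = real a powr (-2 * t)"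
  by (simp add: weight_def)

lemma words_1: "words (Suc 0) = (\<lambda>a. [a]) ` {1..}"
  by (auto simp: words_def length_Suc_conv)

lemma summable_on_powr: "t > 1/2 \<Longrightarrow> (\<lambda>a::nat. real a powr (-2 * t)) summable_on A"
  using summable_real_powr_iff[of "-2 * t"] summable_on_UNIV_nonneg_real_iff[of "\<lambda>a::nat. real a powr (-2 * t)"]
  by (auto intro: summable_on_subset_banach[of _ UNIV])

lemma weight_summable:
  assumes "t > 1/2"
  shows "weight t summable_on words n"
proof (induction n)
  case (Suc n)
  have 1: "weight t summable_on words (Suc 0)"
    unfolding words_1 using summable_on_powr[OF assms, of "{1..}"]
    by (subst summable_on_reindex) (auto simp: inj_on_def comp_def weight_singleton)
  show ?case
    by (rule infsum_append_le(1)[OF weight_nonneg 1 Suc])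
       (use assms words_add[of 1 n] words_pos in \<open>auto intro!: weight_append_le\<close>)
qed (simp add: words_0)

lemma weight_sum_add_le:
  assumes "t > 1/2"
  shows "weight_sum t (m + n) \<le> weight_sum t m * weight_sum t n"
  unfolding weight_sum_def
  by (rule infsum_append_le(2)[OF weight_nonneg weight_summable weight_summable])
     (use assms words_add words_pos in \<open>auto intro!: weight_append_le\<close>)

lemma weight_sum_add_ge:
  assumes "t > 1/2"
  shows "weight_sum t m * weight_sum t n \<le> 4 powr t * weight_sum t (m + n)"
  unfolding weight_sum_def
  by (rule infsum_append_ge[OF weight_nonneg weight_summable weight_summable weight_summable, where n = m])
     (use assms words_append words_pos in \<open>auto intro!: weight_append_ge simp: words_length\<close>)

lemma weight_sum_pos:
  assumes "t > 1/2"
  shows "weight_sum t n > 0"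
proof -
  have w: "replicate n 1 \<in> words n" by (auto simp: words_def)
  have "0 < weight t (replicate n 1)" using cden_pos[OF words_pos[OF w]] by (simp add: weight_def)
  also have "\<dots> = sum (weight t) {replicate n 1}" by simp
  also have "\<dots> \<le> weight_sum t n"
    unfolding weight_sum_def using w
    by (intro finite_sum_le_infsum weight_summable assms) (auto simp: weight_nonneg)
  finally show ?thesis .
qed

text \<open>Fekete's lemma with an error bound. Comparing \<open>a m / m\<close> and
  \<open>a n / n\<close> with the value at \<open>m * n\<close> gives the Cauchy property; letting
  the multiple of a fixed \<open>n\<close> grow gives bounds valid for every
  \<open>n\<close>.\<close>

lemma almost_additive_limit:
  fixes a :: "nat \<Rightarrow> real"
  assumes le: "\<And>m n. a (m + n) \<le> a m + a n" and ge: "\<And>m n. a m + a n \<le> c + a (m + n)"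
  obtains l where "(\<lambda>n. a n / n) \<longlonglongrightarrow> l" "\<And>n. n * l \<le> a n" "\<And>n. a n \<le> c + n * l"
proof -
  have c: "c \<ge> 0" using le[of 0 0] ge[of 0 0] by simp
  have a0: "a 0 \<ge> 0" "a 0 \<le> c" using le[of 0 0] ge[of 0 0] by simp_all
  \<comment> \<open>Multiples are counted from 1 because \<open>a 0\<close> can be positive.\<close>
  have mult_le: "a (Suc k * n) \<le> Suc k * a n" for k n
  proof (induction k)
    case (Suc k)
    then show ?case using le[of n "Suc k * n"] by (simp add: algebra_simps)
  qed simp
  have mult_ge: "Suc k * a n \<le> a (Suc k * n) + k * c" for k n
  proof (induction k)
    case (Suc k)
    then show ?case using ge[of n "Suc k * n"] by (simp add: algebra_simps)
  qed simp
  have cancel: "real (Suc k) * z / real (Suc k * n) = z / n" for k n z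
    unfolding of_nat_mult by (rule mult_divide_mult_cancel_left) simp
  have close: "\<bar>a n / n - a (Suc k * n) / (Suc k * n)\<bar> \<le> c / n" for k n
  proof -
    have "a (Suc k * n) / (Suc k * n) \<le> Suc k * a n / (Suc k * n)"
      using mult_le[of k n] by (rule divide_right_mono) simp
    moreover have "Suc k * a n / (Suc k * n) \<le> (a (Suc k * n) + Suc k * c) / (Suc k * n)"
      using mult_ge[of k n] c by (intro divide_right_mono) (simp_all add: algebra_simps)
    ultimately show ?thesis unfolding add_divide_distrib cancel by linarith
  qed
  have cau: "\<bar>a m / m - a n / n\<bar> \<le> c / m + c / n" if mn: "m > 0" "n > 0" for m n :: nat
  proof -
    obtain k l where kl: "m = Suc k" "n = Suc l" using gr0_implies_Suc[OF mn(1)] gr0_implies_Suc[OF mn(2)] by blast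
    show ?thesis using close[of m l] close[of n k] unfolding kl mult.commute[of "Suc l" "Suc k"] by linarith
  qed
  have "Cauchy (\<lambda>n. a n / n)"
  proof (rule metric_CauchyI)
    fix e :: real assume e: "e > 0"
    define M where "M = nat \<lceil>2 * c / e\<rceil> + 1"
    have M: "real M > 2 * c / e" "M > 0" unfolding M_def by linarith+
    have "c / n < e / 2" if "n \<ge> M" for n :: nat
    proof -
      have "2 * c / e < real n" using M(1) that by linarith
      then have "2 * c < real n * e" using e by (simp add: pos_divide_less_eq)
      then show ?thesis using M that by (simp add: field_simps)
    qed
    then show "\<exists>M. \<forall>m\<ge>M. \<forall>n\<ge>M. dist (a m / m) (a n / n) < e"
    proof (intro exI[of _ M] allI impI)
      fix m n assume "m \<ge> M" "n \<ge> M"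
      with cau[of m n] M(2) \<open>\<And>n. n \<ge> M \<Longrightarrow> c / n < e / 2\<close>[of m] \<open>\<And>n. n \<ge> M \<Longrightarrow> c / n < e / 2\<close>[of n]
      show "dist (a m / m) (a n / n) < e" unfolding dist_real_def by linarith
    qed
  qed
  then obtain l where l: "(\<lambda>n. a n / n) \<longlonglongrightarrow> l" using Cauchy_convergent convergent_def by blast
  have lim: "(\<lambda>k. a (Suc k * n) / (Suc k * n)) \<longlonglongrightarrow> l" if "n > 0" for n :: nat
  proof -
    have "strict_mono (\<lambda>k. Suc k * n)" using that by (simp add: strict_mono_def)
    from LIMSEQ_subseq_LIMSEQ[OF l this] show ?thesis by (simp add: comp_def)
  qed
  have bounds: "l \<le> a n / n" "a n / n \<le> l + c / n" if "n > 0" for n :: nat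
  proof -
    show "l \<le> a n / n"
    proof (rule LIMSEQ_le_const2[OF lim[OF that]], intro exI allI impI)
      fix k
      have "a (Suc k * n) / (Suc k * n) \<le> Suc k * a n / (Suc k * n)"
        using mult_le[of k n] by (rule divide_right_mono) simp
      then show "a (Suc k * n) / (Suc k * n) \<le> a n / n" unfolding cancel .
    qed
    have "a n / n - c / n \<le> l"
    proof (rule LIMSEQ_le_const[OF lim[OF that]], intro exI allI impI)
      fix k
      show "a n / n - c / n \<le> a (Suc k * n) / (Suc k * n)" using close[of n k] by linarith
    qed
    then show "a n / n \<le> l + c / n" by simp
  qed
  have "n * l \<le> a n \<and> a n \<le> c + n * l" for n
  proof (cases "n = 0")
    case False
    then show ?thesis using bounds[of n] by (simp add: field_simps)
  qed (use a0 in simp)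
  then show ?thesis using l that by blast
qed

lemma pressure_eq: "pressure t = lim (\<lambda>n. 1 / real n * ln (weight_sum t n))"
proof -
  have "(\<Sum>\<^sub>\<infinity> as \<in> {as. length as = n \<and> set as \<subseteq> {1..}}. real_of_int (cfrac_denom as) powr (-2 * t))
      = weight_sum t n" for n
    unfolding weight_sum_def words_def[symmetric]
    by (rule infsum_cong) (simp add: weight_def cfrac_denom_eq[OF words_pos])
  then show ?thesis by (simp add: pressure_def)
qed

text \<open>The error is a constant factor uniform in the length, so in a long word each free block
  costs just one bounded factor, however short it is.\<close>

lemma pressure_limit:
  assumes "t > 1/2"
  shows "(\<lambda>n. ln (weight_sum t n) / n) \<longlonglongrightarrow> pressure t"
    and "exp (n * pressure t) \<le> weight_sum t n"
    and "weight_sum t n \<le> 4 powr t * exp (n * pressure t)"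
proof -
  note pos = weight_sum_pos[OF assms]
  have le: "ln (weight_sum t (m + n)) \<le> ln (weight_sum t m) + ln (weight_sum t n)" for m n
  proof -
    have "ln (weight_sum t (m + n)) \<le> ln (weight_sum t m * weight_sum t n)"
      using weight_sum_add_le[OF assms, of m n] pos[of "m + n"] by (intro ln_mono) auto
    then show ?thesis using pos[of m] pos[of n] by (simp add: ln_mult)
  qed
  have ge: "ln (weight_sum t m) + ln (weight_sum t n) \<le> t * ln 4 + ln (weight_sum t (m + n))" for m n
  proof -
    have "ln (weight_sum t m * weight_sum t n) \<le> ln (4 powr t * weight_sum t (m + n))"
      using weight_sum_add_ge[OF assms, of m n] pos[of m] pos[of n] by (intro ln_mono) auto
    then show ?thesis using pos[of m] pos[of n] pos[of "m + n"] by (simp add: ln_mult ln_powr)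
  qed
  obtain l where l: "(\<lambda>n. ln (weight_sum t n) / n) \<longlonglongrightarrow> l"
      "\<And>n. n * l \<le> ln (weight_sum t n)" "\<And>n. ln (weight_sum t n) \<le> t * ln 4 + n * l"
    using almost_additive_limit[of "\<lambda>n. ln (weight_sum t n)" "t * ln 4"] le ge by blast
  then have P: "pressure t = l" unfolding pressure_eq using limI[OF l(1)] by simp
  show "(\<lambda>n. ln (weight_sum t n) / n) \<longlonglongrightarrow> pressure t" using l P by simp
  have e: "exp (ln (weight_sum t n)) = weight_sum t n" using pos by simp
  show "exp (n * pressure t) \<le> weight_sum t n"
    using l(2)[of n] unfolding P by (subst e[symmetric]) simp
  have "weight_sum t n \<le> exp (t * ln 4 + n * l)"
    using l(3)[of n] by (subst e[symmetric]) simp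
  then show "weight_sum t n \<le> 4 powr t * exp (n * pressure t)"
    unfolding P by (simp add: exp_add powr_def)
qed

section \<open>Monotonicity and continuity of the pressure\<close>

lemma weight_antimono: "s \<le> t \<Longrightarrow> 0 \<notin> set w \<Longrightarrow> weight t w \<le> weight s w"
  using cden_pos[of w] by (auto simp: weight_def intro!: powr_mono)

lemma weight_sum_antimono:
  assumes "1/2 < s" "s \<le> t"
  shows "weight_sum t n \<le> weight_sum s n"
  unfolding weight_sum_def
  by (rule infsum_mono) (use assms in \<open>auto intro!: weight_summable weight_antimono words_pos\<close>)

lemma pressure_antimono:
  assumes "1/2 < s" "s \<le> t"
  shows "pressure t \<le> pressure s"
proof (rule LIMSEQ_le[OF pressure_limit(1) pressure_limit(1)])
  show "\<exists>N. \<forall>n\<ge>N. ln (weight_sum t n) / n \<le> ln (weight_sum s n) / n"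
    using assms weight_sum_pos[of t] weight_sum_pos[of s] weight_sum_antimono[OF assms]
    by (intro exI[of _ 0] allI impI divide_right_mono ln_mono) auto
qed (use assms in auto)

lemma continuous_on_weight_sum:
  assumes "1/2 < a"
  shows "continuous_on {a..b} (\<lambda>t. weight_sum t n)"
proof -
  have "uniform_limit {a..b} (\<lambda>X t. \<Sum>w\<in>X. weight t w) (\<lambda>t. infsum (weight t) (words n))
      (finite_subsets_at_top (words n))"
    by (rule Weierstrass_m_test_general[where M = "weight a"])
       (use assms in \<open>auto intro!: weight_summable weight_antimono words_pos simp: weight_nonneg\<close>)
  then show ?thesis unfolding weight_sum_def
  proof (rule uniform_limit_theorem[rotated])
    show "\<forall>\<^sub>F X in finite_subsets_at_top (words n). continuous_on {a..b} (\<lambda>t. \<Sum>w\<in>X. weight t w)"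
    proof (rule eventually_finite_subsets_at_top_weakI)
      fix X assume X: "X \<subseteq> words n"
      have "continuous_on {a..b} (\<lambda>t. weight t w)" if "w \<in> X" for w
        unfolding weight_def using cden_pos[OF words_pos, of w n] X that
        by (intro continuous_intros) auto
      then show "continuous_on {a..b} (\<lambda>t. \<Sum>w\<in>X. weight t w)" by (intro continuous_on_sum)
    qed
  qed simp
qed

text \<open>The two-sided bounds of \<open>pressure_limit\<close> make the convergence uniform: on
  \<open>{a..b}\<close> the error at stage \<open>n\<close> is at most
  \<open>b * ln 4 / n\<close>.\<close>

lemma continuous_on_pressure:
  assumes "1/2 < a"
  shows "continuous_on {a..b} pressure"
proof (rule uniform_limit_theorem)
  show "\<forall>\<^sub>F n in sequentially. continuous_on {a..b} (\<lambda>t. ln (weight_sum t n) / n)"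
    using eventually_gt_at_top[of 0]
  proof eventually_elim
    case (elim n)
    have "weight_sum t n \<noteq> 0" if "t \<in> {a..b}" for t
      using weight_sum_pos[of t n] that assms by auto
    then show ?case using elim assms
      by (intro continuous_intros continuous_on_weight_sum) auto
  qed
  show "uniform_limit {a..b} (\<lambda>n t. ln (weight_sum t n) / n) pressure sequentially"
  proof (rule uniform_limitI)
    fix e :: real assume e: "e > 0"
    have "(\<lambda>n. b * ln 4 / real n) \<longlonglongrightarrow> 0" by real_asymp
    then have "\<forall>\<^sub>F n in sequentially. b * ln 4 / real n < e" using e by (rule order_tendstoD)
    with eventually_gt_at_top[of 0]
    show "\<forall>\<^sub>F n in sequentially. \<forall>t\<in>{a..b}. dist (ln (weight_sum t n) / n) (pressure t) < e"
    proof eventually_elim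
      case (elim n)
      show ?case
      proof
        fix t assume t: "t \<in> {a..b}"
        then have t2: "t > 1/2" using assms by simp
        have "ln (exp (n * pressure t)) \<le> ln (weight_sum t n)"
          using pressure_limit(2)[OF t2, of n] by (intro ln_mono) auto
        moreover have "ln (weight_sum t n) \<le> ln (4 powr t * exp (n * pressure t))"
          using pressure_limit(3)[OF t2, of n] weight_sum_pos[OF t2] by (intro ln_mono) auto
        moreover have "ln (4 powr t * exp (n * pressure t)) = t * ln 4 + n * pressure t"
          by (simp add: ln_mult ln_powr)
        moreover have "t * ln 4 \<le> b * ln 4" using t by simp
        ultimately have "n * pressure t \<le> ln (weight_sum t n)" "ln (weight_sum t n) \<le> b * ln 4 + n * pressure t"
          by (simp, linarith)
        then have "0 \<le> ln (weight_sum t n) - n * pressure t" "ln (weight_sum t n) - n * pressure t \<le> b * ln 4"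
          by linarith+
        from divide_right_mono[OF this(1), of "real n"] divide_right_mono[OF this(2), of "real n"]
        have "0 \<le> (ln (weight_sum t n) - n * pressure t) / n"
            "(ln (weight_sum t n) - n * pressure t) / n \<le> b * ln 4 / n"
          by simp_all
        moreover have "(ln (weight_sum t n) - n * pressure t) / n = ln (weight_sum t n) / n - pressure t"
          using elim(1) by (simp add: diff_divide_distrib)
        ultimately have "0 \<le> ln (weight_sum t n) / n - pressure t"
            "ln (weight_sum t n) / n - pressure t \<le> b * ln 4 / n"
          by simp_all
        then show "dist (ln (weight_sum t n) / n) (pressure t) < e"
          using elim(2) by (simp add: dist_real_def)
      qed
    qed
  qed
qed simp

(* The weights 1 / (q (q + p)), which are the lengths of the cylinders of the reversed words, are
   preserved by telescoping when a letter is prepended. *)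
lemma sum_cylinder_lengths_le_1:
  assumes "finite F" "F \<subseteq> words n"
  shows "(\<Sum>w\<in>F. 1 / (real (cden w) * (real (cden w) + cnum w))) \<le> 1"
  using assms
proof (induction n arbitrary: F)
  case 0
  then have "F = {} \<or> F = {[]}" by (auto simp: words_0)
  then show ?case by auto
next
  case (Suc n)
  define f where "f w = 1 / (real (cden w) * (real (cden w) + cnum w))" for w
  have f0: "f w \<ge> 0" for w by (simp add: f_def)
  have ne: "w \<noteq> [] \<and> hd w \<ge> 1 \<and> tl w \<in> words n" if "w \<in> F" for w
  proof -
    from that Suc.prems(2) have "w \<in> words (Suc n)" by blast
    then show ?thesis by (cases w) (auto simp: words_def)
  qed
  obtain N where N: "\<And>w. w \<in> F \<Longrightarrow> hd w \<le> N"
    using Suc.prems(1) by (metis finite_imageI finite_nat_set_iff_bounded_le imageI)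
  have tele: "(\<Sum>a\<in>{1..N}. f (a # w)) \<le> f w" if w: "w \<in> words n" for w
  proof -
    define q p where "q = real (cden w)" and "p = real (cnum w)"
    have q: "q > 0" "p \<ge> 0" using cden_pos[OF words_pos[OF w]] by (simp_all add: q_def p_def)
    \<comment> \<open>Here \<open>cden (a # w) = a * q + p\<close>, and adding
      \<open>cnum (a # w) = q\<close> gives the same expression for \<open>Suc a\<close>, so the
      terms telescope.\<close>
    have "f (a # w) = 1 / q * (1 / (a * q + p) - 1 / (Suc a * q + p))" if "a \<in> {1..N}" for a
    proof -
      have "real a * q + p > 0" "real (Suc a) * q + p > 0" using q that by (auto intro!: add_pos_nonneg)
      then show ?thesis using q(1) by (simp add: f_def q_def[symmetric] p_def[symmetric] divide_simps) (simp add: algebra_simps)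
    qed
    then have "(\<Sum>a\<in>{1..N}. f (a # w)) = 1 / q * (\<Sum>a\<in>{1..N}. 1 / (a * q + p) - 1 / (Suc a * q + p))"
      by (subst sum_distrib_left) (rule sum.cong, auto)
    also have "(\<Sum>a\<in>{1..N}. 1 / (a * q + p) - 1 / (Suc a * q + p)) = 1 / (q + p) - 1 / (Suc N * q + p)"
      by (induction N) simp_all
    also have "1 / q * \<dots> \<le> 1 / q * (1 / (q + p))" using q by (intro mult_left_mono) auto
    finally show ?thesis by (simp add: f_def q_def p_def)
  qed
  have "sum f F \<le> sum f ((\<lambda>(a, w). a # w) ` ({1..N} \<times> tl ` F))"
  proof (rule sum_mono2)
    show "F \<subseteq> (\<lambda>(a, w). a # w) ` ({1..N} \<times> tl ` F)"
    proof
      fix w assume "w \<in> F"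
      then have "w = (\<lambda>(a, w). a # w) (hd w, tl w)" "(hd w, tl w) \<in> {1..N} \<times> tl ` F"
        using ne[of w] N[of w] by auto
      then show "w \<in> (\<lambda>(a, w). a # w) ` ({1..N} \<times> tl ` F)" by blast
    qed
  qed (use Suc.prems f0 in auto)
  also have "\<dots> = (\<Sum>(a, w)\<in>{1..N} \<times> tl ` F. f (a # w))"
    by (subst sum.reindex) (auto simp: inj_on_def case_prod_unfold)
  also have "\<dots> = (\<Sum>w\<in>tl ` F. \<Sum>a\<in>{1..N}. f (a # w))"
    by (subst sum.swap) (simp add: sum.cartesian_product)
  also have "\<dots> \<le> (\<Sum>w\<in>tl ` F. f w)" using tele ne by (intro sum_mono) auto
  also have "\<dots> \<le> 1" unfolding f_def using Suc.prems ne by (intro Suc.IH) auto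
  finally show ?case by (simp add: f_def)
qed

text \<open>Up to a factor 2, the weights at exponent 1 are the lengths bounded in
  \<open>sum_cylinder_lengths_le_1\<close>, so the word sums stay bounded.\<close>

lemma pressure_1: "pressure 1 \<le> 0"
proof -
  have "weight_sum 1 n \<le> 2" for n
    unfolding weight_sum_def
  proof (rule summable_on_finite_sums_le(2))
    fix F assume F: "finite F" "F \<subseteq> words n"
    have "weight 1 w \<le> 2 * (1 / (real (cden w) * (real (cden w) + cnum w)))" if "w \<in> F" for w
    proof -
      have "0 \<notin> set w" using F that words_pos by blast
      then have q: "real (cden w) > 0" "real (cnum w) \<le> cden w" using cden_pos cnum_le_cden by auto
      have "weight 1 w = 2 / (real (cden w) * (real (cden w) + cden w))"
        using q by (simp add: weight_def powr_minus divide_simps power2_eq_square)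
      also have "\<dots> \<le> 2 / (real (cden w) * (real (cden w) + cnum w))"
        using q by (intro divide_left_mono mult_left_mono mult_pos_pos) auto
      finally show ?thesis by simp
    qed
    then have "sum (weight 1) F \<le> 2 * (\<Sum>w\<in>F. 1 / (real (cden w) * (real (cden w) + cnum w)))"
      unfolding sum_distrib_left by (rule sum_mono)
    then show "sum (weight 1) F \<le> 2" using sum_cylinder_lengths_le_1[OF F] by simp
  qed (simp add: weight_nonneg)
  then have "exp (real n * pressure 1) \<le> 2" for n using pressure_limit(2)[where t = 1 and n = n] by (simp add: order_trans)
  then have bnd: "real n * pressure 1 \<le> ln 2" for n by (metis exp_gt_zero ln_exp ln_mono)
  show ?thesis
  proof (rule ccontr)
    assume "\<not> pressure 1 \<le> 0"
    then obtain n :: nat where "ln 2 < n * pressure 1" using reals_Archimedean3 by (metis linorder_not_le)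
    with bnd[of n] show False by simp
  qed
qed

text \<open>One-letter words suffice: at exponent 1/2 their weights form the harmonic series, and
  \<open>pressure_limit\<close> turns a large \<open>weight_sum t 1\<close> into a large pressure.
  The 4 in \<open>Y\<close> bounds \<open>4 powr t\<close>.\<close>

lemma pressure_unbounded: "\<exists>t. 1/2 < t \<and> t < 1 \<and> pressure t > X"
proof -
  define Y where "Y = 4 * exp X"
  have "\<not> summable (\<lambda>n. 1 / real (Suc n))" using not_summable_harmonic[where 'a=real]
    by (subst (asm) summable_Suc_iff[symmetric]) (simp add: inverse_eq_divide)
  have "\<not> (\<forall>N. (\<Sum>k<N. 1 / real (Suc k)) \<le> Y)"
  proof
    assume "\<forall>N. (\<Sum>k<N. 1 / real (Suc k)) \<le> Y"
    then have "summable (\<lambda>n. 1 / real (Suc n))"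
      by (intro bounded_imp_summable[of _ Y]) (auto simp: lessThan_Suc_atMost[symmetric] simp del: of_nat_Suc sum.lessThan_Suc)
    then show False using \<open>\<not> summable (\<lambda>n. 1 / real (Suc n))\<close> by simp
  qed
  then obtain N where N: "(\<Sum>k<N. 1 / real (Suc k)) > Y" by (metis linorder_not_le)
  have "((\<lambda>t. \<Sum>k<N. real (Suc k) powr (-2 * t)) \<longlongrightarrow> (\<Sum>k<N. real (Suc k) powr (-2 * (1/2)))) (at_right (1/2))"
    by (intro tendsto_intros) auto
  moreover have "(\<Sum>k<N. real (Suc k) powr (-2 * (1/2))) = (\<Sum>k<N. 1 / real (Suc k))"
    by (intro sum.cong) (auto simp: powr_minus inverse_eq_divide)
  ultimately have "\<forall>\<^sub>F t in at_right (1/2). (\<Sum>k<N. real (Suc k) powr (-2 * t)) > Y"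
    using N order_tendstoD(1) by metis
  moreover have "\<forall>\<^sub>F t in at_right (1/2 :: real). t \<in> {1/2<..<1}"
    by (rule eventually_at_right_real) simp
  ultimately have "\<forall>\<^sub>F t in at_right (1/2). (\<Sum>k<N. real (Suc k) powr (-2 * t)) > Y \<and> t \<in> {1/2<..<1}"
    by (rule eventually_conj)
  then obtain t where t: "(\<Sum>k<N. real (Suc k) powr (-2 * t)) > Y" "1/2 < t" "t < 1"
    using eventually_happens'[of "at_right (1/2::real)"] by (metis (no_types, lifting) greaterThanLessThan_iff trivial_limit_at_right_real)
  have "Y < sum (weight t) ((\<lambda>k. [Suc k]) ` {..<N})"
    using t(1) by (subst sum.reindex) (auto simp: inj_on_def weight_singleton simp del: of_nat_Suc)
  also have "\<dots> \<le> weight_sum t 1" unfolding weight_sum_def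
    using t by (intro finite_sum_le_infsum weight_summable) (auto simp: weight_nonneg words_1)
  also have "\<dots> \<le> 4 powr t * exp (pressure t)" using pressure_limit(3)[OF t(2), of 1] by simp
  also have "\<dots> \<le> 4 * exp (pressure t)" using t powr_mono[of t 1 4] by simp
  finally show ?thesis using t by (auto simp: Y_def)
qed

section \<open>The equation that determines the dimension\<close>

definition ratio :: "real \<Rightarrow> real" where
  "ratio t = (sqrt t + sqrt (2 * t - 1))\<^sup>2"

lemma ratio_strict_mono:
  assumes "1/2 \<le> s" "s < t"
  shows "ratio s < ratio t"
  unfolding ratio_def
  by (rule power_strict_mono) (use assms in \<open>auto intro!: add_strict_mono\<close>)

lemma ratio_pos: "1/2 < t \<Longrightarrow> ratio t > 0"
  unfolding ratio_def by (intro zero_less_power add_pos_nonneg) auto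

text \<open>Intermediate values between a point of large pressure near 1/2 and the point 1. As the
  pressure is antimonotone and \<open>ratio\<close> strictly increasing, the solution separates
  strict inequalities of opposite sign; these feed the two dimension bounds and give
  uniqueness.\<close>

lemma pressure_equation:
  assumes B: "B > 0"
  obtains t where "1/2 < t" "t < 1" "pressure t = ratio t * B"
    "\<And>u. t < u \<Longrightarrow> pressure u < ratio u * B"
    "\<And>u. 1/2 < u \<Longrightarrow> u < t \<Longrightarrow> pressure u > ratio u * B"
proof -
  \<comment> \<open>The value at 1 dominates \<open>ratio a\<close> wherever \<open>a\<close> lies,
    so the target for the pressure can be fixed before \<open>a\<close> is found.\<close>
  obtain a where a: "1/2 < a" "a < 1" "pressure a > ratio 1 * B" using pressure_unbounded by blast
  have "ratio a * B < ratio 1 * B" using B a by (simp add: ratio_strict_mono)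
  then have 1: "ratio a * B - pressure a \<le> 0" using a by simp
  have r1: "ratio 1 * B > 0" using B ratio_pos[of 1] by simp
  then have 2: "0 \<le> ratio 1 * B - pressure 1" using pressure_1 by linarith
  have "continuous_on {a..1} (\<lambda>t. ratio t * B - pressure t)"
    unfolding ratio_def using a by (intro continuous_intros continuous_on_pressure)
  from IVT'[of "\<lambda>t. ratio t * B - pressure t", OF 1 2 _ this] a
  obtain t where t: "a \<le> t" "t \<le> 1" "ratio t * B - pressure t = 0" by auto
  have "t \<noteq> 1" using t pressure_1 r1 by auto
  moreover have "pressure u < ratio u * B" if "t < u" for u
  proof -
    have "pressure u \<le> pressure t" using that t a by (intro pressure_antimono) auto
    moreover have "ratio t * B < ratio u * B"
      using ratio_strict_mono[of t u] that t a B by (intro mult_strict_right_mono) auto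
    ultimately show ?thesis using t by linarith
  qed
  moreover have "pressure u > ratio u * B" if "1/2 < u" "u < t" for u
  proof -
    have "pressure t \<le> pressure u" using that t a by (intro pressure_antimono) auto
    moreover have "ratio u * B < ratio t * B"
      using ratio_strict_mono[of u t] that t a B by (intro mult_strict_right_mono) auto
    ultimately show ?thesis using t by linarith
  qed
  ultimately show ?thesis using t a by (intro that[of t]) auto
qed

subsection \<open>The optimal growth rate of record times\<close>

(* The ratio u between the partial sum up to L k and L k itself satisfies u' = 1 + u / r with
   alpha u + beta r < c.  The discriminant of the resulting quadratic inequality is negative, so u
   increases by at least 1 - v in each step, although it is bounded by c / alpha. *)
lemma growth_rate_bound:
  fixes L :: "nat \<Rightarrow> real"
  assumes \<alpha>: "\<alpha> > 0" and \<beta>: "\<beta> > 0" and c: "c < (sqrt \<alpha> + sqrt \<beta>)\<^sup>2"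
    and L: "\<And>k. L k > 0"
    and less: "\<And>k. \<alpha> * (\<Sum>j<Suc k. L j) + \<beta> * L (Suc k) < c * L k"
  shows False
proof -
  define S where "S k = (\<Sum>j<k. L j)" for k
  define u where "u k = S (Suc k) / L k" for k
  have S0: "S k \<ge> 0" for k unfolding S_def using L by (intro sum_nonneg) (simp add: less_imp_le)
  have lt: "\<alpha> * S (Suc k) + \<beta> * L (Suc k) < c * L k" for k using less by (simp add: S_def)
  have "0 < \<alpha> * S (Suc 0) + \<beta> * L (Suc 0)"
    using S0[of "Suc 0"] \<alpha> \<beta> L[of "Suc 0"] by (intro add_nonneg_pos mult_nonneg_nonneg mult_pos_pos) auto
  then have "0 < c * L 0" using lt[of 0] by linarith
  then have c0: "c > 0" using L[of 0] by (simp add: zero_less_mult_iff)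
  \<comment> \<open>Thus \<open>sqrt c - m\<close> is the smaller of \<open>sqrt c\<close> and
    \<open>sqrt \<beta>\<close>; the maximum with 0 covers the case
    \<open>c < \<beta>\<close>.\<close>
  define m where "m = max 0 (sqrt c - sqrt \<beta>)"
  have "sqrt c < sqrt \<alpha> + sqrt \<beta>" using c \<alpha> \<beta> by (simp add: real_less_lsqrt)
  then have m: "0 \<le> m" "m < sqrt \<alpha>" using \<alpha> by (auto simp: m_def)
  have "(sqrt c - m)\<^sup>2 \<le> (sqrt \<beta>)\<^sup>2"
    using \<beta> c0 by (intro power_mono) (auto simp: m_def)
  then have disc: "c + m\<^sup>2 - \<beta> \<le> 2 * sqrt c * m" using \<beta> c0 by (simp add: power2_diff)
  define v where "v = m\<^sup>2 / \<alpha>"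
  have "m\<^sup>2 < (sqrt \<alpha>)\<^sup>2" using m by (intro power_strict_mono) auto
  then have v: "0 \<le> v" "v < 1" using \<alpha> by (simp_all add: v_def)
  have m2: "m\<^sup>2 = \<alpha> * v" using \<alpha> by (simp add: v_def)
  have u1: "u k \<ge> 1" for k
    using S0[of k] L[of k] by (simp add: u_def S_def divide_simps)
  have step: "u (Suc k) \<ge> u k + (1 - v)" for k
  proof -
    define r where "r = L (Suc k) / L k"
    have r: "r > 0" using L by (simp add: r_def)
    have uS: "u (Suc k) = 1 + u k / r"
      using L[of k] L[of "Suc k"] by (simp add: u_def r_def S_def field_simps)
    have "(\<alpha> * S (Suc k) + \<beta> * L (Suc k)) / L k < c" using lt[of k] L[of k] by (simp add: divide_less_eq)
    then have ur: "\<beta> * r < c - \<alpha> * u k" by (simp add: u_def r_def add_divide_distrib)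
    \<comment> \<open>The goal \<open>(c - \<alpha> * u k) * (u k - v) \<le> \<beta> * u k\<close>
      is the quadratic inequality
      \<open>\<alpha> u^2 - (c + \<alpha> v - \<beta>) u + c v \<ge> 0\<close>. By
      \<open>disc\<close> its linear coefficient may be replaced by \<open>2 * sqrt c * m\<close>,
      after which it is a perfect square up to the factor \<alpha>.\<close>
    have "0 \<le> (sqrt c * m - \<alpha> * u k)\<^sup>2" by simp
    then have "2 * (sqrt c * m) * (\<alpha> * u k) \<le> c * m\<^sup>2 + (\<alpha> * u k)\<^sup>2"
      using c0 by (simp add: power2_diff power_mult_distrib)
    then have "\<alpha> * (2 * sqrt c * m * u k) \<le> \<alpha> * (c * v + \<alpha> * (u k)\<^sup>2)"
      unfolding m2 by (simp add: algebra_simps power2_eq_square)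
    then have "2 * sqrt c * m * u k \<le> c * v + \<alpha> * (u k)\<^sup>2" using \<alpha> by simp
    moreover have "(c + \<alpha> * v - \<beta>) * u k \<le> 2 * sqrt c * m * u k"
      using disc u1[of k] unfolding m2 by (intro mult_right_mono) auto
    ultimately have "(c - \<alpha> * u k) * (u k - v) \<le> \<beta> * u k"
      by (simp add: algebra_simps power2_eq_square)
    moreover have "\<beta> * r * (u k - v) \<le> (c - \<alpha> * u k) * (u k - v)"
      using ur u1[of k] v by (intro mult_right_mono) auto
    ultimately have "\<beta> * (r * (u k - v)) \<le> \<beta> * u k" by simp
    then have "r * (u k - v) \<le> u k" using \<beta> by simp
    then have "u k - v \<le> u k / r" using r by (simp add: pos_le_divide_eq mult.commute)
    then show ?thesis using uS by simp
  qed
  have lower: "u k \<ge> real k * (1 - v)" for k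
  proof (induction k)
    case 0
    then show ?case using u1[of 0] by simp
  next
    case (Suc k)
    then show ?case using step[of k] by (simp add: algebra_simps)
  qed
  have upper: "u k < c / \<alpha>" for k
  proof -
    have "\<beta> * L (Suc k) > 0" using \<beta> L by simp
    then have "\<alpha> * S (Suc k) < c * L k" using lt[of k] by linarith
    then show ?thesis using \<alpha> L[of k] by (simp add: u_def divide_simps mult.commute)
  qed
  obtain k where "real k * (1 - v) > c / \<alpha>" using reals_Archimedean3[of "1 - v"] v by auto
  with lower[of k] upper[of k] show False by simp
qed

text \<open>If this failed, a shifted \<open>L\<close> would contradict
  \<open>growth_rate_bound\<close>: the room between \<open>c\<close> and \<open>c'\<close> absorbs
  the factor \<open>\<rho>\<close> and the additive terms that relate \<open>n (Suc k)\<close> to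
  \<open>L k\<close>.\<close>

lemma growth_rate_infinitely_often:
  fixes n L :: "nat \<Rightarrow> nat"
  assumes \<alpha>: "\<alpha> > 0" and \<beta>: "\<beta> > 0"
    and c: "0 < c" "c < c'" "c' < (sqrt \<alpha> + sqrt \<beta>)\<^sup>2" and \<rho>: "1 < \<rho>" "\<rho> < c' / c"
    and L: "\<And>k. k < L k"
    and n: "\<And>k. real (n (Suc k)) \<le> \<rho> * (L k + 1) + 1"
  shows "infinite {k. c * n k \<le> \<alpha> * (\<Sum>j<k. real (L j)) + \<beta> * L k}"
proof
  assume fin: "finite {k. c * n k \<le> \<alpha> * (\<Sum>j<k. real (L j)) + \<beta> * L k}"
  then obtain k1 where k1: "\<And>k. c * n k \<le> \<alpha> * (\<Sum>j<k. real (L j)) + \<beta> * L k \<Longrightarrow> k \<le> k1"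
    unfolding finite_nat_set_iff_bounded_le by blast
  \<comment> \<open>Since \<open>L k > k\<close>, from this index on
    \<open>\<rho> * (L k + 1) + 1\<close> is at most \<open>c' / c * L k\<close>.\<close>
  define k0 where "k0 = k1 + nat \<lceil>(\<rho> + 1) / (c' / c - \<rho>)\<rceil>"
  show False
  proof (rule growth_rate_bound[OF \<alpha> \<beta> c(3), where L = "\<lambda>k. real (L (k0 + k))"])
    show "0 < real (L (k0 + k))" for k using L[of "k0 + k"] by simp
    fix k
    have "(\<rho> + 1) / (c' / c - \<rho>) \<le> real k0" unfolding k0_def by linarith
    also have "\<dots> \<le> real (L (k0 + k))" using L[of "k0 + k"] by simp
    finally have "\<rho> + 1 \<le> (c' / c - \<rho>) * L (k0 + k)"
      using \<rho> by (simp add: pos_divide_le_eq mult.commute)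
    then have "n (Suc (k0 + k)) \<le> c' / c * L (k0 + k)"
      using n[of "k0 + k"] by (simp add: algebra_simps)
    then have nL: "c * n (Suc (k0 + k)) \<le> c' * L (k0 + k)"
      using c by (simp add: field_simps)
    have "\<not> Suc (k0 + k) \<le> k1" by (simp add: k0_def)
    then have "\<alpha> * (\<Sum>j<Suc (k0 + k). real (L j)) + \<beta> * L (Suc (k0 + k)) < c * n (Suc (k0 + k))"
      using k1[of "Suc (k0 + k)"] by linarith
    moreover have "(\<Sum>j<Suc k. real (L (k0 + j))) \<le> (\<Sum>j<Suc (k0 + k). real (L j))"
    proof -
      have "(\<Sum>j<Suc k. real (L (k0 + j))) = sum (\<lambda>j. real (L j)) ((+) k0 ` {..<Suc k})"
        by (subst sum.reindex) auto
      also have "\<dots> \<le> (\<Sum>j<Suc (k0 + k). real (L j))" by (rule sum_mono2) auto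
      finally show ?thesis .
    qed
    ultimately show "\<alpha> * (\<Sum>j<Suc k. real (L (k0 + j))) + \<beta> * real (L (k0 + Suc k)) < c' * L (k0 + k)"
      using nL mult_left_mono[of "\<Sum>j<Suc k. real (L (k0 + j))" "\<Sum>j<Suc (k0 + k). real (L j)" \<alpha>, OF _ less_imp_le[OF \<alpha>]]
      unfolding add_Suc_right by linarith
  qed
qed

subsection \<open>Records of the partial quotients\<close>

lemma max_pquot_attained:
  assumes "u \<ge> 1"
  shows "\<exists>i\<in>{1..u}. pquot i x = max_pquot u x"
proof -
  have "max_pquot u x \<in> (\<lambda>i. pquot i x) ` {1..u}"
    unfolding max_pquot_def using assms by (intro Max_in) auto
  then show ?thesis by force
qed

lemma max_pquot_ge: "i \<in> {1..u} \<Longrightarrow> pquot i x \<le> max_pquot u x"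
  unfolding max_pquot_def by (rule Max_ge) auto

text \<open>Not every record is taken. At scale \<open>u\<close> the current maximum meets the
  requirement \<open>C ^ n\<close> up to time \<open>\<Lambda> u\<close> and no longer; the next
  scale \<open>g (\<Lambda> u)\<close> lies beyond \<open>\<rho>\<close> times that. By then the
  maximum must have grown, and the new one is attained at a position after \<open>u\<close>.\<close>

lemma record_sequence:
  fixes C \<rho> :: real
  assumes C: "C > 1" and \<rho>: "\<rho> > 1" and x: "x \<in> M_hat C"
  obtains n L :: "nat \<Rightarrow> nat" where
    "\<And>k. 1 \<le> n k" "\<And>k. n k \<le> L k" "\<And>k. C ^ L k \<le> pquot (n k) x" "\<And>k. n k < n (Suc k)"
    "\<And>k. real (n (Suc k)) \<le> \<rho> * (L k + 1) + 1" "\<And>k. \<rho> * L k \<le> L (Suc k)"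
proof -
  obtain n1 where n1: "\<And>n. n \<ge> n1 \<Longrightarrow> C ^ n \<le> max_pquot n x"
    using x by (auto simp: M_hat_def eventually_sequentially)
  \<comment> \<open>Positive, so that the maximum over \<open>{1..n}\<close> is attained.\<close>
  define n0 where "n0 = Suc n1"
  have n0: "C ^ n \<le> max_pquot n x" if "n \<ge> n0" for n using n1 that by (simp add: n0_def)
  have "\<exists>i. 1 \<le> i \<and> i \<le> u \<and> pquot i x = max_pquot u x" if "u \<ge> n0" for u
    using max_pquot_attained[of u x] that by (auto simp: n0_def)
  then obtain N where N: "\<And>u. u \<ge> n0 \<Longrightarrow> 1 \<le> N u \<and> N u \<le> u \<and> pquot (N u) x = max_pquot u x"
    by metis
  define \<Lambda> where "\<Lambda> u = nat \<lfloor>log C (max_pquot u x)\<rfloor>" for u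
  have \<Lambda>: "u \<le> \<Lambda> u" "C ^ \<Lambda> u \<le> max_pquot u x" "max_pquot u x < C ^ Suc (\<Lambda> u)" if "u \<ge> n0" for u
  proof -
    have "C ^ u > 0" using C by simp
    with n0[OF that] have pos: "real (max_pquot u x) > 0" by linarith
    from n0[OF that] C pos have ul: "real u \<le> log C (max_pquot u x)"
      by (simp add: le_log_iff powr_realpow)
    then show "u \<le> \<Lambda> u" unfolding \<Lambda>_def by linarith
    have "real (\<Lambda> u) \<le> log C (max_pquot u x)" "log C (max_pquot u x) < real (Suc (\<Lambda> u))"
      using ul unfolding \<Lambda>_def by linarith+
    then show "C ^ \<Lambda> u \<le> max_pquot u x" "max_pquot u x < C ^ Suc (\<Lambda> u)"
      using C pos le_log_iff[of C "max_pquot u x" "real (\<Lambda> u)"] log_less_iff[of C "max_pquot u x" "real (Suc (\<Lambda> u))"]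
      by (simp_all add: powr_realpow del: power_Suc of_nat_Suc)
  qed
  define g where "g l = nat \<lceil>\<rho> * (real l + 1)\<rceil>" for l
  have g: "l + 1 \<le> g l" "\<rho> * l \<le> g l" "real (g l) \<le> \<rho> * (l + 1) + 1" for l
  proof -
    have *: "real l + 1 \<le> \<rho> * (real l + 1)" using \<rho> by simp
    then show "l + 1 \<le> g l" unfolding g_def by linarith
    have "\<rho> * l \<le> \<rho> * (real l + 1)" using \<rho> by simp
    then show "\<rho> * l \<le> g l" unfolding g_def by linarith
    show "real (g l) \<le> \<rho> * (l + 1) + 1"
      using * of_int_ceiling_le_add_one[of "\<rho> * (real l + 1)"] unfolding g_def of_nat_add of_nat_1 by linarith
  qed
  define u where "u = rec_nat n0 (\<lambda>_ v. g (\<Lambda> v))"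
  have u0: "u 0 = n0" and uS: "u (Suc k) = g (\<Lambda> (u k))" for k by (simp_all add: u_def)
  have u: "u k \<ge> n0" for k
  proof (induction k)
    case (Suc k)
    then show ?case using \<Lambda>(1)[of "u k"] g(1)[of "\<Lambda> (u k)"] by (simp add: uS)
  qed (simp add: u0)
  show ?thesis
  proof (rule that[of "\<lambda>k. N (u k)" "\<lambda>k. \<Lambda> (u k)"])
    fix k
    show "1 \<le> N (u k)" using N[OF u] by simp
    show "N (u k) \<le> \<Lambda> (u k)" using N[OF u] \<Lambda>(1)[OF u] le_trans by blast
    show "C ^ \<Lambda> (u k) \<le> pquot (N (u k)) x" using N[OF u] \<Lambda>(2)[OF u] by simp
    have "real (N (u (Suc k))) \<le> real (g (\<Lambda> (u k)))" using N[OF u, of "Suc k"] by (simp add: uS)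
    then show "real (N (u (Suc k))) \<le> \<rho> * (\<Lambda> (u k) + 1) + 1" using g(3)[of "\<Lambda> (u k)"] by linarith
    have "real (g (\<Lambda> (u k))) \<le> \<Lambda> (u (Suc k))" using \<Lambda>(1)[OF u, of "Suc k"] by (simp add: uS)
    then show "\<rho> * \<Lambda> (u k) \<le> \<Lambda> (u (Suc k))" using g(2)[of "\<Lambda> (u k)"] by linarith
    have "real (max_pquot (u k) x) < C ^ Suc (\<Lambda> (u k))" by (rule \<Lambda>(3)[OF u])
    also have "\<dots> \<le> C ^ u (Suc k)" using C g(1)[of "\<Lambda> (u k)"] by (intro power_increasing) (auto simp: uS)
    also have "\<dots> \<le> max_pquot (u (Suc k)) x" by (rule n0[OF u])
    finally have "max_pquot (u k) x < pquot (N (u (Suc k))) x" using N[OF u, of "Suc k"] by simp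
    then have "\<not> N (u (Suc k)) \<le> u k" using max_pquot_ge[of "N (u (Suc k))" "u k" x] N[OF u, of "Suc k"] by fastforce
    then show "N (u k) < N (u (Suc k))" using N[OF u, of k] by simp
  qed
qed

subsection \<open>Words with prescribed large entries\<close>

text \<open>Comparison with the integral of \<open>x powr (-2 * t)\<close> from \<open>m\<close>;
  the summand 1 in the constant pays for the first term.\<close>

lemma sum_powr_tail_le:
  fixes t :: real
  assumes t: "t > 1/2" and X: "X \<ge> 1" and F: "finite F" "\<And>b. b \<in> F \<Longrightarrow> X \<le> real b"
  shows "(\<Sum>b\<in>F. real b powr (-2 * t)) \<le> (1 + 1 / (2 * t - 1)) * X powr (1 - 2 * t)"
proof -
  define m where "m = nat \<lceil>X\<rceil>"
  have m: "X \<le> m" "m \<ge> 1" using X unfolding m_def by linarith+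
  have mF: "m \<le> b" if "b \<in> F" for b using F(2)[OF that] unfolding m_def by linarith
  define a where "a = 2 * t - 1"
  have a: "a > 0" using t by (simp add: a_def)
  have step: "real (Suc N) powr (-2 * t) \<le> 1 / a * (real N powr (-a) - real (Suc N) powr (-a))" if N: "N \<ge> 1" for N
  proof -
    have "\<exists>z>real N. z < real (Suc N) \<and>
        real (Suc N) powr (-a) - real N powr (-a) = (real (Suc N) - real N) * (-a * z powr (-a - 1))"
      by (rule MVT2) (use N in \<open>auto intro!: derivative_eq_intros\<close>)
    then obtain z where z: "real N < z" "z < real (Suc N)"
        "real N powr (-a) - real (Suc N) powr (-a) = a * z powr (-a - 1)" by auto
    have "real (Suc N) powr (-2 * t) \<le> z powr (-a - 1)"
      using z N t by (auto simp: a_def intro!: powr_mono2')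
    then show ?thesis using a unfolding z(3) by simp
  qed
  have sum: "(\<Sum>b=m..N. real b powr (-2 * t)) \<le> (1 + 1 / a) * real m powr (-a) - 1 / a * real N powr (-a)"
    if "N \<ge> m" for N
    using that
  proof (induction N rule: dec_induct)
    case base
    have "real m powr (-2 * t) \<le> real m powr (-a)" using m by (intro powr_mono) (auto simp: a_def)
    then show ?case by (simp add: algebra_simps)
  next
    case (step N)
    then have "(\<Sum>b=m..Suc N. real b powr (-2 * t)) = (\<Sum>b=m..N. real b powr (-2 * t)) + real (Suc N) powr (-2 * t)"
      by (simp add: sum.cl_ivl_Suc)
    with step.IH \<open>\<And>N. N \<ge> 1 \<Longrightarrow> _\<close>[of N] m step.hyps show ?case by (simp add: algebra_simps)
  qed
  define N where "N = Max (insert m F)"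
  have N: "F \<subseteq> {m..N}" "N \<ge> m" using F(1) mF by (auto simp: N_def)
  have "(\<Sum>b\<in>F. real b powr (-2 * t)) \<le> (\<Sum>b=m..N. real b powr (-2 * t))"
    using N by (intro sum_mono2) auto
  also have "\<dots> \<le> (1 + 1 / a) * real m powr (-a)"
  proof -
    have "1 / a * real N powr (-a) \<ge> 0" using a by simp
    with sum[OF N(2)] show ?thesis by linarith
  qed
  also have "\<dots> \<le> (1 + 1 / a) * X powr (-a)"
    using a m X by (intro mult_left_mono powr_mono2') auto
  finally show ?thesis by (simp add: a_def)
qed

(* A pattern lists, latest first, the lengths g of the free blocks of a word and the exponents l
   of the lower bounds C ^ l for the entries that follow them. *)
fun pattern_words :: "real \<Rightarrow> (nat \<times> nat) list \<Rightarrow> nat list set" where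
  "pattern_words C [] = {[]}"
| "pattern_words C ((g, l) # ps) = {w @ u @ [b] |w u b. w \<in> pattern_words C ps \<and> u \<in> words g \<and> C ^ l \<le> real b}"

definition pattern_length :: "(nat \<times> nat) list \<Rightarrow> nat" where
  "pattern_length ps = (\<Sum>(g, l)\<leftarrow>ps. Suc g)"

definition pattern_weight :: "(nat \<times> nat) list \<Rightarrow> nat" where
  "pattern_weight ps = (\<Sum>(g, l)\<leftarrow>ps. l)"

lemma pattern_words_pos: "C > 1 \<Longrightarrow> w \<in> pattern_words C ps \<Longrightarrow> 0 \<notin> set w"
proof (induction ps arbitrary: w)
  case (Cons p ps)
  obtain g l where p: "p = (g, l)" by force
  have "\<not> C ^ l \<le> 0" using Cons.prems(1) by (simp add: not_le)
  then show ?case using Cons words_pos unfolding p by fastforce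
qed simp

text \<open>Each pair contributes a free block, bounded through the pressure, and a record, bounded
  by \<open>sum_powr_tail_le\<close>. Because \<open>P\<close> is nonnegative, the position of the
  record can be counted in \<open>pattern_length\<close> as well. The constants amount to one factor
  \<open>K\<close> per pair.\<close>

lemma pattern_words_weight:
  assumes C: "C > 1" and t: "t > 1/2" and P: "P \<ge> 0" "pressure t \<le> P"
    and K: "K = 4 powr t * (1 + 1 / (2 * t - 1))"
  shows "weight t summable_on pattern_words C ps"
    "infsum (weight t) (pattern_words C ps)
      \<le> K ^ length ps * exp (P * pattern_length ps - (2 * t - 1) * ln C * pattern_weight ps)"
proof -
  have "weight t summable_on pattern_words C ps \<and> infsum (weight t) (pattern_words C ps)
      \<le> K ^ length ps * exp (P * pattern_length ps - (2 * t - 1) * ln C * pattern_weight ps)"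
  proof (induction ps)
    case Nil
    then show ?case by (simp add: pattern_length_def pattern_weight_def weight_def)
  next
    case (Cons p ps)
    obtain g l where p: "p = (g, l)" by force
    define T where "T = {[b] |b::nat. C ^ l \<le> real b}"
    define D where "D = (1 + 1 / (2 * t - 1)) * exp (- (2 * t - 1) * ln C * l)"
    have Cl: "C ^ l \<ge> 1" using C by simp
    have Tpos: "0 \<notin> set w" if "w \<in> T" for w using that Cl by (auto simp: T_def)
    have T: "sum (weight t) F \<le> D" if F: "finite F" "F \<subseteq> T" for F
    proof -
      have "F \<subseteq> (\<lambda>b. [b]) ` {b. C ^ l \<le> real b}" using F by (auto simp: T_def)
      then obtain G where G: "finite G" "G \<subseteq> {b. C ^ l \<le> real b}" "F = (\<lambda>b. [b]) ` G"
        using F(1) by (metis finite_subset_image)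
      have "sum (weight t) F = (\<Sum>b\<in>G. real b powr (-2 * t))"
        unfolding G(3) by (subst sum.reindex) (auto simp: inj_on_def weight_singleton)
      also have "\<dots> \<le> (1 + 1 / (2 * t - 1)) * (C ^ l) powr (1 - 2 * t)"
        using G by (intro sum_powr_tail_le t Cl) auto
      also have "(C ^ l) powr (1 - 2 * t) = exp (- (2 * t - 1) * ln C * l)"
        using C by (simp add: powr_def ln_realpow algebra_simps)
      finally show ?thesis by (simp add: D_def)
    qed
    note Ts = summable_on_finite_sums_le[of T "weight t", OF weight_nonneg T]
    define V where "V = {u @ v |u v. u \<in> words g \<and> v \<in> T}"
    have Vpos: "0 \<notin> set w" if "w \<in> V" for w
      using that Tpos words_pos by (auto simp: V_def)
    have sub: "weight t (u @ v) \<le> weight t u * weight t v" if "u \<in> words g" "v \<in> T" for u v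
      using that t Tpos words_pos by (intro weight_append_le) auto
    note V = infsum_append_le[where f = "weight t", OF weight_nonneg weight_summable[OF t] Ts(1) sub eq_refl[OF V_def]]
    have "infsum (weight t) (words g) \<le> 4 powr t * exp (g * pressure t)"
      using pressure_limit(3)[OF t] by (simp add: weight_sum_def)
    also have "\<dots> \<le> 4 powr t * exp (P * Suc g)"
    proof -
      have "real g * pressure t \<le> real g * P" using P(2) by (intro mult_left_mono) auto
      also have "\<dots> \<le> P * Suc g" using P(1) by (simp add: algebra_simps)
      finally show ?thesis by simp
    qed
    finally have "infsum (weight t) (words g) * infsum (weight t) T \<le> 4 powr t * exp (P * Suc g) * D"
      using Ts(2) by (intro mult_mono) (auto intro!: infsum_nonneg weight_nonneg)
    also have "4 powr t * exp (P * Suc g) * D = K * exp (P * Suc g - (2 * t - 1) * ln C * l)"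
    proof -
      have "exp (P * Suc g - (2 * t - 1) * ln C * l) = exp (P * Suc g) * exp (- (2 * t - 1) * ln C * l)"
        by (subst exp_add[symmetric]) (simp add: algebra_simps)
      then show ?thesis by (simp only: K D_def mult_ac)
    qed
    finally have V2: "infsum (weight t) V \<le> K * exp (P * Suc g - (2 * t - 1) * ln C * l)"
      using V(2) by linarith
    have eq: "pattern_words C (p # ps) = {w @ v |w v. w \<in> pattern_words C ps \<and> v \<in> V}"
      unfolding p V_def T_def by auto (metis append_assoc)
    have sub: "weight t (u @ v) \<le> weight t u * weight t v" if "u \<in> pattern_words C ps" "v \<in> V" for u v
      using that t Vpos pattern_words_pos[OF C] by (intro weight_append_le) auto
    note W = infsum_append_le[where f = "weight t", OF weight_nonneg conjunct1[OF Cons] V(1) sub eq_refl[OF eq]]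
    note W(2)
    also have "infsum (weight t) (pattern_words C ps) * infsum (weight t) V
      \<le> (K ^ length ps * exp (P * pattern_length ps - (2 * t - 1) * ln C * pattern_weight ps))
        * (K * exp (P * Suc g - (2 * t - 1) * ln C * l))"
      using Cons V2 t K by (intro mult_mono) (auto intro!: infsum_nonneg weight_nonneg)
    also have "\<dots> = K ^ length (p # ps) * exp (P * pattern_length (p # ps) - (2 * t - 1) * ln C * pattern_weight (p # ps))"
    proof -
      have "real (pattern_length (p # ps)) = real (pattern_length ps) + real (Suc g)"
        "real (pattern_weight (p # ps)) = real (pattern_weight ps) + real l"
        unfolding p by (simp_all add: pattern_length_def pattern_weight_def)
      then have "exp (P * pattern_length (p # ps) - (2 * t - 1) * ln C * pattern_weight (p # ps))
          = exp (P * pattern_length ps - (2 * t - 1) * ln C * pattern_weight ps)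
            * exp (P * Suc g - (2 * t - 1) * ln C * l)"
        unfolding exp_add[symmetric] by (simp only: algebra_simps)
      then show ?thesis by simp
    qed
    finally show ?case using W(1) by blast
  qed
  then show "weight t summable_on pattern_words C ps"
    "infsum (weight t) (pattern_words C ps)
      \<le> K ^ length ps * exp (P * pattern_length ps - (2 * t - 1) * ln C * pattern_weight ps)"
    by auto
qed

subsection \<open>The upper bound\<close>

lemma sum_le_suminf_fibres:
  fixes c :: "'a \<Rightarrow> real" and l :: "'a \<Rightarrow> nat" and N d :: "nat \<Rightarrow> real"
  assumes "finite T" "\<And>L. real (card {x \<in> T. l x = L}) \<le> N L" "\<And>x. x \<in> T \<Longrightarrow> c x \<le> d (l x)"
    and d: "\<And>L. d L \<ge> 0" and summable: "summable (\<lambda>L. N L * d L)"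
  shows "sum c T \<le> (\<Sum>L. N L * d L)"
proof -
  have N: "N L * d L \<ge> 0" for L using assms(2)[of L] d[of L] by (intro mult_nonneg_nonneg) auto
  have "sum c T = (\<Sum>L\<in>l ` T. \<Sum>x | x \<in> T \<and> l x = L. c x)"
    by (rule sum.image_gen) (fact assms(1))
  also have "\<dots> \<le> (\<Sum>L\<in>l ` T. N L * d L)"
  proof (rule sum_mono)
    fix L
    have "(\<Sum>x | x \<in> T \<and> l x = L. c x) \<le> real (card {x \<in> T. l x = L}) * d L"
      using assms(3) by (intro sum_bounded_above) auto
    also have "\<dots> \<le> N L * d L" using assms(2) d by (intro mult_right_mono) auto
    finally show "(\<Sum>x | x \<in> T \<and> l x = L. c x) \<le> N L * d L" .
  qed
  also have "\<dots> \<le> (\<Sum>L. N L * d L)"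
    using assms(1) N by (intro sum_le_suminf summable) auto
  finally show ?thesis .
qed

text \<open>The number of patterns is the exponential of a squared logarithm, and the constants
  \<open>K\<close> contribute a power of \<open>l\<close>; both lose against
  \<open>exp (- \<epsilon> * l)\<close>.\<close>

lemma summable_subexponential:
  fixes D k \<epsilon> :: real
  assumes "D > 0" "k \<ge> 0" "\<epsilon> > 0"
  shows "summable (\<lambda>l::nat. (real l + 1) * (D * ln (real l) + 1) * exp (2 * D * ln (real l) * ln (real l + 1))
    * exp ((D * ln (real l) + 1) * k) * exp (- \<epsilon> * real l))"
proof (rule summable_comparison_test_bigo)
  show "summable (\<lambda>n. norm (1 / real n ^ 2))"
    using inverse_power_summable[of 2, where 'a = real] by (simp add: divide_inverse)
  show "(\<lambda>l. (real l + 1) * (D * ln (real l) + 1) * exp (2 * D * ln (real l) * ln (real l + 1))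
    * exp ((D * ln (real l) + 1) * k) * exp (- \<epsilon> * real l)) \<in> O(\<lambda>n. 1 / real n ^ 2)"
  proof (cases "k = 0")
    case True
    show ?thesis unfolding True using assms by real_asymp
  next
    case False
    then have "k > 0" using assms by simp
    then show ?thesis using assms by real_asymp
  qed
qed

text \<open>A pattern consists of at most \<open>ln l / ln \<rho>\<close> pairs, each with
  \<open>(l + 1)^2\<close> possible values.\<close>

lemma card_patterns_le:
  fixes \<rho> :: real
  assumes \<rho>: "\<rho> > 1"
  shows "finite {(ps, g). \<rho> ^ length ps \<le> real l \<and> g \<le> l \<and> set ps \<subseteq> {..l} \<times> {..l}}" (is "finite ?G")
    "real (card {(ps, g). \<rho> ^ length ps \<le> real l \<and> g \<le> l \<and> set ps \<subseteq> {..l} \<times> {..l}})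
      \<le> (real l + 1) * (1 / ln \<rho> * ln l + 1) * exp (2 * (1 / ln \<rho>) * ln l * ln (real l + 1))"
proof -
  define h where "h = nat \<lfloor>1 / ln \<rho> * ln (real l)\<rfloor>"
  have len: "length ps \<le> h" "l \<ge> 1" if "\<rho> ^ length ps \<le> real l" for ps :: "(nat \<times> nat) list"
  proof -
    have "1 \<le> \<rho> ^ length ps" using \<rho> by simp
    then have l: "real l \<ge> 1" using that by linarith
    then show "l \<ge> 1" by simp
    have "length ps * ln \<rho> = ln (\<rho> ^ length ps)" using \<rho> by (simp add: ln_realpow)
    also have "\<dots> \<le> ln l" using that \<rho> l by (subst ln_le_cancel_iff) auto
    finally have "length ps \<le> 1 / ln \<rho> * ln l" using \<rho> by (simp add: field_simps)
    then show "length ps \<le> h" unfolding h_def by (metis floor_of_nat floor_mono nat_int nat_mono of_nat_le_iff le_nat_iff)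
  qed
  define A where "A = {..l} \<times> {..l}"
  have A: "finite A" "card A = (l + 1) ^ 2" by (simp_all add: A_def card_cartesian_product power2_eq_square)
  have sub: "?G \<subseteq> {ps. set ps \<subseteq> A \<and> length ps \<le> h} \<times> {..l}" using len by (auto simp: A_def)
  have fin: "finite ({ps. set ps \<subseteq> A \<and> length ps \<le> h} \<times> {..l})"
    using finite_lists_length_le[OF A(1)] by simp
  show "finite ?G" using finite_subset[OF sub fin] .
  show "real (card ?G) \<le> (real l + 1) * (1 / ln \<rho> * ln l + 1) * exp (2 * (1 / ln \<rho>) * ln l * ln (real l + 1))"
  proof (cases "l = 0")
    case True
    then have "?G = {}" using len(2) by auto
    then have "card ?G = 0" by (metis card.empty)
    then show ?thesis using True by simp
  next
    case False
    then have l0: "ln (real l) \<ge> 0" by simp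
    have h: "real h \<le> 1 / ln \<rho> * ln l" using l0 \<rho> unfolding h_def by (simp add: zero_le_divide_iff)
    have "card ?G \<le> (\<Sum>i\<le>h. card A ^ i) * (l + 1)"
      using card_mono[OF fin sub] A(1) by (simp add: card_cartesian_product card_lists_length_le)
    also have "\<dots> \<le> (h + 1) * card A ^ h * (l + 1)"
      using sum_bounded_above[of "{..h}" "\<lambda>i. card A ^ i" "card A ^ h"]
      by (intro mult_right_mono) (auto simp: A power_increasing)
    finally have "card ?G \<le> (h + 1) * card A ^ h * (l + 1)" .
    then have "real (card ?G) \<le> real ((h + 1) * card A ^ h * (l + 1))" by (simp only: of_nat_le_iff)
    also have "\<dots> = (real h + 1) * (real l + 1) ^ (2 * h) * (real l + 1)"
      unfolding A power_mult[symmetric] of_nat_mult of_nat_power of_nat_add of_nat_1 ..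
    also have "(real l + 1) ^ (2 * h) = exp (2 * real h * ln (real l + 1))"
      using exp_of_nat_mult[of "2 * h" "ln (real l + 1)"] by (simp add: add_nonneg_pos)
    also have "(real h + 1) * exp (2 * real h * ln (real l + 1)) * (real l + 1)
      \<le> (1 / ln \<rho> * ln l + 1) * exp (2 * (1 / ln \<rho> * ln l) * ln (real l + 1)) * (real l + 1)"
    proof (intro mult_right_mono mult_mono)
      have "2 * real h * ln (real l + 1) \<le> 2 * (1 / ln \<rho> * ln l) * ln (real l + 1)"
        using h by (intro mult_right_mono mult_left_mono) auto
      then show "exp (2 * real h * ln (real l + 1)) \<le> exp (2 * (1 / ln \<rho> * ln l) * ln (real l + 1))" by simp
      have "0 \<le> 1 / ln \<rho> * ln l" using l0 \<rho> by (intro mult_nonneg_nonneg) auto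
      then show "0 \<le> 1 / ln \<rho> * ln l + 1" by linarith
    qed (use h in auto)
    finally show ?thesis by (simp add: mult_ac)
  qed
qed

text \<open>\<open>w\<close> carries the earlier records and \<open>u\<close> is the block before
  the last one. The \<open>+ 1\<close> counts the position of that last record, so that the exponent
  becomes \<open>P\<close> times its index.\<close>

lemma sum_pattern_words_le:
  assumes C: "C > 1" and t: "t > 1/2" and P: "P \<ge> 0" "pressure t \<le> P"
    and K: "K = 4 powr t * (1 + 1 / (2 * t - 1))"
    and F: "finite F" "F \<subseteq> pattern_words C ps \<times> words g"
  shows "(\<Sum>(w, u)\<in>F. weight t (w @ u))
    \<le> K ^ Suc (length ps) * exp (P * (pattern_length ps + g + 1) - (2 * t - 1) * ln C * pattern_weight ps)"
proof -
  note PW = pattern_words_weight[OF C t P K, of ps]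
  have "(\<Sum>(w, u)\<in>F. weight t (w @ u)) \<le> (\<Sum>(w, u)\<in>F. weight t w * weight t u)"
  proof (rule sum_mono, clarify)
    fix w u assume "(w, u) \<in> F"
    then have "0 \<notin> set w" "0 \<notin> set u" using F(2) pattern_words_pos[OF C] words_pos by blast+
    then show "weight t (w @ u) \<le> weight t w * weight t u" using t by (intro weight_append_le) auto
  qed
  also have "\<dots> \<le> (\<Sum>(w, u)\<in>fst ` F \<times> snd ` F. weight t w * weight t u)"
    using F by (intro sum_mono2) (auto intro!: mult_nonneg_nonneg weight_nonneg intro: rev_image_eqI)
  also have "\<dots> = sum (weight t) (fst ` F) * sum (weight t) (snd ` F)"
    by (simp add: sum.cartesian_product[symmetric] sum_product)
  also have "\<dots> \<le> infsum (weight t) (pattern_words C ps) * infsum (weight t) (words g)"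
    using F by (intro mult_mono finite_sum_le_infsum PW(1) weight_summable t sum_nonneg infsum_nonneg weight_nonneg) auto
  also have "\<dots> \<le> (K ^ length ps * exp (P * pattern_length ps - (2 * t - 1) * ln C * pattern_weight ps))
      * (K * exp (P * (g + 1)))"
  proof (intro mult_mono PW(2) infsum_nonneg weight_nonneg)
    have "infsum (weight t) (words g) \<le> 4 powr t * exp (g * pressure t)"
      using pressure_limit(3)[OF t] by (simp add: weight_sum_def)
    also have "\<dots> \<le> K * exp (P * (g + 1))"
    proof (rule mult_mono)
      have "real g * pressure t \<le> real g * P" using P(2) by (intro mult_left_mono) auto
      also have "\<dots> \<le> P * real (g + 1)" using P(1) by (simp add: algebra_simps)
      finally show "exp (real g * pressure t) \<le> exp (P * real (g + 1))" by simp
    next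
      have "4 powr t * 1 \<le> K" unfolding K using t by (intro mult_left_mono) auto
      then show "4 powr t \<le> K" "0 \<le> K" using powr_ge_zero[of 4 t] by linarith+
    qed auto
    finally show "infsum (weight t) (words g) \<le> K * exp (P * (g + 1))" .
  qed (use t K in auto)
  also have "\<dots> = K ^ Suc (length ps) * exp (P * (pattern_length ps + g + 1) - (2 * t - 1) * ln C * pattern_weight ps)"
  proof -
    have "exp (P * real (pattern_length ps + g + 1) - (2 * t - 1) * ln C * real (pattern_weight ps))
        = exp (P * pattern_length ps - (2 * t - 1) * ln C * pattern_weight ps) * exp (P * real (g + 1))"
      unfolding exp_add[symmetric] of_nat_add by (simp only: algebra_simps)
    then show ?thesis by simp
  qed
  finally show ?thesis .
qed

text \<open>The covering sets \<open>J\<close> consist of points that begin with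
  \<open>w @ u\<close> and leave a remainder of at most \<open>1 / C ^ l\<close>, as happens when
  the next digit is at least \<open>C ^ l\<close>. The condition in \<open>G\<close> makes the total
  cost of a pattern exponentially small in \<open>l\<close>, and each point of the set satisfies it
  for infinitely many of its records.\<close>

theorem hausdorff_measure_M_hat_eq_0:
  assumes C: "C > 1" and t: "t > 1/2" and less: "pressure t < ratio t * ln C"
  shows "hausdorff_measure t (M_hat C) = 0"
proof -
  define B where "B = ln C"
  define \<alpha> where "\<alpha> = 2 * t - 1"
  \<comment> \<open>The pressure can be negative, while \<open>pattern_words_weight\<close> asks for
    a nonnegative bound.\<close>
  define P where "P = max 0 (pressure t)"
  define K where "K = 4 powr t * (1 + 1 / (2 * t - 1))"
  \<comment> \<open>The numbers \<open>c1 < c < c' < ratio t\<close> are equally spaced. The first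
    gap yields the decay rate \<open>\<epsilon>\<close>, the second leaves room for
    \<open>\<rho>\<close>, and the third is required by \<open>growth_rate_bound\<close>.\<close>
  define c1 where "c1 = P / B"
  define c where "c = (2 * c1 + ratio t) / 3"
  define c' where "c' = (c1 + 2 * ratio t) / 3"
  define \<rho> where "\<rho> = (1 + c' / c) / 2"
  define \<epsilon> where "\<epsilon> = B * (1 - c1 / c) * t"
  have B: "B > 0" using C by (simp add: B_def)
  have \<alpha>: "\<alpha> > 0" using t by (simp add: \<alpha>_def)
  have P: "P \<ge> 0" "pressure t \<le> P" by (simp_all add: P_def)
  have "P < ratio t * B" using less ratio_pos[OF t] B by (simp add: P_def B_def)
  then have c1: "0 \<le> c1" "c1 < ratio t" using B P by (simp_all add: c1_def divide_less_eq)
  then have c: "0 < c" "c1 < c" "c < c'" "c' < ratio t"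
    using ratio_pos[OF t] by (simp_all add: c_def c'_def field_simps)
  have mid: "1 < (1 + q) / 2 \<and> (1 + q) / 2 < q" if "q > 1" for q :: real using that by simp
  have "c' / c > 1" using c by simp
  note \<rho> = mid[OF this, folded \<rho>_def, THEN conjunct1] mid[OF this, folded \<rho>_def, THEN conjunct2]
  have \<epsilon>: "\<epsilon> > 0" using B c t c1 by (simp add: \<epsilon>_def)
  have "4 powr t * 1 \<le> K" unfolding K_def using t by (intro mult_left_mono) auto
  moreover have "4 powr t \<ge> (1 :: real)" using t by (intro ge_one_powr_ge_zero) auto
  ultimately have K: "K \<ge> 1" by simp

  define G where "G = {(ps, g, l). \<rho> ^ length ps \<le> real l \<and> g \<le> l \<and> set ps \<subseteq> {..l} \<times> {..l} \<and>
    P * (pattern_length ps + g + 1) \<le> B * (\<alpha> * pattern_weight ps + t * l) - \<epsilon> * l}"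
  define W :: "(nat \<times> nat) list \<times> nat \<times> nat \<Rightarrow> (nat list \<times> nat list) set"
    where "W = (\<lambda>(ps, g, l). pattern_words C ps \<times> words g)"
  define I where "I = Sigma G W"
  define J :: "((nat \<times> nat) list \<times> nat \<times> nat) \<times> (nat list \<times> nat list) \<Rightarrow> real set"
    where "J = (\<lambda>((ps, g, l), (w, u)). cmap (w @ u) ` {0..1 / C ^ l})"
  define r :: "((nat \<times> nat) list \<times> nat \<times> nat) \<times> (nat list \<times> nat list) \<Rightarrow> real"
    where "r = (\<lambda>((ps, g, l), (w, u)). 1 / C ^ l / (real (cden (w @ u)))\<^sup>2)"
  define D where "D = 1 / ln \<rho>"
  define N where "N l = (real l + 1) * (D * ln l + 1) * exp (2 * D * ln l * ln (real l + 1))" for l :: nat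
  define d where "d l = exp ((D * ln l + 1) * ln K) * exp (- \<epsilon> * l)" for l :: nat
  have D: "D > 0" using \<rho> by (simp add: D_def)
  have sumNd: "summable (\<lambda>l. N l * d l)"
    using summable_subexponential[of D "ln K" \<epsilon>] D K \<epsilon> by (simp add: N_def d_def mult.assoc)

  have fibre: "(\<Sum>v\<in>F. r (p, v) powr t) \<le> d (snd (snd p))" if p: "p \<in> G" and F: "finite F" "F \<subseteq> W p" for p F
  proof -
    obtain ps g l where p': "p = (ps, g, l)" by (cases p)
    have rw: "r (p, v) powr t = exp (- B * t * l) * (case v of (w, u) \<Rightarrow> weight t (w @ u))" if "v \<in> F" for v
    proof -
      obtain w u where v: "v = (w, u)" by force
      have "0 \<notin> set (w @ u)" using that F(2) pattern_words_pos[OF C] words_pos unfolding v W_def p' by fastforce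
      then have q: "real (cden (w @ u)) > 0" using cden_pos by simp
      have "r (p, v) = exp (- (B * l)) * real (cden (w @ u)) powr (-2)"
        using q C by (simp add: r_def p' v B_def exp_minus powr_minus exp_of_nat2_mult divide_inverse)
      then show ?thesis using q by (simp add: v weight_def powr_mult powr_powr exp_powr_real mult_ac)
    qed
    have "(\<Sum>v\<in>F. r (p, v) powr t) = exp (- B * t * l) * (\<Sum>(w, u)\<in>F. weight t (w @ u))"
      using rw by (simp add: sum_distrib_left)
    also have "\<dots> \<le> exp (- B * t * l) * (K ^ Suc (length ps)
        * exp (P * (pattern_length ps + g + 1) - (2 * t - 1) * ln C * pattern_weight ps))"
      using F by (intro mult_left_mono sum_pattern_words_le C t P K_def) (auto simp: W_def p')
    also have "\<dots> = K ^ Suc (length ps) * exp (P * (pattern_length ps + g + 1) - B * (\<alpha> * pattern_weight ps + t * l))"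
    proof -
      have "exp (P * real (pattern_length ps + g + 1) - B * (\<alpha> * pattern_weight ps + t * l))
        = exp (- B * t * l) * exp (P * (pattern_length ps + g + 1) - (2 * t - 1) * ln C * pattern_weight ps)"
        unfolding exp_add[symmetric] B_def[symmetric] \<alpha>_def[symmetric] exp_inj_iff by (simp add: algebra_simps)
      then show ?thesis by simp
    qed
    also have "\<dots> \<le> K ^ Suc (length ps) * exp (- \<epsilon> * l)"
      using p K unfolding p' G_def by (intro mult_left_mono) auto
    also have "\<dots> \<le> exp ((D * ln l + 1) * ln K) * exp (- \<epsilon> * l)"
    proof (rule mult_right_mono)
      have "1 \<le> \<rho> ^ length ps" using \<rho> by simp
      also have le: "\<dots> \<le> real l" using p by (simp add: G_def p')
      finally have l: "real l \<ge> 1" .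
      have "length ps * ln \<rho> = ln (\<rho> ^ length ps)" using \<rho> by (simp add: ln_realpow)
      also have "\<dots> \<le> ln l" using le \<rho> l by (subst ln_le_cancel_iff) auto
      finally have "length ps \<le> D * ln l" using \<rho> by (simp add: D_def field_simps)
      then have "real (Suc (length ps)) * ln K \<le> (D * ln l + 1) * ln K" using K by (intro mult_right_mono) auto
      moreover have "K ^ Suc (length ps) = exp (real (Suc (length ps)) * ln K)"
        using K by (subst exp_of_nat_mult) simp
      ultimately show "K ^ Suc (length ps) \<le> exp ((D * ln l + 1) * ln K)" by simp
    qed simp
    finally show ?thesis by (simp add: d_def p')
  qed

  show ?thesis
  proof (rule hausdorff_measure_eq_0_limsup[where J = J and I = I and r = r and b = "\<Sum>l. N l * d l"])
    fix i assume "i \<in> I"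
    then obtain ps g l w u where i: "i = ((ps, g, l), (w, u))" and wu: "w \<in> pattern_words C ps" "u \<in> words g"
      by (auto simp: I_def W_def)
    have pos: "0 \<notin> set (w @ u)" using wu pattern_words_pos[OF C] words_pos by auto
    have Cl: "C ^ l > 0" using C by simp
    have dist: "dist y z \<le> r i" if "y \<in> J i" "z \<in> J i" for y z
    proof -
      obtain a b where ab: "y = cmap (w @ u) a" "z = cmap (w @ u) b" "0 \<le> a" "a \<le> 1 / C ^ l" "0 \<le> b" "b \<le> 1 / C ^ l"
        using \<open>y \<in> J i\<close> \<open>z \<in> J i\<close> by (auto simp: J_def i)
      have "dist y z \<le> \<bar>a - b\<bar> / (real (cden (w @ u)))\<^sup>2"
        unfolding ab dist_real_def using ab by (intro cmap_diff_le[OF pos])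
      also have "\<dots> \<le> 1 / C ^ l / (real (cden (w @ u)))\<^sup>2"
        using ab by (intro divide_right_mono) auto
      finally show ?thesis by (simp add: r_def i)
    qed
    have "J i \<noteq> {}" using Cl by (simp add: J_def i)
    then have "diameter (J i) \<le> r i" using dist by (intro diameter_le) (auto simp: dist_norm)
    moreover have "bounded (J i)"
      using dist \<open>J i \<noteq> {}\<close> unfolding bounded_def by blast
    moreover have "0 \<le> r i" using Cl by (simp add: r_def i)
    ultimately show "bounded (J i) \<and> diameter (J i) \<le> r i \<and> 0 \<le> r i" by blast
  next
    fix F assume F: "finite F" "F \<subseteq> I"
    define F' where "F' p = {v. (p, v) \<in> F}" for p
    have F': "finite (F' p)" "F' p \<subseteq> W p" for p
    proof -
      have "F' p \<subseteq> snd ` F" by (force simp: F'_def)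
      then show "finite (F' p)" using F(1) finite_subset by blast
      show "F' p \<subseteq> W p" using F(2) by (auto simp: F'_def I_def)
    qed
    have "F = Sigma (fst ` F) F'" by (force simp: F'_def)
    then have "(\<Sum>i\<in>F. r i powr t) = (\<Sum>i\<in>Sigma (fst ` F) F'. r i powr t)" by simp
    also have "\<dots> = (\<Sum>p\<in>fst ` F. \<Sum>v\<in>F' p. r (p, v) powr t)"
      using F(1) F' by (subst sum.Sigma) auto
    also have "\<dots> \<le> (\<Sum>l. N l * d l)"
    proof (rule sum_le_suminf_fibres[where l = "\<lambda>p. snd (snd p)"])
      fix L
      have "{x \<in> fst ` F. snd (snd x) = L} \<subseteq> (\<lambda>(ps, g). (ps, g, L)) `
          {(ps, g). \<rho> ^ length ps \<le> real L \<and> g \<le> L \<and> set ps \<subseteq> {..L} \<times> {..L}}"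
        using F(2) by (fastforce simp: I_def G_def)
      from surj_card_le[OF card_patterns_le(1)[OF \<rho>(1)] this] card_patterns_le(2)[OF \<rho>(1), of L]
      show "real (card {x \<in> fst ` F. snd (snd x) = L}) \<le> N L" unfolding N_def D_def
        by (meson of_nat_le_iff order_trans)
    next
      show "(\<Sum>v\<in>F' p. r (p, v) powr t) \<le> d (snd (snd p))" if "p \<in> fst ` F" for p
        using that F(2) F' by (intro fibre) (auto simp: I_def)
    qed (use F(1) sumNd in \<open>auto simp: d_def\<close>)
    finally show "(\<Sum>i\<in>F. r i powr t) \<le> (\<Sum>l. N l * d l)" .
  next
    fix x assume x: "x \<in> M_hat C"
    then have irr: "x \<in> unit_irrationals" by (simp add: M_hat_def)
    obtain n L where nL: "\<And>k. 1 \<le> n k" "\<And>k. n k \<le> L k" "\<And>k. C ^ L k \<le> pquot (n k) x" "\<And>k. n k < n (Suc k)"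
        "\<And>k. real (n (Suc k)) \<le> \<rho> * (L k + 1) + 1" "\<And>k. \<rho> * L k \<le> L (Suc k)"
      using record_sequence[OF C \<rho>(1) x] by metis
    \<comment> \<open>\<open>m k\<close> digits precede the k-th free block, which has
      \<open>g k\<close> digits and is followed by the record at position \<open>n k\<close>;
      positions are counted from 1.\<close>
    define m where "m k = (if k = 0 then 0 else n (k - 1))" for k
    have m: "m k < n k" for k using nL(1)[of k] nL(4)[of "k - 1"] by (auto simp: m_def)
    have mS: "m (Suc k) = n k" for k by (simp add: m_def)
    define g where "g k = n k - m k - 1" for k
    have g: "m k + g k + 1 = n k" for k using m[of k] by (simp add: g_def)
    define ps where "ps = rec_nat [] (\<lambda>k p. (g k, L k) # p)"
    have ps0: "ps 0 = []" and psS: "ps (Suc k) = (g k, L k) # ps k" for k by (simp_all add: ps_def)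
    define u where "u k = map (\<lambda>i. pquot (Suc i) x) [m k..<m k + g k]" for k
    have uw: "u k \<in> words (g k)" for k using pquot_ge_1[OF irr] by (auto simp: u_def words_def)
    have split: "pquots (m k) x @ u k = pquots (n k - 1) x" for k
    proof -
      have "n k - 1 = m k + g k" using g[of k] by simp
      then show ?thesis by (simp add: u_def pquots_def upt_add_eq_append[of 0 "m k" "g k"])
    qed
    have prefix: "pquots (m k) x \<in> pattern_words C (ps k)" for k
    proof (induction k)
      case 0
      then show ?case by (simp add: ps0 m_def pquots_def)
    next
      case (Suc k)
      have "pquots (Suc (n k - 1)) x = pquots (n k - 1) x @ [pquot (Suc (n k - 1)) x]"
        by (simp add: pquots_def)
      then have "pquots (n k) x = pquots (n k - 1) x @ [pquot (n k) x]" using nL(1)[of k] by simp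
      then have "pquots (m (Suc k)) x = pquots (m k) x @ u k @ [pquot (n k) x]"
        unfolding mS using split[of k] by simp
      then show ?case unfolding psS using Suc uw nL(3) by auto
    qed
    have plen: "pattern_length (ps k) = m k" for k
    proof (induction k)
      case 0
      show ?case by (simp add: ps0 pattern_length_def m_def)
    next
      case (Suc k)
      then show ?case using g[of k] by (simp add: psS pattern_length_def mS)
    qed
    have pwt: "real (pattern_weight (ps k)) = (\<Sum>j<k. real (L j))" for k
      by (induction k) (auto simp: ps0 psS pattern_weight_def)
    have len: "length (ps k) = k" for k by (induction k) (auto simp: ps0 psS)
    have kn: "k < n k" for k
    proof (induction k)
      case 0
      then show ?case using nL(1)[of 0] by simp
    next
      case (Suc k)
      then show ?case using nL(4)[of k] by simp
    qed
    then have kL: "k < L k" for k using nL(2)[of k] by (meson le_trans not_le)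
    have \<rho>L: "\<rho> ^ k \<le> L k" for k
    proof (induction k)
      case 0
      then show ?case using kL[of 0] by simp
    next
      case (Suc k)
      then have "\<rho> * \<rho> ^ k \<le> \<rho> * L k" using \<rho> by (intro mult_left_mono) auto
      then show ?case using nL(6)[of k] by simp
    qed
    have Lmono: "L j \<le> L k" if "j \<le> k" for j k
    proof (rule lift_Suc_mono_le[OF _ that])
      fix i
      have "1 * real (L i) \<le> \<rho> * L i" using \<rho> by (intro mult_right_mono) auto
      then show "L i \<le> L (Suc i)" using nL(6)[of i] by linarith
    qed
    have gL: "g k \<le> L k" for k using nL(2)[of k] g[of k] by linarith
    have psL: "set (ps k) \<subseteq> {..L k} \<times> {..L k}" for k
    proof (induction k)
      case (Suc k)
      then show ?case using Lmono[of k "Suc k"] gL[of k] unfolding psS by fastforce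
    qed (simp add: ps0)
    define idx where "idx k = ((ps k, g k, L k), (pquots (m k) x, u k))" for k
    define Q where "Q = {k. c * n k \<le> \<alpha> * (\<Sum>j<k. real (L j)) + t * L k}"
    have "infinite Q" unfolding Q_def
      by (rule growth_rate_infinitely_often[OF \<alpha> _ c(1,3) _ \<rho> kL nL(5)])
        (use c(4) t in \<open>auto simp: ratio_def \<alpha>_def add.commute\<close>)
    \<comment> \<open>The pattern in \<open>idx k\<close> has \<open>k\<close> pairs, so it
      determines \<open>k\<close>.\<close>
    moreover have "inj_on idx Q" by (rule inj_onI) (metis idx_def len prod.inject)
    ultimately have "infinite (idx ` Q)" using finite_imageD by blast
    moreover have "idx ` Q \<subseteq> {i \<in> I. x \<in> J i}"
    proof (rule image_subsetI)
      fix k assume k: "k \<in> Q"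
      define s where "s = \<alpha> * (\<Sum>j<k. real (L j)) + t * L k"
      \<comment> \<open>Passing from \<open>c\<close> to \<open>c1\<close> gains the fraction
        \<open>1 - c1 / c\<close> of \<open>s\<close>. As \<open>s\<close> is at least
        \<open>t * L k\<close>, this is at least \<open>\<epsilon> * L k\<close> after
        multiplication by \<open>B\<close>.\<close>
      have "c1 * n k = c1 / c * (c * n k)" using c by simp
      also have "\<dots> \<le> c1 / c * s" using k c c1 by (intro mult_left_mono) (auto simp: Q_def s_def)
      also have "\<dots> = s - (1 - c1 / c) * s" by (simp add: algebra_simps)
      also have "\<dots> \<le> s - (1 - c1 / c) * (t * L k)"
      proof -
        have "t * L k \<le> s" using \<alpha> by (simp add: s_def sum_nonneg)
        moreover have "0 \<le> 1 - c1 / c" using c c1 by simp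
        ultimately have "(1 - c1 / c) * (t * L k) \<le> (1 - c1 / c) * s" by (rule mult_left_mono)
        then show ?thesis by simp
      qed
      finally have "B * (c1 * n k) \<le> B * (s - (1 - c1 / c) * (t * L k))" using B by simp
      moreover have "B * (c1 * n k) = P * n k" using B by (simp add: c1_def)
      moreover have "B * (s - (1 - c1 / c) * (t * L k)) = B * s - \<epsilon> * L k" by (simp add: \<epsilon>_def algebra_simps)
      ultimately have "P * n k \<le> B * s - \<epsilon> * L k" by simp
      then have "P * real (pattern_length (ps k) + g k + 1)
          \<le> B * (\<alpha> * pattern_weight (ps k) + t * L k) - \<epsilon> * L k"
        unfolding plen g pwt s_def .
      then have "(ps k, g k, L k) \<in> G" using \<rho>L len psL gL by (simp add: G_def)
      then have "idx k \<in> I" using prefix uw by (simp add: idx_def I_def W_def)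
      moreover have "x \<in> J (idx k)"
      proof -
        define y where "y = (gauss_map ^^ (n k - 1)) x"
        have "y \<in> unit_irrationals" unfolding y_def by (rule unit_irrationals_funpow[OF irr])
        note y = pquot_1[OF this] gauss_map_irr[OF this]
        have "pquot (n k) x = pquot 1 y" unfolding y_def using nL(1)[of k] pquot_Suc_funpow[of "n k - 1" x] by simp
        then have "C ^ L k \<le> pquot 1 y" using nL(3)[of k] by simp
        also have "\<dots> \<le> pquot 1 y + gauss_map y" using unit_irrationals_pos[OF y(3)] by simp
        finally have "1 / (pquot 1 y + gauss_map y) \<le> 1 / C ^ L k"
          using C by (intro frac_le) auto
        then have "y \<le> 1 / C ^ L k" using y(2) by simp
        moreover have "0 \<le> y" using unit_irrationals_pos[OF unit_irrationals_funpow[OF irr]] by (simp add: y_def less_imp_le)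
        moreover have "x = cmap (pquots (m k) x @ u k) y"
          unfolding split y_def using cmap_pquots[OF irr] by simp
        ultimately show ?thesis unfolding J_def idx_def by auto
      qed
      ultimately show "idx k \<in> {i \<in> I. x \<in> J i}" by blast
    qed
    ultimately show "infinite {i \<in> I. x \<in> J i}" using infinite_super by blast
  qed (use t in simp)
qed

subsection \<open>A Cantor set of continued fractions\<close>

text \<open>Neighbouring cylinders share an endpoint, so different digits alone give no distance.
  Next digits up to \<open>M\<close> keep both remainders away from 0, next digits from 2 on keep
  both at most 1/2; either way \<open>cmap_separation\<close> applies with gap
  \<open>1 / (M + 1)\<close>.\<close>

lemma has_digits_separation:
  assumes d: "\<And>j. d j \<ge> 1" "has_digits d x" and d': "\<And>j. d' j \<ge> 1" "has_digits d' x'"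
    and agree: "\<And>j. j < n \<Longrightarrow> d j = d' j" and diff: "d n \<noteq> d' n" and M: "M \<ge> 1"
    and next_digit: "(d (Suc n) \<le> M \<and> d' (Suc n) \<le> M) \<or> (d (Suc n) \<ge> 2 \<and> d' (Suc n) \<ge> 2)"
  shows "\<bar>real (d n) - real (d' n)\<bar> / (16 * (real M + 1) * (real (cden (map d [0..<n])))\<^sup>2 * d n * d' n)
    \<le> \<bar>x - x'\<bar>"
proof -
  define w where "w = map d [0..<n]"
  have w': "map d' [0..<n] = w" unfolding w_def using agree by auto
  have w: "0 \<notin> set w" unfolding w_def using d(1) by (auto simp: Suc_le_eq) (metis less_irrefl)
  have ex: "\<exists>\<tau>. y = cmap (map e [0..<n] @ [e n]) \<tau> \<and> \<tau> \<in> {0..1}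
      \<and> (e (Suc n) \<le> M \<longrightarrow> \<tau> \<ge> 1 / (real M + 1)) \<and> (e (Suc n) \<ge> 2 \<longrightarrow> \<tau> \<le> 1 - 1 / (real M + 1))"
    if e: "\<And>j. e j \<ge> 1" "has_digits e y" for e :: "nat \<Rightarrow> nat" and y
  proof -
    have "y \<in> cmap (map e [0..<Suc (Suc n)]) ` {0..1}" using e(2) unfolding has_digits_def by blast
    then obtain u where u: "u \<in> {0..1}" "y = cmap (map e [0..<n] @ [e n] @ [e (Suc n)]) u" by auto
    define \<tau> where "\<tau> = 1 / (real (e (Suc n)) + u)"
    have e1: "real (e (Suc n)) \<ge> 1" using e(1)[of "Suc n"] by simp
    have "y = cmap (map e [0..<n] @ [e n]) \<tau>" using u(2) by (simp add: cmap_append \<tau>_def)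
    moreover have "\<tau> \<in> {0..1}" using e1 u(1) by (auto simp: \<tau>_def)
    moreover have "\<tau> \<ge> 1 / (real M + 1)" if "e (Suc n) \<le> M"
      unfolding \<tau>_def using that e1 u(1) by (intro frac_le) auto
    moreover have "\<tau> \<le> 1 - 1 / (real M + 1)" if "e (Suc n) \<ge> 2"
    proof -
      have "\<tau> \<le> 1 / 2" unfolding \<tau>_def using that u(1) by (intro frac_le) auto
      moreover have "1 / (real M + 1) \<le> 1 / 2" using M by (intro frac_le) auto
      ultimately show ?thesis by linarith
    qed
    ultimately show ?thesis by blast
  qed
  obtain \<tau> where \<tau>: "x = cmap (w @ [d n]) \<tau>" "\<tau> \<in> {0..1}"
      "d (Suc n) \<le> M \<longrightarrow> \<tau> \<ge> 1 / (real M + 1)" "d (Suc n) \<ge> 2 \<longrightarrow> \<tau> \<le> 1 - 1 / (real M + 1)"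
    using ex[OF d] unfolding w_def by blast
  obtain \<tau>' where \<tau>': "x' = cmap (w @ [d' n]) \<tau>'" "\<tau>' \<in> {0..1}"
      "d' (Suc n) \<le> M \<longrightarrow> \<tau>' \<ge> 1 / (real M + 1)" "d' (Suc n) \<ge> 2 \<longrightarrow> \<tau>' \<le> 1 - 1 / (real M + 1)"
    using ex[OF d'] unfolding w' by blast
  have "1 / (real M + 1) * \<bar>real (d n) - real (d' n)\<bar> / (16 * (real (cden w))\<^sup>2 * d n * d' n) \<le> \<bar>x - x'\<bar>"
    unfolding \<tau>(1) \<tau>'(1)
    by (rule cmap_separation) (use w d(1) d'(1) diff \<tau> \<tau>' M next_digit in auto)
  then show ?thesis unfolding w_def by (simp add: mult_ac del: distrib_left_numeral distrib_right_numeral)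
qed

lemma cden_le_power:
  assumes "0 \<notin> set w" "set w \<subseteq> {..M}"
  shows "cden w \<le> (M + 1) ^ length w"
  using assms
proof (induction w)
  case (Cons a w)
  have "cden (a # w) \<le> a * cden w + cden w" using cnum_le_cden[of w] Cons by simp
  also have "\<dots> = (a + 1) * cden w" by simp
  also have "\<dots> \<le> (M + 1) * (M + 1) ^ length w" using Cons by (intro mult_mono) auto
  finally show ?case by simp
qed simp

(* Blocks of m digits.  If N i = 0 then the i-th block ranges over W, with probabilities
   proportional to the weights; otherwise it is b, 1, ..., 1 with b uniform in {N i..<2 * N i}. *)
locale block_cantor =
  fixes m M :: nat and W :: "nat list set" and N :: "nat \<Rightarrow> nat" and t :: real
  assumes m: "m \<ge> 2" and M: "M \<ge> 1"
    and W: "finite W" "W \<noteq> {}" "W \<subseteq> words m" "\<And>w. w \<in> W \<Longrightarrow> set w \<subseteq> {..M}"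
    and N: "\<And>i. N i = 0 \<or> N i \<ge> 2"
    and t: "1/2 < t" "t \<le> 1"
begin

definition Z :: real where "Z = sum (weight t) W"

text \<open>The 1 after \<open>b\<close> is the bounded next digit that
  \<open>has_digits_separation\<close> asks for. The remaining padding gives all blocks the same
  length, so block \<open>i\<close> always starts at digit \<open>m * i\<close>.\<close>

definition alphabet :: "nat \<Rightarrow> nat list set" where
  "alphabet i = (if N i = 0 then W else (\<lambda>b. b # replicate (m - 1) 1) ` {N i..<2 * N i})"

definition prob_of :: "nat \<Rightarrow> nat list \<Rightarrow> real" where
  "prob_of i w = (if N i = 0 then weight t w / Z else 1 / N i)"

definition \<Omega> :: "(nat \<Rightarrow> nat list) set" where
  "\<Omega> = {\<omega>. \<forall>i. \<omega> i \<in> alphabet i}"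

definition pre :: "(nat \<Rightarrow> nat list) \<Rightarrow> nat \<Rightarrow> nat list" where
  "pre \<omega> i = concat (map \<omega> [0..<i])"

definition dig :: "(nat \<Rightarrow> nat list) \<Rightarrow> nat \<Rightarrow> nat" where
  "dig \<omega> n = \<omega> (n div m) ! (n mod m)"

definition point :: "(nat \<Rightarrow> nat list) \<Rightarrow> real" where
  "point \<omega> = (SOME x. has_digits (dig \<omega>) x)"

lemma alphabet_words: "w \<in> alphabet i \<Longrightarrow> w \<in> words m"
  using W(3) N[of i] m by (auto simp: alphabet_def words_def split: if_splits)

lemma alphabet_finite: "finite (alphabet i)"
  using W(1) by (simp add: alphabet_def)

lemma Z_pos: "Z > 0"
  unfolding Z_def
proof (rule sum_pos[OF W(1,2)])
  fix w assume "w \<in> W"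
  then have "0 \<notin> set w" using W(3) words_pos by blast
  then show "0 < weight t w" using cden_pos[of w] by (simp add: weight_def)
qed

lemma prob_of_nonneg: "prob_of i w \<ge> 0"
  using Z_pos by (simp add: prob_of_def weight_nonneg)

lemma sum_prob_of: "sum (prob_of i) (alphabet i) = 1"
proof (cases "N i = 0")
  case True
  then show ?thesis using Z_pos
    by (simp add: alphabet_def prob_of_def[abs_def] sum_divide_distrib[symmetric] Z_def[symmetric])
next
  case False
  then show ?thesis by (simp add: alphabet_def prob_of_def card_image inj_on_def)
qed

lemma \<Omega>_alphabet: "\<omega> \<in> \<Omega> \<Longrightarrow> \<omega> i \<in> alphabet i"
  by (simp add: \<Omega>_def)

lemma \<Omega>_words: "\<omega> \<in> \<Omega> \<Longrightarrow> \<omega> i \<in> words m"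
  by (rule alphabet_words[OF \<Omega>_alphabet])

lemma \<Omega>_length: "\<omega> \<in> \<Omega> \<Longrightarrow> length (\<omega> i) = m"
  by (rule words_length[OF \<Omega>_words])

lemma dig_block: "j < m \<Longrightarrow> dig \<omega> (m * i + j) = \<omega> i ! j"
  by (simp add: dig_def)

lemma dig_ge_1:
  assumes "\<omega> \<in> \<Omega>"
  shows "dig \<omega> n \<ge> 1"
proof -
  have "n mod m < length (\<omega> (n div m))" using m \<Omega>_length[OF assms] by simp
  then have "dig \<omega> n \<in> set (\<omega> (n div m))" unfolding dig_def by (rule nth_mem)
  then show ?thesis using \<Omega>_words[OF assms, of "n div m"] by (auto simp: words_def)
qed

lemma map_dig:
  assumes \<omega>: "\<omega> \<in> \<Omega>"
  shows "j \<le> m \<Longrightarrow> map (dig \<omega>) [0..<m * i + j] = pre \<omega> i @ take j (\<omega> i)"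
proof (induction i arbitrary: j)
  case 0
  then show ?case using \<Omega>_length[OF \<omega>, of 0] dig_block[of _ \<omega> 0]
    by (auto simp: pre_def intro!: nth_equalityI)
next
  case (Suc i)
  have "[0..<m * Suc i + j] = [0..<m * i + m] @ [m * Suc i..<m * Suc i + j]"
    using upt_add_eq_append[of 0 "m * Suc i" j] by (simp add: add.commute)
  moreover have "map (dig \<omega>) [m * Suc i..<m * Suc i + j] = take j (\<omega> (Suc i))"
    using \<Omega>_length[OF \<omega>, of "Suc i"] Suc.prems dig_block[of _ \<omega> "Suc i"]
    by (auto intro!: nth_equalityI simp del: mult_Suc_right)
  ultimately have "map (dig \<omega>) [0..<m * Suc i + j] = pre \<omega> i @ take m (\<omega> i) @ take j (\<omega> (Suc i))"
    using Suc.IH[of m] by simp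
  then show ?case using \<Omega>_length[OF \<omega>, of i] by (simp add: pre_def)
qed

lemma pre_pos:
  assumes "\<omega> \<in> \<Omega>"
  shows "0 \<notin> set (pre \<omega> i)"
  using words_pos[OF \<Omega>_words[OF assms]] by (auto simp: pre_def)

lemma pre_Suc: "pre \<omega> (Suc i) = pre \<omega> i @ \<omega> i"
  by (simp add: pre_def)

lemma point: "\<omega> \<in> \<Omega> \<Longrightarrow> has_digits (dig \<omega>) (point \<omega>)"
  unfolding point_def using has_digits_exists[of "dig \<omega>"] dig_ge_1 by (metis someI_ex)

lemma first_digit:
  assumes \<omega>: "\<omega> \<in> \<Omega>"
  shows "N i = 0 \<Longrightarrow> j < m \<Longrightarrow> \<omega> i ! j \<le> M"
    "N i \<noteq> 0 \<Longrightarrow> \<omega> i = hd (\<omega> i) # replicate (m - 1) 1 \<and> N i \<le> hd (\<omega> i) \<and> hd (\<omega> i) < 2 * N i"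
proof -
  have a: "\<omega> i \<in> alphabet i" using \<omega> by (simp add: \<Omega>_def)
  show "\<omega> i ! j \<le> M" if "N i = 0" "j < m"
  proof -
    have "\<omega> i \<in> W" using a that by (simp add: alphabet_def)
    moreover have "\<omega> i ! j \<in> set (\<omega> i)" using that \<Omega>_length[OF \<omega>] by simp
    ultimately show ?thesis using W(4) by blast
  qed
  show "\<omega> i = hd (\<omega> i) # replicate (m - 1) 1 \<and> N i \<le> hd (\<omega> i) \<and> hd (\<omega> i) < 2 * N i" if "N i \<noteq> 0"
    using a that by (auto simp: alphabet_def)
qed

text \<open>The first differing digit comes fewer than \<open>m\<close> bounded digits after the
  prefix, so the denominator has grown by a bounded factor only. In the constant, one power of
  \<open>M + 1\<close> is the gap, \<open>2 * m\<close> come from these digits and two from the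
  differing ones; 64 is 16 times the square of the gluing factor 2.\<close>

lemma separation_regular:
  assumes \<omega>: "\<omega> \<in> \<Omega>" "\<omega>' \<in> \<Omega>" and agree: "\<And>j. j < i \<Longrightarrow> \<omega> j = \<omega>' j"
    and diff: "\<omega> i \<noteq> \<omega>' i" and Ni: "N i = 0"
  shows "1 / (64 * (real M + 1) ^ (3 + 2 * m)) / (real (cden (pre \<omega> i)))\<^sup>2 \<le> \<bar>point \<omega> - point \<omega>'\<bar>"
proof -
  define j where "j = (LEAST j. j < m \<and> \<omega> i ! j \<noteq> \<omega>' i ! j)"
  have "\<exists>j. j < m \<and> \<omega> i ! j \<noteq> \<omega>' i ! j"
    using diff \<Omega>_length[OF \<omega>(1)] \<Omega>_length[OF \<omega>(2)] by (metis nth_equalityI)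
  from LeastI_ex[OF this] have j: "j < m" "\<omega> i ! j \<noteq> \<omega>' i ! j" by (simp_all add: j_def)
  have below: "\<omega> i ! l = \<omega>' i ! l" if "l < j" for l
    using that j not_less_Least[of l "\<lambda>j. j < m \<and> \<omega> i ! j \<noteq> \<omega>' i ! j"] unfolding j_def[symmetric] by auto
  have tk: "take j (\<omega> i) = take j (\<omega>' i)"
    using below j \<Omega>_length[OF \<omega>(1)] \<Omega>_length[OF \<omega>(2)] by (intro nth_equalityI) auto
  define n where "n = m * i + j"
  define w where "w = map (dig \<omega>) [0..<n]"
  have pre: "pre \<omega> i = pre \<omega>' i" unfolding pre_def using agree by (intro arg_cong[of _ _ concat]) auto
  have ww: "w = map (dig \<omega>') [0..<n]"
    unfolding w_def n_def using j map_dig[OF \<omega>(1), of j i] map_dig[OF \<omega>(2), of j i] pre tk by simp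
  have agr: "dig \<omega> l = dig \<omega>' l" if "l < n" for l
    using arg_cong[OF ww, of "\<lambda>v. v ! l"] that by (simp add: w_def)
  have dn: "dig \<omega> n = \<omega> i ! j" "dig \<omega>' n = \<omega>' i ! j" using j by (simp_all add: n_def dig_block)
  have dM: "dig \<omega> n \<le> M" "dig \<omega>' n \<le> M" unfolding dn using first_digit(1) \<omega> Ni j by auto
  have "(dig \<omega> (Suc n) \<le> M \<and> dig \<omega>' (Suc n) \<le> M) \<or> (dig \<omega> (Suc n) \<ge> 2 \<and> dig \<omega>' (Suc n) \<ge> 2)"
  proof (cases "Suc j < m")
    case True
    then have "dig \<omega> (Suc n) = \<omega> i ! Suc j" "dig \<omega>' (Suc n) = \<omega>' i ! Suc j"
      unfolding n_def using dig_block[of "Suc j" _ i] by simp_all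
    then show ?thesis using first_digit(1) \<omega> Ni True by auto
  next
    case False
    then have "Suc n = m * Suc i + 0" using j by (simp add: n_def)
    then have s: "dig \<omega> (Suc n) = \<omega> (Suc i) ! 0" "dig \<omega>' (Suc n) = \<omega>' (Suc i) ! 0"
      using dig_block[of 0 _ "Suc i"] m by simp_all
    show ?thesis
    proof (cases "N (Suc i) = 0")
      case True
      then show ?thesis unfolding s using first_digit(1) \<omega> m by auto
    next
      case False
      \<comment> \<open>The next digits are record digits, possibly huge, so only the alternative
        with the lower bound 2 is available.\<close>
      then have "N (Suc i) \<ge> 2" using N[of "Suc i"] by simp
      moreover have "N (Suc i) \<le> \<omega> (Suc i) ! 0" "N (Suc i) \<le> \<omega>' (Suc i) ! 0"
        using first_digit(2)[OF \<omega>(1) False] first_digit(2)[OF \<omega>(2) False] by (metis nth_Cons_0)+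
      ultimately show ?thesis unfolding s by simp
    qed
  qed
  then have sep: "\<bar>real (dig \<omega> n) - real (dig \<omega>' n)\<bar> / (16 * (real M + 1) * (real (cden w))\<^sup>2 * dig \<omega> n * dig \<omega>' n)
      \<le> \<bar>point \<omega> - point \<omega>'\<bar>"
    unfolding w_def using \<omega> point dig_ge_1 agr j(2) M dn by (intro has_digits_separation) auto
  have q: "real (cden w) \<le> 2 * real (cden (pre \<omega> i)) * (real M + 1) ^ m"
  proof -
    have "\<omega> i \<in> W" using \<Omega>_alphabet[OF \<omega>(1), of i] Ni by (simp add: alphabet_def)
    from W(4)[OF this] words_pos[OF \<Omega>_words[OF \<omega>(1), of i]] set_take_subset[of j "\<omega> i"]
    have tkp: "0 \<notin> set (take j (\<omega> i))" "set (take j (\<omega> i)) \<subseteq> {..M}" by blast+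
    have "cden w \<le> 2 * cden (pre \<omega> i) * cden (take j (\<omega> i))"
      unfolding w_def n_def using map_dig[OF \<omega>(1), of j i] j cden_append_le[OF pre_pos[OF \<omega>(1)] tkp(1)] by simp
    also have "\<dots> \<le> 2 * cden (pre \<omega> i) * (M + 1) ^ length (take j (\<omega> i))"
      using cden_le_power[OF tkp] by (rule mult_left_mono) simp
    also have "\<dots> \<le> 2 * cden (pre \<omega> i) * (M + 1) ^ m"
      using j \<Omega>_length[OF \<omega>(1)] by (intro mult_left_mono power_increasing) auto
    finally have "real (cden w) \<le> real (2 * cden (pre \<omega> i) * (M + 1) ^ m)" by (simp only: of_nat_le_iff)
    then show ?thesis by (simp add: add.commute)
  qed
  have "0 \<notin> set w" using dig_ge_1[OF \<omega>(1)] by (auto simp: w_def Suc_le_eq) (metis less_irrefl)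
  then have qw: "real (cden w) > 0" using cden_pos by simp
  have d1: "real (dig \<omega> n) \<ge> 1" "real (dig \<omega>' n) \<ge> 1" using dig_ge_1 \<omega> by (metis of_nat_1 of_nat_le_iff)+
  have "1 / (64 * (real M + 1) ^ (3 + 2 * m)) / (real (cden (pre \<omega> i)))\<^sup>2
      = 1 / (16 * (real M + 1) * (2 * real (cden (pre \<omega> i)) * (real M + 1) ^ m)\<^sup>2 * (real M + 1) * (real M + 1))"
    by (simp add: power_mult_distrib power_add power_mult power2_eq_square power3_eq_cube mult_ac
        del: distrib_left_numeral distrib_right_numeral)
  also have "\<dots> \<le> \<bar>real (dig \<omega> n) - real (dig \<omega>' n)\<bar> / (16 * (real M + 1) * (real (cden w))\<^sup>2 * dig \<omega> n * dig \<omega>' n)"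
  proof (rule frac_le)
    show "1 \<le> \<bar>real (dig \<omega> n) - real (dig \<omega>' n)\<bar>" using j(2) dn by linarith
    show "16 * (real M + 1) * (real (cden w))\<^sup>2 * dig \<omega> n * dig \<omega>' n
      \<le> 16 * (real M + 1) * (2 * real (cden (pre \<omega> i)) * (real M + 1) ^ m)\<^sup>2 * (real M + 1) * (real M + 1)"
      using q qw dM d1 by (intro mult_mono power_mono) auto
    show "0 < 16 * (real M + 1) * (real (cden w))\<^sup>2 * dig \<omega> n * dig \<omega>' n"
      using qw d1 by (intro mult_pos_pos) auto
  qed simp
  also note sep
  finally show ?thesis .
qed

text \<open>Both first digits are below \<open>2 * N i\<close> and are followed by a 1. The
  difference is kept as a factor because a small set can still meet many values of this digit, and
  these have to be counted.\<close>

lemma separation_special: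
  assumes \<omega>: "\<omega> \<in> \<Omega>" "\<omega>' \<in> \<Omega>" and agree: "\<And>j. j < i \<Longrightarrow> \<omega> j = \<omega>' j"
    and Ni: "N i \<noteq> 0"
  shows "\<bar>real (hd (\<omega> i)) - real (hd (\<omega>' i))\<bar> / (64 * (real M + 1)) / ((real (cden (pre \<omega> i)))\<^sup>2 * (real (N i))\<^sup>2)
    \<le> \<bar>point \<omega> - point \<omega>'\<bar>"
proof (cases "hd (\<omega> i) = hd (\<omega>' i)")
  case False
  define n where "n = m * i"
  have pre: "pre \<omega> i = pre \<omega>' i" unfolding pre_def using agree by (intro arg_cong[of _ _ concat]) auto
  have wp: "map (dig \<omega>) [0..<n] = pre \<omega> i" "map (dig \<omega>') [0..<n] = pre \<omega> i"
    using map_dig[OF \<omega>(1), of 0 i] map_dig[OF \<omega>(2), of 0 i] pre by (simp_all add: n_def)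
  have agr: "dig \<omega> l = dig \<omega>' l" if "l < n" for l
    using arg_cong[OF trans[OF wp(1) wp(2)[symmetric]], of "\<lambda>v. v ! l"] that by simp
  note f = first_digit(2)[OF \<omega>(1) Ni] first_digit(2)[OF \<omega>(2) Ni]
  have nth: "\<omega>'' i ! 0 = hd (\<omega>'' i)" "\<omega>'' i ! 1 = 1" if \<omega>'': "\<omega>'' \<in> \<Omega>" for \<omega>''
  proof -
    obtain b where "\<omega>'' i = b # replicate (m - 1) 1" using first_digit(2)[OF \<omega>'' Ni] by blast
    then show "\<omega>'' i ! 0 = hd (\<omega>'' i)" "\<omega>'' i ! 1 = 1" using m by simp_all
  qed
  have d0: "dig \<omega> n = hd (\<omega> i)" "dig \<omega>' n = hd (\<omega>' i)"
    using dig_block[of 0 _ i] m nth(1) \<omega> unfolding n_def by simp_all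
  have "\<omega> i ! 1 = 1" "\<omega>' i ! 1 = 1" using nth(2) \<omega> by blast+
  then have d1: "dig \<omega> (Suc n) = 1" "dig \<omega>' (Suc n) = 1"
    using dig_block[of 1 _ i] m unfolding n_def by simp_all
  have "\<bar>real (dig \<omega> n) - real (dig \<omega>' n)\<bar> / (16 * (real M + 1) * (real (cden (map (dig \<omega>) [0..<n])))\<^sup>2 * dig \<omega> n * dig \<omega>' n)
      \<le> \<bar>point \<omega> - point \<omega>'\<bar>"
    using \<omega> point dig_ge_1 agr False M d0 d1 by (intro has_digits_separation) auto
  then have sep: "\<bar>real (hd (\<omega> i)) - real (hd (\<omega>' i))\<bar> / (16 * (real M + 1) * (real (cden (pre \<omega> i)))\<^sup>2 * hd (\<omega> i) * hd (\<omega>' i))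
      \<le> \<bar>point \<omega> - point \<omega>'\<bar>" unfolding wp d0 .
  have q: "real (cden (pre \<omega> i)) > 0" using cden_pos[OF pre_pos[OF \<omega>(1)]] by simp
  have b: "real (hd (\<omega> i)) \<le> 2 * real (N i)" "real (hd (\<omega>' i)) \<le> 2 * real (N i)" "real (hd (\<omega> i)) > 0" "real (hd (\<omega>' i)) > 0"
    using f Ni by linarith+
  have "\<bar>real (hd (\<omega> i)) - real (hd (\<omega>' i))\<bar> / (64 * (real M + 1)) / ((real (cden (pre \<omega> i)))\<^sup>2 * (real (N i))\<^sup>2)
    = \<bar>real (hd (\<omega> i)) - real (hd (\<omega>' i))\<bar> / (16 * (real M + 1) * (real (cden (pre \<omega> i)))\<^sup>2 * (2 * real (N i)) * (2 * real (N i)))"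
    by (simp add: power2_eq_square mult_ac del: distrib_left_numeral distrib_right_numeral)
  also have "\<dots> \<le> \<bar>real (hd (\<omega> i)) - real (hd (\<omega>' i))\<bar> / (16 * (real M + 1) * (real (cden (pre \<omega> i)))\<^sup>2 * hd (\<omega> i) * hd (\<omega>' i))"
    using q b by (intro divide_left_mono mult_mono mult_pos_pos) auto
  also note sep
  finally show ?thesis .
qed simp

section \<open>The product measure and the mass of cylinders\<close>

definition block_measure :: "nat \<Rightarrow> nat list measure" where
  "block_measure i = point_measure (alphabet i) (\<lambda>w. ennreal (prob_of i w))"

definition cantor_measure :: "(nat \<Rightarrow> nat list) measure" where
  "cantor_measure = PiM UNIV block_measure"

definition mass :: "(nat \<Rightarrow> nat list) \<Rightarrow> nat \<Rightarrow> real" where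
  "mass \<omega> i = (\<Prod>j<i. prob_of j (\<omega> j))"

lemma mass_nonneg: "mass \<omega> i \<ge> 0"
  unfolding mass_def by (intro prod_nonneg) (simp add: prob_of_nonneg)

lemma emeasure_block_measure:
  "S \<subseteq> alphabet i \<Longrightarrow> emeasure (block_measure i) S = ennreal (sum (prob_of i) S)"
  unfolding block_measure_def
  by (subst emeasure_point_measure_finite) (auto simp: alphabet_finite prob_of_nonneg sum_ennreal)

lemma space_block_measure: "space (block_measure i) = alphabet i"
  by (simp add: block_measure_def space_point_measure)

lemma sets_block_measure: "sets (block_measure i) = Pow (alphabet i)"
  by (simp add: block_measure_def sets_point_measure)

lemma product_prob_space_block_measure: "product_prob_space block_measure"
proof -
  have "prob_space (block_measure i)" for i
    by (rule prob_spaceI) (simp add: space_block_measure emeasure_block_measure sum_prob_of)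
  then show ?thesis
    by (simp add: product_prob_space_def product_prob_space_axioms_def product_sigma_finite_def prob_space_imp_sigma_finite)
qed

lemma prob_space_cantor_measure: "prob_space cantor_measure"
proof -
  interpret product_prob_space block_measure UNIV by (rule product_prob_space_block_measure)
  show ?thesis unfolding cantor_measure_def by unfold_locales
qed

lemma space_cantor_measure: "space cantor_measure = \<Omega>"
  by (auto simp: cantor_measure_def space_PiM space_block_measure \<Omega>_def PiE_def Pi_def)

text \<open>Letting block \<open>i\<close> range over \<open>S\<close> yields the partial unions of
  cylinders that arise when a set meets only some values of a record digit.\<close>

lemma emeasure_cylinder:
  assumes \<omega>0: "\<omega>0 \<in> \<Omega>" and S: "S \<subseteq> alphabet i"
  shows "{\<omega> \<in> \<Omega>. (\<forall>j<i. \<omega> j = \<omega>0 j) \<and> \<omega> i \<in> S} \<in> sets cantor_measure"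
    "emeasure cantor_measure {\<omega> \<in> \<Omega>. (\<forall>j<i. \<omega> j = \<omega>0 j) \<and> \<omega> i \<in> S} = ennreal (mass \<omega>0 i * sum (prob_of i) S)"
proof -
  interpret product_prob_space block_measure UNIV by (rule product_prob_space_block_measure)
  define F where "F j = (if j < i then {\<omega>0 j} else S)" for j
  have F: "F j \<in> sets (block_measure j)" if "j \<in> {..i}" for j
    using that \<omega>0 S by (auto simp: F_def sets_block_measure \<Omega>_def)
  have eq: "{\<omega> \<in> \<Omega>. (\<forall>j<i. \<omega> j = \<omega>0 j) \<and> \<omega> i \<in> S} = prod_emb UNIV block_measure {..i} (PiE {..i} F)"
    unfolding prod_emb_def space_block_measure F_def \<Omega>_def
    by (auto simp: PiE_iff restrict_def extensional_def le_less split: if_splits)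
  show "{\<omega> \<in> \<Omega>. (\<forall>j<i. \<omega> j = \<omega>0 j) \<and> \<omega> i \<in> S} \<in> sets cantor_measure"
    unfolding eq cantor_measure_def by (rule sets_PiM_I) (use F in auto)
  have "emeasure cantor_measure (prod_emb UNIV block_measure {..i} (PiE {..i} F))
      = (\<Prod>j\<in>{..i}. emeasure (block_measure j) (F j))"
    unfolding cantor_measure_def by (rule emeasure_PiM_emb) (use F in auto)
  also have "\<dots> = (\<Prod>j<i. emeasure (block_measure j) (F j)) * emeasure (block_measure i) (F i)"
    by (simp add: lessThan_Suc_atMost[symmetric])
  also have "(\<Prod>j<i. emeasure (block_measure j) (F j)) = (\<Prod>j<i. ennreal (prob_of j (\<omega>0 j)))"
    using \<omega>0 by (intro prod.cong) (auto simp: F_def emeasure_block_measure \<Omega>_def)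
  also have "\<dots> = ennreal (mass \<omega>0 i)"
    unfolding mass_def by (rule prod_ennreal) (simp add: prob_of_nonneg)
  also have "emeasure (block_measure i) (F i) = ennreal (sum (prob_of i) S)"
    using S by (simp add: F_def emeasure_block_measure)
  finally show "emeasure cantor_measure {\<omega> \<in> \<Omega>. (\<forall>j<i. \<omega> j = \<omega>0 j) \<and> \<omega> i \<in> S}
      = ennreal (mass \<omega>0 i * sum (prob_of i) S)"
    unfolding eq by (simp add: ennreal_mult mass_nonneg sum_nonneg prob_of_nonneg)
qed

lemma cylinder:
  assumes "\<omega>0 \<in> \<Omega>"
  shows "{\<omega> \<in> \<Omega>. \<forall>j<i. \<omega> j = \<omega>0 j} \<in> sets cantor_measure"
    "emeasure cantor_measure {\<omega> \<in> \<Omega>. \<forall>j<i. \<omega> j = \<omega>0 j} = ennreal (mass \<omega>0 i)"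
proof -
  have "{\<omega> \<in> \<Omega>. \<forall>j<i. \<omega> j = \<omega>0 j} = {\<omega> \<in> \<Omega>. (\<forall>j<i. \<omega> j = \<omega>0 j) \<and> \<omega> i \<in> alphabet i}"
    by (auto simp: \<Omega>_def)
  note eq = this
  show "{\<omega> \<in> \<Omega>. \<forall>j<i. \<omega> j = \<omega>0 j} \<in> sets cantor_measure"
    unfolding eq by (rule emeasure_cylinder(1)[OF assms order_refl])
  show "emeasure cantor_measure {\<omega> \<in> \<Omega>. \<forall>j<i. \<omega> j = \<omega>0 j} = ennreal (mass \<omega>0 i)"
    unfolding eq emeasure_cylinder(2)[OF assms order_refl] sum_prob_of by simp
qed

text \<open>The loss of one block when mass is compared with weight. Gluing costs
  \<open>4 powr t\<close>. In a regular block the probability is the weight divided by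
  \<open>Z\<close>; in a special one \<open>1 / N j\<close> is set against the lower bound
  \<open>(N j * 2 ^ m) powr (-2 * t)\<close> of the weight.\<close>

definition distortion :: "nat \<Rightarrow> real" where
  "distortion j = (if N j = 0 then 4 powr t / Z else 4 powr (t * (m + 1)) * real (N j) powr (2 * t - 1))"

lemma mass_le_weight:
  assumes \<omega>: "\<omega> \<in> \<Omega>"
  shows "mass \<omega> i \<le> (\<Prod>j<i. distortion j) * weight t (pre \<omega> i)"
proof (induction i)
  case 0
  then show ?case by (simp add: mass_def pre_def weight_def)
next
  case (Suc i)
  have dist: "distortion j \<ge> 0" for j using Z_pos by (simp add: distortion_def)
  have wi: "0 \<notin> set (\<omega> i)" by (rule words_pos[OF \<Omega>_words[OF \<omega>]])
  have "weight t (pre \<omega> i) * weight t (\<omega> i) \<le> 4 powr t * weight t (pre \<omega> (Suc i))"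
    unfolding pre_Suc using t wi pre_pos[OF \<omega>] by (intro weight_append_ge) auto
  note app = this
  have step: "weight t (pre \<omega> i) * prob_of i (\<omega> i) \<le> distortion i * weight t (pre \<omega> (Suc i))"
  proof (cases "N i = 0")
    case True
    have "weight t (pre \<omega> i) * weight t (\<omega> i) / Z \<le> 4 powr t * weight t (pre \<omega> (Suc i)) / Z"
      using app Z_pos by (intro divide_right_mono) auto
    then show ?thesis using True by (simp add: prob_of_def distortion_def)
  next
    case False
    note f = first_digit(2)[OF \<omega> False]
    have Np: "real (N i) > 0" using False by simp
    \<comment> \<open>The first digit is below \<open>2 * N i\<close>, and the \<open>m - 1\<close>
      ones contribute at most \<open>2 ^ (m - 1)\<close>.\<close>
    have "cden (\<omega> i) \<le> hd (\<omega> i) * cden (replicate (m - 1) 1) + cden (replicate (m - 1) 1)"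
      using f cnum_le_cden[of "replicate (m - 1) 1"] by (metis (no_types, lifting) cden.simps(2) add_left_mono in_set_replicate zero_neq_one)
    also have "\<dots> = (hd (\<omega> i) + 1) * cden (replicate (m - 1) 1)" by simp
    also have "\<dots> \<le> (2 * N i) * (1 + 1) ^ length (replicate (m - 1) (1::nat))"
      using f by (intro mult_mono cden_le_power) auto
    also have "\<dots> = N i * 2 ^ m" using m by (cases m) (auto simp: numeral_2_eq_2 distrib_left distrib_right)
    finally have "real (cden (\<omega> i)) \<le> real (N i * 2 ^ m)" by (simp only: of_nat_le_iff)
    then have c: "real (cden (\<omega> i)) \<le> real (N i) * 2 ^ m" by simp
    have "real (cden (\<omega> i)) > 0" using cden_pos[OF wi] by simp
    then have "(real (N i) * 2 ^ m) powr (-2 * t) \<le> weight t (\<omega> i)"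
      unfolding weight_def using c t by (intro powr_mono2') auto
    moreover have "(real (N i) * 2 ^ m) powr (-2 * t) = real (N i) powr (-2 * t) * 4 powr (- (t * m))"
    proof -
      have "(4 :: real) powr (- (t * m)) = (2 powr 2) powr (- (t * m))" by simp
      also have "\<dots> = 2 powr (m * (-2 * t))" unfolding powr_powr by (simp add: mult_ac)
      also have "\<dots> = (2 powr m) powr (-2 * t)" unfolding powr_powr ..
      finally show ?thesis using Np by (simp add: powr_mult powr_realpow)
    qed
    ultimately have le: "real (N i) powr (2 * t - 1) * 4 powr (t * m) * (real (N i) powr (-2 * t) * 4 powr (- (t * m)))
      \<le> real (N i) powr (2 * t - 1) * 4 powr (t * m) * weight t (\<omega> i)" by (intro mult_left_mono) auto
    have reorder: "a * b * (c * d) = (a * c) * (b * d)" for a b c d :: real by (simp add: mult_ac)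
    have eq: "real (N i) powr (2 * t - 1) * 4 powr (t * m) * (real (N i) powr (-2 * t) * 4 powr (- (t * m))) = 1 / N i"
    proof -
      have "real (N i) powr (2 * t - 1) * real (N i) powr (-2 * t) = 1 / N i"
        unfolding powr_add[symmetric] using Np by (simp add: powr_minus_divide)
      moreover have "(4::real) powr (t * m) * 4 powr (- (t * m)) = 1" unfolding powr_add[symmetric] by simp
      ultimately show ?thesis by (subst reorder) simp
    qed
    have "prob_of i (\<omega> i) \<le> real (N i) powr (2 * t - 1) * 4 powr (t * m) * weight t (\<omega> i)"
      using le unfolding eq using False by (simp add: prob_of_def)
    then have "weight t (pre \<omega> i) * prob_of i (\<omega> i)
      \<le> weight t (pre \<omega> i) * (real (N i) powr (2 * t - 1) * 4 powr (t * m) * weight t (\<omega> i))"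
      by (rule mult_left_mono) (rule weight_nonneg)
    also have "\<dots> = real (N i) powr (2 * t - 1) * 4 powr (t * m) * (weight t (pre \<omega> i) * weight t (\<omega> i))"
      by (simp add: mult_ac)
    also have "\<dots> \<le> real (N i) powr (2 * t - 1) * 4 powr (t * m) * (4 powr t * weight t (pre \<omega> (Suc i)))"
      using app by (intro mult_left_mono) auto
    also have "\<dots> = distortion i * weight t (pre \<omega> (Suc i))"
      using False by (simp add: distortion_def distrib_left powr_add mult_ac)
    finally show ?thesis .
  qed
  have "mass \<omega> (Suc i) = mass \<omega> i * prob_of i (\<omega> i)" by (simp add: mass_def)
  also have "\<dots> \<le> (\<Prod>j<i. distortion j) * weight t (pre \<omega> i) * prob_of i (\<omega> i)"
    using Suc by (intro mult_right_mono prob_of_nonneg)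
  also have "\<dots> = (\<Prod>j<i. distortion j) * (weight t (pre \<omega> i) * prob_of i (\<omega> i))" by simp
  also have "\<dots> \<le> (\<Prod>j<i. distortion j) * (distortion i * weight t (pre \<omega> (Suc i)))"
    using step dist by (intro mult_left_mono prod_nonneg) auto
  finally show ?case by simp
qed

text \<open>A block has at least two digits, so its own denominator is at least 2.\<close>

lemma cden_pre_ge:
  assumes \<omega>: "\<omega> \<in> \<Omega>"
  shows "2 ^ i \<le> cden (pre \<omega> i)"
proof (induction i)
  case 0
  then show ?case by (simp add: pre_def)
next
  case (Suc i)
  have w: "\<omega> i \<in> words m" by (rule \<Omega>_words[OF \<omega>])
  then obtain a b w where abw: "\<omega> i = a # b # w" using m unfolding words_def
    by (cases "\<omega> i"; cases "tl (\<omega> i)") auto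
  with w have pos: "a \<ge> 1" "b \<ge> 1" "0 \<notin> set w" by (auto simp: words_def)
  have "cden w \<ge> 1" using cden_pos[OF pos(3)] by simp
  moreover have "1 * (1 * cden w) \<le> a * (b * cden w)" using pos by (intro mult_mono) auto
  moreover have "cden (\<omega> i) = a * (b * cden w) + a * cnum w + cden w" by (simp add: abw distrib_left)
  ultimately have "2 \<le> cden (\<omega> i)" by linarith
  then have "2 ^ i * 2 \<le> cden (pre \<omega> i) * cden (\<omega> i)" using Suc by (intro mult_mono) auto
  also have "\<dots> \<le> cden (pre \<omega> (Suc i))" unfolding pre_Suc by (rule cden_append_ge)
  finally show ?case by simp
qed

end

section \<open>Mass of sets of small diameter\<close>

context block_cantor
begin

text \<open>A set that meets the Cantor set in one point can have diameter 0 and must then have no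
  mass. The cylinders around a point have exponentially small mass once the distortions are
  bounded.\<close>

lemma singleton_null:
  assumes \<omega>: "\<omega> \<in> \<Omega>" and K0: "\<And>i. (\<Prod>j<i. distortion j) \<le> K0"
  shows "\<exists>E\<in>sets cantor_measure. \<omega> \<in> E \<and> emeasure cantor_measure E = 0"
proof -
  define E where "E = (\<Inter>i. {\<omega>' \<in> \<Omega>. \<forall>j<i. \<omega>' j = \<omega> j})"
  have E: "E \<in> sets cantor_measure" unfolding E_def
    by (rule sets.countable_INT, rule image_subsetI, rule cylinder(1)[OF \<omega>], simp)
  have le: "emeasure cantor_measure E \<le> ennreal (K0 * (2 ^ i) powr (-2 * t))" for i
  proof -
    have "emeasure cantor_measure E \<le> emeasure cantor_measure {\<omega>' \<in> \<Omega>. \<forall>j<i. \<omega>' j = \<omega> j}"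
      by (rule emeasure_mono[OF _ cylinder(1)[OF \<omega>]], unfold E_def, rule INT_lower, simp)
    also have "\<dots> = ennreal (mass \<omega> i)" by (rule cylinder(2)[OF \<omega>])
    also have "\<dots> \<le> ennreal (K0 * (2 ^ i) powr (-2 * t))"
    proof (rule ennreal_leI)
      have "2 ^ i \<le> real (cden (pre \<omega> i))" using cden_pre_ge[OF \<omega>, of i] by (metis of_nat_le_iff of_nat_numeral of_nat_power)
      then have "weight t (pre \<omega> i) \<le> (2 ^ i) powr (-2 * t)"
        unfolding weight_def using t by (intro powr_mono2') auto
      moreover have "(\<Prod>j<i. distortion j) \<ge> 0"
        using Z_pos by (intro prod_nonneg) (simp add: distortion_def)
      ultimately have "(\<Prod>j<i. distortion j) * weight t (pre \<omega> i) \<le> K0 * (2 ^ i) powr (-2 * t)"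
        using K0[of i] by (intro mult_mono) (auto simp: weight_nonneg)
      with mass_le_weight[OF \<omega>, of i] show "mass \<omega> i \<le> K0 * (2 ^ i) powr (-2 * t)" by linarith
    qed
    finally show ?thesis .
  qed
  have eq: "(2 ^ i) powr (-2 * t) = (2 powr (-2 * t)) ^ i" for i
    by (simp add: powr_realpow[symmetric] powr_powr mult.commute)
  have "2 powr (-2 * t) < 2 powr 0" using t by (intro powr_less_mono) auto
  then have "(\<lambda>i. K0 * (2 ^ i) powr (-2 * t)) \<longlonglongrightarrow> K0 * 0"
    unfolding eq by (intro tendsto_mult tendsto_const LIMSEQ_realpow_zero) auto
  then have "(\<lambda>i. ennreal (K0 * (2 ^ i) powr (-2 * t))) \<longlonglongrightarrow> ennreal 0"
    by (intro tendsto_ennrealI) simp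
  then have "emeasure cantor_measure E \<le> ennreal 0"
    by (rule LIMSEQ_le_const) (use le in auto)
  moreover have "\<omega> \<in> E" using \<omega> by (simp add: E_def)
  ultimately show ?thesis using E by (intro bexI[of _ E]) auto
qed

text \<open>At most \<open>2 * Y + 1 \<le> 3 * Y\<close> first digits are near \<open>b\<close>. The
  probability is thus at most \<open>3 * Y / N i\<close>, and also at most 1; since
  \<open>t \<le> 1\<close>, the right-hand side exceeds the smaller of the two.\<close>

lemma sum_prob_of_near_le:
  assumes Ni: "N i \<noteq> 0" and Y: "Y \<ge> 1"
  shows "sum (prob_of i) {w \<in> alphabet i. \<bar>real (hd w) - real b\<bar> \<le> Y} \<le> 3 * (Y / N i) powr t"
proof -
  define S where "S = {w \<in> alphabet i. \<bar>real (hd w) - real b\<bar> \<le> Y}"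
  have Np: "real (N i) > 0" using Ni by simp
  have "sum (prob_of i) S \<le> sum (prob_of i) (alphabet i)"
    by (rule sum_mono2) (auto simp: S_def alphabet_finite prob_of_nonneg)
  then have one: "sum (prob_of i) S \<le> 1" by (simp add: sum_prob_of)
  have "sum (prob_of i) S \<le> 3 * (Y / N i)"
  proof -
    have "inj_on hd S" using Ni by (auto simp: S_def alphabet_def inj_on_def)
    then have "card S = card (hd ` S)" by (simp add: card_image)
    also have "hd ` S \<subseteq> {b - nat \<lfloor>Y\<rfloor>..b + nat \<lfloor>Y\<rfloor>}"
    proof clarify
      fix w assume "w \<in> S"
      then have "\<bar>real (hd w) - real b\<bar> \<le> Y" by (simp add: S_def)
      then have "real (hd w) - real b \<le> Y" "real b - real (hd w) \<le> Y" by linarith+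
      then have "int (hd w) - int b \<le> \<lfloor>Y\<rfloor>" "int b - int (hd w) \<le> \<lfloor>Y\<rfloor>" by (simp_all add: le_floor_iff)
      then show "hd w \<in> {b - nat \<lfloor>Y\<rfloor>..b + nat \<lfloor>Y\<rfloor>}" using Y by auto
    qed
    then have "card (hd ` S) \<le> card {b - nat \<lfloor>Y\<rfloor>..b + nat \<lfloor>Y\<rfloor>}" by (rule card_mono[rotated]) simp
    also have "\<dots> \<le> 2 * nat \<lfloor>Y\<rfloor> + 1" by simp
    finally have "real (card S) \<le> 2 * real (nat \<lfloor>Y\<rfloor>) + 1" by linarith
    also have "\<dots> \<le> 3 * Y" using Y by linarith
    finally have "real (card S) \<le> 3 * Y" .
    moreover have "sum (prob_of i) S = real (card S) / N i" using Ni by (simp add: prob_of_def)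
    ultimately show ?thesis using Np by (simp add: divide_right_mono)
  qed
  moreover have "Y / N i \<le> (Y / N i) powr t" if "Y / N i \<le> 1"
    using powr_mono'[of t 1 "Y / N i"] that t Y Np by simp
  moreover have "1 \<le> (Y / N i) powr t" if "Y / N i \<ge> 1"
    using that t by (intro ge_one_powr_ge_zero) auto
  ultimately show ?thesis using one unfolding S_def[symmetric] by (cases "Y / N i \<le> 1") linarith+
qed

text \<open>Consider the first block in which points of \<open>U\<close> differ. If it is regular,
  the diameter is at least of the order of the prefix cylinder. If it is special, \<open>U\<close>
  meets only first digits within \<open>Y\<close> of \<open>b\<close>, and the factor
  \<open>N i powr (-t)\<close> in \<open>K0N\<close> cancels the powers of \<open>N i\<close> that
  enter through \<open>Y\<close>.\<close>

lemma mass_distribution: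
  assumes K0: "K0 > 0" "\<And>i. (\<Prod>j<i. distortion j) \<le> K0"
    and K0N: "\<And>i. N i \<noteq> 0 \<Longrightarrow> (\<Prod>j<i. distortion j) \<le> K0 * real (N i) powr (-t)"
    and U: "bounded U"
    and \<kappa>: "\<kappa> = 1 / (64 * (real M + 1) ^ (3 + 2 * m))"
  shows "\<exists>E\<in>sets cantor_measure. {\<omega> \<in> space cantor_measure. point \<omega> \<in> U} \<subseteq> E
    \<and> emeasure cantor_measure E \<le> ennreal (3 * K0 * \<kappa> powr (-t) * diameter U powr t)"
proof -
  define T where "T = {\<omega> \<in> \<Omega>. point \<omega> \<in> U}"
  define d where "d = diameter U"
  have \<kappa>0: "\<kappa> > 0" by (simp add: \<kappa>)
  have d: "\<bar>point \<omega> - point \<omega>'\<bar> \<le> d" if "\<omega> \<in> T" "\<omega>' \<in> T" for \<omega> \<omega>'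
    using diameter_bounded_bound[OF U, of "point \<omega>" "point \<omega>'"] that by (simp add: T_def d_def dist_real_def)
  have "\<exists>E\<in>sets cantor_measure. T \<subseteq> E
    \<and> emeasure cantor_measure E \<le> ennreal (3 * K0 * \<kappa> powr (-t) * d powr t)"
  proof (cases "\<exists>i. \<exists>\<omega>\<in>T. \<exists>\<omega>'\<in>T. \<omega> i \<noteq> \<omega>' i")
    case False
    then have single: "\<omega> = \<omega>'" if "\<omega> \<in> T" "\<omega>' \<in> T" for \<omega> \<omega>' using that by auto
    show ?thesis
    proof (cases "T = {}")
      case True
      then show ?thesis by (intro bexI[of _ "{}"]) auto
    next
      case False
      then obtain \<omega> where \<omega>: "\<omega> \<in> T" by blast
      then obtain E where "E \<in> sets cantor_measure" "\<omega> \<in> E" "emeasure cantor_measure E = 0"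
        using singleton_null[OF _ K0(2), of \<omega>] by (auto simp: T_def)
      moreover have "T \<subseteq> {\<omega>}" using single[OF _ \<omega>] by blast
      ultimately show ?thesis by (intro bexI[of _ E]) auto
    qed
  next
    case True
    define i where "i = (LEAST i. \<exists>\<omega>\<in>T. \<exists>\<omega>'\<in>T. \<omega> i \<noteq> \<omega>' i)"
    from LeastI_ex[OF True] obtain \<omega> \<omega>' where \<omega>: "\<omega> \<in> T" "\<omega>' \<in> T" "\<omega> i \<noteq> \<omega>' i"
      unfolding i_def by blast
    have agree: "\<nu> j = \<nu>' j" if "j < i" "\<nu> \<in> T" "\<nu>' \<in> T" for j \<nu> \<nu>'
      using not_less_Least[OF that(1)[unfolded i_def]] that(2,3) by blast
    have \<Omega>: "\<omega> \<in> \<Omega>" "\<omega>' \<in> \<Omega>" using \<omega> by (auto simp: T_def)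
    define q where "q = real (cden (pre \<omega> i))"
    have q: "q > 0" using cden_pos[OF pre_pos[OF \<Omega>(1)]] by (simp add: q_def)
    have d0: "d \<ge> 0" using d[OF \<omega>(1,2)] by linarith
    have wt: "weight t (pre \<omega> i) = (1 / q\<^sup>2) powr t"
    proof -
      have "1 / q\<^sup>2 = q powr (-2)" using q by (simp add: powr_minus_divide)
      then show ?thesis by (simp add: weight_def q_def[symmetric] powr_powr)
    qed
    show ?thesis
    proof (cases "N i = 0")
      case Ni: True
      have "\<kappa> / q\<^sup>2 \<le> \<bar>point \<omega> - point \<omega>'\<bar>"
        unfolding \<kappa> q_def by (rule separation_regular[OF \<Omega> agree[OF _ \<omega>(1,2)] \<omega>(3) Ni])
      also have "\<dots> \<le> d" by (rule d[OF \<omega>(1,2)])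
      finally have "1 / q\<^sup>2 \<le> d / \<kappa>" using \<kappa>0 by (simp add: field_simps)
      then have "weight t (pre \<omega> i) \<le> (d / \<kappa>) powr t" unfolding wt using t q by (intro powr_mono2) auto
      also have "\<dots> = \<kappa> powr (-t) * d powr t" using d0 \<kappa>0 by (simp add: powr_divide powr_minus_divide)
      finally have "weight t (pre \<omega> i) \<le> \<kappa> powr (-t) * d powr t" .
      then have "K0 * weight t (pre \<omega> i) \<le> K0 * (\<kappa> powr (-t) * d powr t)" using K0(1) by simp
      moreover have "mass \<omega> i \<le> K0 * weight t (pre \<omega> i)"
        using mass_le_weight[OF \<Omega>(1), of i] mult_right_mono[OF K0(2)[of i] weight_nonneg[of t "pre \<omega> i"]] by linarith
      moreover have "0 \<le> K0 * (\<kappa> powr (-t) * d powr t)" using K0(1) by simp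
      ultimately have "mass \<omega> i \<le> 3 * K0 * \<kappa> powr (-t) * d powr t" by (simp add: mult.assoc)
      then have "emeasure cantor_measure {\<nu> \<in> \<Omega>. \<forall>j<i. \<nu> j = \<omega> j} \<le> ennreal (3 * K0 * \<kappa> powr (-t) * d powr t)"
        unfolding cylinder(2)[OF \<Omega>(1)] by (rule ennreal_leI)
      moreover have "T \<subseteq> {\<nu> \<in> \<Omega>. \<forall>j<i. \<nu> j = \<omega> j}" using agree \<omega>(1) by (auto simp: T_def)
      ultimately show ?thesis using cylinder(1)[OF \<Omega>(1)] by blast
    next
      case Ni: False
      define n where "n = real (N i)"
      have n: "n > 0" using Ni by (simp add: n_def)
      define b where "b = hd (\<omega> i)"
      \<comment> \<open>This is \<open>separation_special\<close> solved for the difference of the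
        first digits.\<close>
      define Y where "Y = d * q\<^sup>2 * n\<^sup>2 / \<kappa>"
      have near: "\<bar>real (hd (\<nu> i)) - real b\<bar> \<le> Y" if "\<nu> \<in> T" for \<nu>
      proof -
        define D where "D = \<bar>real (hd (\<nu> i)) - real b\<bar>"
        have \<nu>: "\<nu> \<in> \<Omega>" using that by (simp add: T_def)
        have pe: "pre \<nu> i = pre \<omega> i" unfolding pre_def using agree[OF _ that \<omega>(1)] by (intro arg_cong[of _ _ concat]) auto
        have "\<kappa> \<le> 1 / (64 * (real M + 1))"
          unfolding \<kappa> using self_le_power[of "real M + 1" "3 + 2 * m"] by (intro frac_le) auto
        then have "D * \<kappa> / (q\<^sup>2 * n\<^sup>2) \<le> D * (1 / (64 * (real M + 1))) / (q\<^sup>2 * n\<^sup>2)"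
          by (intro divide_right_mono mult_left_mono) (auto simp: D_def)
        also have "\<dots> \<le> \<bar>point \<nu> - point \<omega>\<bar>"
          using separation_special[OF \<nu> \<Omega>(1) agree[OF _ that \<omega>(1)] Ni] unfolding pe q_def n_def D_def b_def by simp
        also have "\<dots> \<le> d" by (rule d[OF that \<omega>(1)])
        finally show ?thesis unfolding D_def[symmetric] Y_def using q n \<kappa>0 by (simp add: field_simps)
      qed
      have "hd (\<omega>' i) \<noteq> b" using first_digit(2)[OF \<Omega>(1) Ni] first_digit(2)[OF \<Omega>(2) Ni] \<omega>(3) by (metis b_def)
      then have "1 \<le> \<bar>real (hd (\<omega>' i)) - real b\<bar>" by linarith
      then have Y: "Y \<ge> 1" using near[OF \<omega>(2)] by linarith
      define S where "S = {w \<in> alphabet i. \<bar>real (hd w) - real b\<bar> \<le> Y}"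
      have "mass \<omega> i * sum (prob_of i) S \<le> (K0 * n powr (-t) * weight t (pre \<omega> i)) * (3 * (Y / n) powr t)"
      proof (rule mult_mono)
        show "mass \<omega> i \<le> K0 * n powr (-t) * weight t (pre \<omega> i)"
          using mass_le_weight[OF \<Omega>(1), of i] mult_right_mono[OF K0N[OF Ni] weight_nonneg[of t "pre \<omega> i"]]
          unfolding n_def by linarith
        show "sum (prob_of i) S \<le> 3 * (Y / n) powr t"
          unfolding S_def n_def by (rule sum_prob_of_near_le[OF Ni Y])
        show "0 \<le> K0 * n powr (-t) * weight t (pre \<omega> i)" using K0(1) by (simp add: weight_nonneg)
        show "0 \<le> sum (prob_of i) S" by (intro sum_nonneg prob_of_nonneg)
      qed
      also have "\<dots> = 3 * K0 * ((1 / n) powr t * (1 / q\<^sup>2) powr t * (Y / n) powr t)"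
        using n by (simp add: wt powr_minus_divide powr_divide)
      also have "(1 / n) powr t * (1 / q\<^sup>2) powr t * (Y / n) powr t = (1 / n * (1 / q\<^sup>2) * (Y / n)) powr t"
        using n Y by (simp only: powr_mult[symmetric])
      also have "1 / n * (1 / q\<^sup>2) * (Y / n) = d / \<kappa>"
        using n q unfolding Y_def by (simp add: field_simps power2_eq_square)
      also have "(d / \<kappa>) powr t = \<kappa> powr (-t) * d powr t" using d0 \<kappa>0 by (simp add: powr_divide powr_minus_divide)
      finally have "mass \<omega> i * sum (prob_of i) S \<le> 3 * K0 * \<kappa> powr (-t) * d powr t" by (simp add: mult_ac)
      have S: "S \<subseteq> alphabet i" by (auto simp: S_def)
      have "emeasure cantor_measure {\<nu> \<in> \<Omega>. (\<forall>j<i. \<nu> j = \<omega> j) \<and> \<nu> i \<in> S} \<le> ennreal (3 * K0 * \<kappa> powr (-t) * d powr t)"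
        unfolding emeasure_cylinder(2)[OF \<Omega>(1) S] by (rule ennreal_leI) fact
      moreover have "T \<subseteq> {\<nu> \<in> \<Omega>. (\<forall>j<i. \<nu> j = \<omega> j) \<and> \<nu> i \<in> S}"
        using agree \<omega>(1) near by (auto simp: T_def S_def \<Omega>_alphabet)
      ultimately show ?thesis using emeasure_cylinder(1)[OF \<Omega>(1) S] by blast
    qed
  qed
  then show ?thesis unfolding T_def d_def space_cantor_measure .
qed

text \<open>For \<open>n\<close> above \<open>m * s k\<close> and up to
  \<open>m * s (Suc k)\<close>, the digit that opens block \<open>s k\<close> is already among the
  first \<open>n\<close>; it must be large enough to last until the next record, which is
  \<open>big\<close>.\<close>

lemma point_in_M_hat:
  assumes C: "C > 1" and s: "strict_mono s" and big: "\<And>k. C ^ (m * s (Suc k)) \<le> real (N (s k))" and \<omega>: "\<omega> \<in> \<Omega>"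
  shows "point \<omega> \<in> M_hat C"
proof -
  note hd = dig_ge_1[OF \<omega>] point[OF \<omega>]
  have "C ^ n \<le> max_pquot n (point \<omega>)" if n: "n \<ge> Suc (m * s 0)" for n
  proof -
    define P where "P k \<longleftrightarrow> m * s k < n" for k
    have P0: "P 0" using n by (simp add: P_def)
    have bnd: "k \<le> n" if "P k" for k
    proof -
      have "k \<le> s k" using s by (rule strict_mono_imp_increasing)
      also have "\<dots> \<le> m * s k" using m by simp
      finally show ?thesis using that by (simp add: P_def)
    qed
    define k where "k = (GREATEST k. P k)"
    have Pk: "P k" unfolding k_def by (rule GreatestI_nat[where P = P and b = n, OF P0 bnd])
    have "\<not> P (Suc k)"
    proof
      assume "P (Suc k)"
      then have "Suc k \<le> k" unfolding k_def by (rule Greatest_le_nat[where P = P and b = n]) (rule bnd)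
      then show False by simp
    qed
    then have nk: "n \<le> m * s (Suc k)" by (simp add: P_def)
    have "C ^ n \<le> C ^ (m * s (Suc k))" using nk C by (intro power_increasing) auto
    also have "\<dots> \<le> real (N (s k))" by (rule big)
    also have "\<dots> \<le> pquot (Suc (m * s k)) (point \<omega>)"
    proof -
      have Ns: "N (s k) \<noteq> 0"
      proof
        assume "N (s k) = 0"
        with big[of k] C show False by (simp add: power_le_zero_eq) 
      qed
      have "pquot (Suc (m * s k)) (point \<omega>) = dig \<omega> (m * s k)" by (rule has_digits_pquot[OF hd])
      also have "\<dots> = \<omega> (s k) ! 0" using dig_block[of 0 \<omega> "s k"] m by simp
      also have "\<dots> \<ge> N (s k)" using first_digit(2)[OF \<omega> Ns] by (metis nth_Cons_0)
      finally show ?thesis by simp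
    qed
    also have "\<dots> \<le> max_pquot n (point \<omega>)"
      using Pk by (intro of_nat_mono max_pquot_ge) (auto simp: P_def)
    finally show ?thesis .
  qed
  moreover have "point \<omega> \<in> unit_irrationals" by (rule has_digits_gauss(1)[OF hd])
  ultimately show ?thesis unfolding M_hat_def eventually_sequentially by blast
qed

end

subsection \<open>The lower bound\<close>

text \<open>With \<open>y = ln Z - t * ln 4\<close>, \<open>e = t * (m + 1) * ln 4\<close> and
  \<open>l i = ln (N (s i))\<close>, the left-hand side is the logarithm of the distortions before
  block \<open>s k\<close>, plus \<open>t * l k\<close>; bounding it gives \<open>K0N\<close>. At
  geometric positions it is at most \<open>- \<delta> * \<rho> ^ k\<close> plus terms linear in
  \<open>k\<close>.\<close>

lemma geometric_record_positions:
  fixes t B P e y :: real and m :: nat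
  assumes t: "1/2 < t" and B: "B > 0" and P: "P > ratio t * B" and m: "m > 0" and e: "e \<ge> 0" and y: "y \<ge> m * P"
  obtains s :: "nat \<Rightarrow> nat" and K where "strict_mono s"
    "\<And>k l. (\<And>i. l i \<le> m * B * s (Suc i) + ln 2) \<Longrightarrow>
      - (real (s k) - k) * y + (\<Sum>i<k. e + (2 * t - 1) * l i) + t * l k \<le> K"
proof -
  define \<alpha> where "\<alpha> = 2 * t - 1"
  have \<alpha>: "\<alpha> > 0" using t by (simp add: \<alpha>_def)
  \<comment> \<open>Below, \<open>\<rho>\<close> becomes the growth ratio of minimal cost. Then
    \<open>\<kappa> * (\<rho> - 1) = 1\<close>: consecutive values of
    \<open>\<kappa> * \<rho> ^ k\<close> differ by \<open>\<rho> ^ k \<ge> 1\<close>, so rounding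
    down keeps them distinct, and \<open>\<kappa>\<close> is also the factor
    \<open>1 / (\<rho> - 1)\<close> of the geometric sum.\<close>
  define \<kappa> where "\<kappa> = sqrt t / sqrt \<alpha>"
  have \<kappa>: "\<kappa> > 0" using t \<alpha> by (simp add: \<kappa>_def)
  define \<rho> where "\<rho> = 1 + 1 / \<kappa>"
  have \<rho>: "\<rho> > 1" "\<kappa> * \<rho> = \<kappa> + 1" using \<kappa> by (simp_all add: \<rho>_def distrib_left)
  have rat: "\<alpha> * (\<kappa> * \<rho>) + t * \<rho> = ratio t"
  proof -
    have "\<alpha> * \<kappa> = \<alpha> / sqrt \<alpha> * sqrt t" by (simp add: \<kappa>_def)
    then have "\<alpha> * \<kappa> = sqrt \<alpha> * sqrt t" using \<alpha> by (simp add: real_div_sqrt)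
    moreover have "t * (1 / \<kappa>) = t / sqrt t * sqrt \<alpha>" by (simp add: \<kappa>_def)
    then have "t * (1 / \<kappa>) = sqrt \<alpha> * sqrt t" using t by (simp add: real_div_sqrt)
    moreover have "ratio t = t + \<alpha> + 2 * (sqrt \<alpha> * sqrt t)"
      unfolding ratio_def \<alpha>_def[symmetric] using \<alpha> t by (simp add: power2_sum)
    moreover have "t * \<rho> = t + t * (1 / \<kappa>)" by (simp add: \<rho>_def distrib_left)
    moreover have "\<alpha> * (\<kappa> * \<rho>) = \<alpha> * \<kappa> + \<alpha>" unfolding \<rho>(2) by (simp add: distrib_left)
    ultimately show ?thesis by linarith
  qed
  define s where "s k = nat \<lfloor>\<kappa> * \<rho> ^ k\<rfloor>" for k
  have \<kappa>\<rho>: "\<kappa> * \<rho> ^ k \<ge> 0" for k using \<kappa> \<rho> by simp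
  have s: "real (s k) \<le> \<kappa> * \<rho> ^ k" "\<kappa> * \<rho> ^ k - 1 \<le> real (s k)" for k
    using \<kappa>\<rho>[of k] unfolding s_def by linarith+
  have next_pow: "\<kappa> * \<rho> ^ Suc k = \<kappa> * \<rho> ^ k + \<rho> ^ k" for k
  proof -
    have "\<kappa> * \<rho> ^ Suc k = (\<kappa> * \<rho>) * \<rho> ^ k" by simp
    then show ?thesis unfolding \<rho>(2) by (simp add: distrib_right)
  qed
  have mono: "strict_mono s"
  proof (rule strict_mono_Suc_iff[THEN iffD2], rule allI)
    fix k
    have "1 \<le> \<rho> ^ k" using \<rho> by simp
    then have "\<kappa> * \<rho> ^ k + 1 \<le> \<kappa> * \<rho> ^ Suc k" unfolding next_pow by linarith
    then show "s k < s (Suc k)" using \<kappa>\<rho>[of k] unfolding s_def by linarith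
  qed
  have sums: "(\<Sum>i<k. \<rho> ^ Suc i) \<le> \<kappa> * \<rho> ^ Suc k" for k
  proof (induction k)
    case 0
    then show ?case using \<kappa> \<rho> by simp
  next
    case (Suc k)
    then show ?case unfolding next_pow[of "Suc k"] by simp
  qed
  have "ratio t * B > 0" using ratio_pos[OF t] B by simp
  then have P0: "P > 0" using P by linarith
  \<comment> \<open>The gain per unit of \<open>\<rho> ^ k\<close>, positive because
    \<open>P\<close> exceeds \<open>ratio t * B\<close>; \<open>c1\<close> collects the losses per
    record.\<close>
  define \<delta> where "\<delta> = m * \<kappa> * (P - ratio t * B)"
  have \<delta>: "\<delta> > 0" unfolding \<delta>_def using m \<kappa> P by (intro mult_pos_pos) auto
  define c1 where "c1 = m * P + e + \<alpha> * ln 2"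
  have c1: "c1 \<ge> 0" unfolding c1_def using P0 e \<alpha> by (intro add_nonneg_nonneg mult_nonneg_nonneg) auto
  have "(\<lambda>k. real k / \<rho> ^ k) \<longlonglongrightarrow> 0" using \<rho>(1) by real_asymp
  then have "(\<lambda>k. c1 * (real k / \<rho> ^ k)) \<longlonglongrightarrow> c1 * 0" by (intro tendsto_mult tendsto_const)
  then have "\<forall>\<^sub>F k in sequentially. c1 * (real k / \<rho> ^ k) < \<delta>" using \<delta> by (intro order_tendstoD) auto
  then obtain k0 where k0: "\<And>k. k \<ge> k0 \<Longrightarrow> c1 * (real k / \<rho> ^ k) < \<delta>" unfolding eventually_sequentially by blast
  have lin: "c1 * k - \<delta> * \<rho> ^ k \<le> c1 * k0" for k
  proof (cases "k \<ge> k0")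
    case True
    have "c1 * k \<le> \<delta> * \<rho> ^ k" using k0[OF True] \<rho>(1) by (simp add: field_simps)
    moreover have "0 \<le> c1 * k0" using c1 by simp
    ultimately show ?thesis by linarith
  next
    case False
    then have "c1 * k \<le> c1 * k0" using c1 by (intro mult_left_mono) auto
    moreover have "0 \<le> \<delta> * \<rho> ^ k" using \<delta> \<rho> by simp
    ultimately show ?thesis by linarith
  qed
  show ?thesis
  proof (rule that[OF mono])
    fix k l assume l: "\<And>i. l i \<le> m * B * s (Suc i) + ln 2"
    have ls: "l i \<le> m * B * (\<kappa> * \<rho> ^ Suc i) + ln 2" for i
      using l[of i] mult_left_mono[OF s(1)[of "Suc i"], of "m * B"] B by simp
    have "real (s k) - k \<ge> 0" using strict_mono_imp_increasing[OF mono, of k] by simp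
    then have "(real (s k) - k) * (m * P) \<le> (real (s k) - k) * y" using y by (intro mult_left_mono)
    moreover have "(\<kappa> * \<rho> ^ k - 1 - k) * (m * P) \<le> (real (s k) - k) * (m * P)"
      using s(2)[of k] P0 by (intro mult_right_mono) auto
    ultimately have 1: "- (real (s k) - k) * y \<le> - (\<kappa> * \<rho> ^ k - 1 - k) * (m * P)" by linarith
    have "(\<Sum>i<k. e + \<alpha> * l i) \<le> (\<Sum>i<k. (e + \<alpha> * ln 2) + \<alpha> * (m * B * \<kappa>) * \<rho> ^ Suc i)"
    proof (rule sum_mono)
      fix i
      have "\<alpha> * l i \<le> \<alpha> * (m * B * (\<kappa> * \<rho> ^ Suc i) + ln 2)" using ls \<alpha> by (intro mult_left_mono) auto
      then show "e + \<alpha> * l i \<le> (e + \<alpha> * ln 2) + \<alpha> * (m * B * \<kappa>) * \<rho> ^ Suc i" by (simp add: algebra_simps)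
    qed
    also have "\<dots> = k * (e + \<alpha> * ln 2) + \<alpha> * (m * B * \<kappa>) * (\<Sum>i<k. \<rho> ^ Suc i)"
      by (simp add: sum.distrib sum_distrib_left)
    also have "\<dots> \<le> k * (e + \<alpha> * ln 2) + \<alpha> * (m * B * \<kappa>) * (\<kappa> * \<rho> ^ Suc k)"
      using \<alpha> B \<kappa> by (intro add_left_mono mult_left_mono sums) auto
    finally have 2: "(\<Sum>i<k. e + \<alpha> * l i) \<le> k * (e + \<alpha> * ln 2) + \<alpha> * (m * B * \<kappa>) * (\<kappa> * \<rho> ^ Suc k)" .
    have 3: "t * l k \<le> t * (m * B * (\<kappa> * \<rho> ^ Suc k) + ln 2)" using ls t by (intro mult_left_mono) auto
    have "- (\<kappa> * \<rho> ^ k - 1 - k) * (m * P) + (k * (e + \<alpha> * ln 2) + \<alpha> * (m * B * \<kappa>) * (\<kappa> * \<rho> ^ Suc k))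
        + t * (m * B * (\<kappa> * \<rho> ^ Suc k) + ln 2)
      = c1 * k + m * P + t * ln 2 - m * \<kappa> * \<rho> ^ k * P + m * \<kappa> * \<rho> ^ k * B * (\<alpha> * (\<kappa> * \<rho>) + t * \<rho>)"
      unfolding c1_def by (simp add: algebra_simps)
    also have "\<dots> = c1 * k - \<delta> * \<rho> ^ k + (m * P + t * ln 2)"
      unfolding rat \<delta>_def by (simp add: algebra_simps)
    also have "\<dots> \<le> c1 * k0 + (m * P + t * ln 2)" using lin[of k] by linarith
    finally show "- (real (s k) - k) * y + (\<Sum>i<k. e + (2 * t - 1) * l i) + t * l k \<le> c1 * k0 + (m * P + t * ln 2)"
      using 1 2 3 unfolding \<alpha>_def[symmetric] by linarith
  qed
qed

text \<open>\<open>k\<close> is the number of special blocks among the first \<open>i\<close>, so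
  the remaining \<open>i - k\<close> are regular.\<close>

lemma (in block_cantor) prod_distortion:
  fixes s :: "nat \<Rightarrow> nat"
  assumes s: "strict_mono s" and range: "\<And>i. N i \<noteq> 0 \<longleftrightarrow> i \<in> range s"
  shows "(\<And>l. l < k \<Longrightarrow> s l < i) \<Longrightarrow> i \<le> s k \<Longrightarrow>
    (\<Prod>j<i. distortion j) = exp (- (real i - k) * (ln Z - t * ln 4)
      + (\<Sum>l<k. t * (m + 1) * ln 4 + (2 * t - 1) * ln (N (s l))))"
proof (induction i arbitrary: k)
  case 0
  then have "k = 0" by (cases k) auto
  then show ?case by simp
next
  case (Suc i)
  show ?case
  proof (cases "i \<in> range s")
    case True
    then obtain l where l: "i = s l" by blast
    have "l < k" using Suc.prems(2) l s by (simp add: strict_mono_less Suc_le_eq)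
    moreover have "k \<le> Suc l"
    proof (rule ccontr)
      assume "\<not> k \<le> Suc l"
      then have "s (Suc l) < Suc (s l)" using Suc.prems(1)[of "Suc l"] l by simp
      moreover have "s l < s (Suc l)" using s by (simp add: strict_mono_less)
      ultimately show False by simp
    qed
    ultimately have k: "k = Suc l" by simp
    have IH: "(\<Prod>j<i. distortion j) = exp (- (real i - l) * (ln Z - t * ln 4)
      + (\<Sum>l<l. t * (m + 1) * ln 4 + (2 * t - 1) * ln (N (s l))))"
      by (rule Suc.IH) (use s l in \<open>auto simp: strict_mono_less\<close>)
    have Np: "N i \<noteq> 0" using range True by simp
    then have "distortion i = exp (t * (m + 1) * ln 4 + (2 * t - 1) * ln (N (s l)))"
      unfolding l by (simp add: distortion_def exp_add powr_def mult_ac)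
    then show ?thesis unfolding k prod.lessThan_Suc IH by (simp add: exp_add mult_ac)
  next
    case False
    have less: "s l < i" if "l < k" for l
      using Suc.prems(1)[OF that] False by (metis less_antisym rangeI)
    have IH: "(\<Prod>j<i. distortion j) = exp (- (real i - k) * (ln Z - t * ln 4)
      + (\<Sum>l<k. t * (m + 1) * ln 4 + (2 * t - 1) * ln (N (s l))))"
      by (rule Suc.IH[OF less]) (use Suc.prems(2) in auto)
    have "N i = 0" using range False by blast
    then have "distortion i = exp (- (ln Z - t * ln 4))"
      using Z_pos by (simp add: distortion_def exp_diff powr_def exp_minus)
    then have "(\<Prod>j<Suc i. distortion j) = exp ((- (real i - k) * (ln Z - t * ln 4)
      + (\<Sum>l<k. t * (m + 1) * ln 4 + (2 * t - 1) * ln (N (s l)))) + (- (ln Z - t * ln 4)))"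
      unfolding prod.lessThan_Suc IH by (simp only: exp_add)
    then show ?thesis by (simp add: algebra_simps)
  qed
qed

text \<open>By \<open>y\<close> no regular block increases the product, so it is largest right after
  a record. There the additional factor contains \<open>N powr (2 * t - 1)\<close>, at most
  \<open>N powr t\<close> as \<open>t \<le> 1\<close>, which the bound \<open>K\<close> already
  covers; the extra constant goes into \<open>K0\<close>.\<close>

lemma (in block_cantor) distortion_bounds:
  fixes s :: "nat \<Rightarrow> nat"
  assumes s: "strict_mono s" and range: "\<And>i. N i \<noteq> 0 \<longleftrightarrow> i \<in> range s"
    and y: "ln Z - t * ln 4 \<ge> 0"
    and K: "\<And>k. - (real (s k) - k) * (ln Z - t * ln 4)
      + (\<Sum>i<k. t * (m + 1) * ln 4 + (2 * t - 1) * ln (N (s i))) + t * ln (N (s k)) \<le> K"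
  defines "K0 \<equiv> exp (\<bar>K\<bar> + t * (m + 1) * ln 4)"
  shows "(\<Prod>j<i. distortion j) \<le> K0" and "N i \<noteq> 0 \<Longrightarrow> (\<Prod>j<i. distortion j) \<le> K0 * real (N i) powr (-t)"
proof -
  define e where "e = t * (m + 1) * ln 4"
  have e: "e \<ge> 0" using t by (simp add: e_def)
  show "(\<Prod>j<i. distortion j) \<le> K0 * real (N i) powr (-t)" if Ni: "N i \<noteq> 0"
  proof -
    obtain k where k: "i = s k" using Ni range by blast
    have "(\<Prod>j<i. distortion j) = exp (- (real i - k) * (ln Z - t * ln 4) + (\<Sum>l<k. e + (2 * t - 1) * ln (N (s l))))"
      unfolding e_def by (rule prod_distortion[OF s range]) (use s k in \<open>auto simp: strict_mono_less\<close>)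
    also have "\<dots> \<le> exp (\<bar>K\<bar> + e + - t * ln (N i))"
      using K[of k] e unfolding k e_def[symmetric] by simp
    also have "\<dots> = K0 * real (N i) powr (-t)"
      using Ni unfolding exp_add K0_def e_def by (simp add: powr_def)
    finally show ?thesis .
  qed
  define k where "k = (LEAST k. i \<le> s k)"
  have ik: "i \<le> s k" unfolding k_def by (rule LeastI[of _ i]) (rule strict_mono_imp_increasing[OF s])
  have less: "s l < i" if "l < k" for l using not_less_Least[OF that[unfolded k_def]] by simp
  have eq: "(\<Prod>j<i. distortion j) = exp (- (real i - k) * (ln Z - t * ln 4) + (\<Sum>l<k. e + (2 * t - 1) * ln (N (s l))))"
    unfolding e_def by (rule prod_distortion[OF s range less ik])
  have "- (real i - k) * (ln Z - t * ln 4) + (\<Sum>l<k. e + (2 * t - 1) * ln (N (s l))) \<le> \<bar>K\<bar> + e"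
  proof (cases k)
    case 0
    have "0 \<le> real i * (ln Z - t * ln 4)" using y by (rule mult_nonneg_nonneg[OF of_nat_0_le_iff])
    moreover have "0 \<le> \<bar>K\<bar>" by simp
    ultimately show ?thesis using e
      unfolding 0 lessThan_0 sum.empty of_nat_0 diff_0_right mult_minus_left by linarith
  next
    case (Suc l)
    have "real (s l) - l \<le> real i - k" using less[of l] Suc by simp
    then have 1: "(real (s l) - l) * (ln Z - t * ln 4) \<le> (real i - k) * (ln Z - t * ln 4)"
      using y by (rule mult_right_mono)
    have "N (s l) \<noteq> 0" using range by blast
    then have "ln (N (s l)) \<ge> 0" by simp
    then have 2: "(2 * t - 1) * ln (N (s l)) \<le> t * ln (N (s l))" using t by (intro mult_right_mono) auto
    show ?thesis using 1 2 K[of l] unfolding Suc e_def[symmetric] sum.lessThan_Suc minus_mult_left[symmetric] by linarith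
  qed
  then show "(\<Prod>j<i. distortion j) \<le> K0" unfolding eq K0_def e_def by simp
qed

text \<open>Finiteness bounds the digits, as the separation of points requires; at most half of the
  sum is lost.\<close>

lemma finite_words_weight:
  assumes t: "t > 1/2"
  obtains W where "finite W" "W \<noteq> {}" "W \<subseteq> words m" "sum (weight t) W \<ge> exp (m * pressure t) / 2"
proof -
  have "(weight t has_sum weight_sum t m) (words m)"
    unfolding weight_sum_def using weight_summable[OF t] by simp
  then have "\<forall>\<^sub>F F in finite_subsets_at_top (words m). sum (weight t) F > weight_sum t m / 2"
    unfolding has_sum_def by (rule order_tendstoD) (use weight_sum_pos[OF t, of m] in simp)
  then obtain W where W: "finite W" "W \<subseteq> words m" "sum (weight t) W > weight_sum t m / 2"
    unfolding eventually_finite_subsets_at_top by blast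
  show ?thesis
  proof (rule that[OF W(1) _ W(2)])
    show "W \<noteq> {}" using W(3) weight_sum_pos[OF t, of m] by auto
    show "exp (m * pressure t) / 2 \<le> sum (weight t) W" using W(3) pressure_limit(2)[OF t, of m] by linarith
  qed
qed

theorem hausdorff_measure_M_hat_neq_0:
  assumes C: "C > 1" and t: "1/2 < t" "t \<le> 1" and less: "ratio t * ln C < pressure t"
    and u: "0 \<le> u" "u \<le> t"
  shows "hausdorff_measure u (M_hat C) \<noteq> 0"
proof -
  define B where "B = ln C"
  have B: "B > 0" using C by (simp add: B_def)
  define P where "P = (ratio t * B + pressure t) / 2"
  have P: "ratio t * B < P" "P < pressure t" using less by (simp_all add: P_def B_def)
  have "ratio t * B > 0" using ratio_pos[OF t(1)] B by simp
  then have P0: "P > 0" using P by linarith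
  \<comment> \<open>Over \<open>m\<close> digits the slack \<open>pressure t - P\<close> pays for
    the factor 2 lost to finiteness and the factor \<open>4 powr t\<close> lost to gluing. Adding 2
    ensures \<open>m \<ge> 2\<close>.\<close>
  define m where "m = nat \<lceil>(ln 2 + t * ln 4) / (pressure t - P)\<rceil> + 2"
  have m: "m \<ge> 2" "(ln 2 + t * ln 4) / (pressure t - P) \<le> m" unfolding m_def by linarith+
  then have mP: "ln 2 + t * ln 4 \<le> m * (pressure t - P)" using P by (simp add: pos_divide_le_eq)
  obtain W where W: "finite W" "W \<noteq> {}" "W \<subseteq> words m" "sum (weight t) W \<ge> exp (m * pressure t) / 2"
    using finite_words_weight[OF t(1)] by metis
  define y where "y = ln (sum (weight t) W) - t * ln 4"
  have "ln (exp (m * pressure t) / 2) \<le> ln (sum (weight t) W)"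
    using W(4) by (intro ln_mono) (auto intro: less_le_trans[of 0 "exp (m * pressure t) / 2"])
  then have y: "y \<ge> m * P" using mP by (simp add: y_def ln_div algebra_simps)
  have y0: "y \<ge> 0" using y P0 by (meson mult_nonneg_nonneg of_nat_0_le_iff less_imp_le order_trans)
  define e where "e = t * (m + 1) * ln 4"
  have e: "e \<ge> 0" using t by (simp add: e_def)
  obtain s K where s: "strict_mono s" and K: "\<And>k l. (\<And>i. l i \<le> m * B * s (Suc i) + ln 2) \<Longrightarrow>
      - (real (s k) - k) * y + (\<Sum>i<k. e + (2 * t - 1) * l i) + t * l k \<le> K"
    by (rule geometric_record_positions[OF t(1) B P(1) _ e y]) (use m(1) in auto)
  define M where "M = Suc (Max (\<Union>(set ` W)))"
  have WM: "set w \<subseteq> {..M}" if "w \<in> W" for w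
  proof
    fix a assume "a \<in> set w"
    then have "a \<le> Max (\<Union>(set ` W))" using that W(1) by (intro Max_ge) auto
    then show "a \<in> {..M}" by (simp add: M_def)
  qed
  \<comment> \<open>The sizes are those demanded by \<open>point_in_M_hat\<close>. Rounding up costs
    at most a factor 2, the \<open>ln 2\<close> allowed in
    \<open>geometric_record_positions\<close>.\<close>
  define N where "N i = (if i \<in> range s then nat \<lceil>C ^ (m * s (Suc (inv s i)))\<rceil> else 0)" for i
  have Ns: "N (s k) = nat \<lceil>C ^ (m * s (Suc k))\<rceil>" for k
    by (simp add: N_def inv_f_f[OF strict_mono_imp_inj_on[OF s]])
  have C1: "C ^ (m * s (Suc k)) > 1" for k
  proof -
    have "s (Suc k) > 0" using strict_mono_imp_increasing[OF s, of "Suc k"] by simp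
    then show ?thesis using C m by (intro one_less_power) auto
  qed
  have N2: "N (s k) \<ge> 2" for k using C1[of k] unfolding Ns by linarith
  have range: "N i \<noteq> 0 \<longleftrightarrow> i \<in> range s" for i
  proof
    show "N i \<noteq> 0 \<Longrightarrow> i \<in> range s" unfolding N_def by (simp split: if_splits)
    assume "i \<in> range s"
    then obtain k where "i = s k" by blast
    then show "N i \<noteq> 0" using N2[of k] by simp
  qed
  interpret block_cantor m M W N t
  proof
    show "N i = 0 \<or> N i \<ge> 2" for i
    proof (cases "N i = 0")
      case False
      then obtain k where "i = s k" using range[of i] by blast
      then show ?thesis using N2[of k] by simp
    qed simp
  qed (use m W WM t in \<open>auto simp: M_def\<close>)
  have yZ: "y = ln Z - t * ln 4" by (simp add: y_def Z_def)
  have lN: "ln (N (s i)) \<le> m * B * s (Suc i) + ln 2" for i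
  proof -
    have "real (N (s i)) \<le> 2 * C ^ (m * s (Suc i))" using C1[of i] unfolding Ns by linarith
    then have "ln (N (s i)) \<le> ln (2 * C ^ (m * s (Suc i)))" using N2[of i] by (intro ln_mono) auto
    also have "\<dots> = m * B * s (Suc i) + ln 2" using C by (simp add: ln_mult ln_realpow B_def algebra_simps)
    finally show ?thesis .
  qed
  define K0 where "K0 = exp (\<bar>K\<bar> + t * (m + 1) * ln 4)"
  have K0: "(\<Prod>j<i. distortion j) \<le> K0" "N i \<noteq> 0 \<Longrightarrow> (\<Prod>j<i. distortion j) \<le> K0 * real (N i) powr (-t)" for i
    unfolding K0_def using distortion_bounds[OF s range y0[unfolded yZ], of K i] K[of "\<lambda>i. ln (N (s i))", OF lN]
    by (simp_all add: e_def yZ)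
  define \<kappa> where "\<kappa> = 1 / (64 * (real M + 1) ^ (3 + 2 * m))"
  have \<kappa>: "\<kappa> > 0" by (simp add: \<kappa>_def)
  have "C ^ (m * s (Suc k)) \<le> real (N (s k))" for k unfolding Ns by linarith
  note pt = point_in_M_hat[OF C s this]
  show ?thesis
  proof (rule hausdorff_measure_neq_0_mass_distribution[OF prob_space_cantor_measure _ _ u])
    show "point w \<in> M_hat C" if "w \<in> space cantor_measure" for w
      using that pt by (simp add: space_cantor_measure)
    show "0 < 3 * K0 * \<kappa> powr (-t)" using \<kappa> by (simp add: K0_def)
    show "\<exists>E\<in>sets cantor_measure. {w \<in> space cantor_measure. point w \<in> U} \<subseteq> E
      \<and> emeasure cantor_measure E \<le> ennreal (3 * K0 * \<kappa> powr (-t) * diameter U powr t)" if "bounded U" for U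
      by (rule mass_distribution[OF _ K0 that \<kappa>_def]) (simp_all add: K0_def)
  qed
qed

theorem theorem8:
  fixes C :: real
  assumes "C > 1"
  shows "(\<exists>!\<theta>. \<theta> > 1/2 \<and> pressure \<theta> = (sqrt \<theta> + sqrt (2 * \<theta> - 1))\<^sup>2 * ln C)
    \<and> hausdorff_dim (M_hat C) = ereal (theta_hat (ln C))"
proof -
  have B: "ln C > 0" using assms by simp
  obtain t where t: "1/2 < t" "t < 1" "pressure t = ratio t * ln C"
    and above: "\<And>u. t < u \<Longrightarrow> pressure u < ratio u * ln C"
    and below: "\<And>u. 1/2 < u \<Longrightarrow> u < t \<Longrightarrow> pressure u > ratio u * ln C"
    using pressure_equation[OF B] by metis
  have sol: "t > 1/2 \<and> pressure t = (sqrt t + sqrt (2 * t - 1))\<^sup>2 * ln C"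
    using t by (simp add: ratio_def)
  have uniq: "u = t" if "u > 1/2 \<and> pressure u = (sqrt u + sqrt (2 * u - 1))\<^sup>2 * ln C" for u
    using that above[of u] below[of u] unfolding ratio_def by (cases u t rule: linorder_cases) auto
  have "theta_hat (ln C) = t" unfolding theta_hat_def using sol uniq by (rule the_equality)
  moreover have "hausdorff_dim (M_hat C) = ereal t"
  \<comment> \<open>Any number above \<open>t\<close> could replace \<open>t + 1\<close>, as the
    upper bound works for all larger exponents; 1/2 is where the pressure starts to be
    finite.\<close>
  proof (rule hausdorff_dim_eqI[of "1/2" t "t + 1"])
    show "hausdorff_measure s (M_hat C) = 0" if "t < s" for s
      using that t above[OF that] by (intro hausdorff_measure_M_hat_eq_0 assms) auto
    show "hausdorff_measure s (M_hat C) \<noteq> 0" if "1/2 < u" "u < t" "0 \<le> s" "s \<le> u" for u s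
      using that t by (intro hausdorff_measure_M_hat_neq_0[OF assms that(1) _ below[OF that(1,2)]]) auto
  qed (use t in auto)
  ultimately show ?thesis using sol uniq by blast
qed

end
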